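(* Let $\mathcal{P}$ be the subalgebra of $(\mathcal{F},\star)$ generated by the characteristic functions $\mathbf{1}_{K_u}$ of the cones $K_u$, $u$ ranging over packed words. The linear map $\alpha:\mathcal{P}\to\mathbf{WQSym}$ defined by $$\mathbf{1}_{C_u}\mapsto(-1)^{\max(u)}\Phi_u$$ is an isomorphism of algebras.
   Context: Packed words: a word $u$ over the positive integers is packed if its set of letters is $\{1,\dots,r\}$, $r=\max(u)$ (the empty word is packed). $\mathrm{pack}(w)$ replaces the distinct letters $b_1<\dots<b_r$ of a word $w$ by $1,\dots,r$. $\mathrm{ev}(u)$ is the composition whose $i$-th part is the number of occurrences of $i$ in $u$. The standardization $\mathrm{Std}(w)$ is the permutation obtained by numbering $1,2,\dots$ the occurrences of the smallest letter from left to right, then those of the next letter, and so on. A packed word $u$ of length $n$ encodes the set composition $(B_1,\dots,B_r)$ of $\{1,\dots,n\}$ ($B_k$ = set of positions of the letter $k$), and the segmented permutation $\sigma$ obtained by writing the elements of each block $B_k$ in increasing order, blocks in order $B_1,B_2,\dots,B_r$, with bars between consecutive blocks. $\mathbf{WQSym}$ (over $\mathbb{R}$): algebra with basis $\mathbf{M}_u=\sum_{\mathrm{pack}(w)=u}w$ ($u$ packed; sum over words over an infinite totally ordered alphabet of noncommuting variables), a subalgebra of the algebra of noncommutative series of finite degree. For packed words, $v\succeq u$ ($v$ finer than $u$) means $\mathrm{Std}(v)=\mathrm{Std}(u)$ and the composition $\mathrm{ev}(v)$ is finer than or equal to $\mathrm{ev}(u)$. The basis $\Phi_u$ is $\Phi_u=\sum_{v\succeq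 u}\mathbf{M}_v$. Cones: $K_u\subset\mathbb{R}^n$ is defined by $\sum_{j=1}^k\sum_{i\in B_j}x_i\ge0$ for $k=1,\dots,r$. $C_u\subset\mathbb{R}^n$ is defined by the conditions, for $k=1,\dots,n$: $\sum_{i=1}^kx_{\sigma_i}<0$ if $\sigma_k$ is not the end of a block of $\sigma$, and $\sum_{i=1}^kx_{\sigma_i}\ge0$ otherwise. $\mathcal{F}=\bigoplus_{n\ge0}\mathcal{F}_n$, where $\mathcal{F}_n$ is the space of measurable functions $\mathbb{R}^n\to\mathbb{R}$ modulo equality almost everywhere, with product $(f\star g)(x_1,\dots,x_{m+n})=f(x_1,\dots,x_m)g(x_{m+1},\dots,x_{m+n})$ for $f\in\mathcal{F}_m$, $g\in\mathcal{F}_n$. *)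

theory Defs
  imports "HOL-Analysis.Analysis"
begin

section \<open>Packed words\<close>

definition packed :: "nat list \<Rightarrow> bool" where
  "packed u \<longleftrightarrow> (\<exists>r. set u = {1..r})"

definition word_max :: "nat list \<Rightarrow> nat" where
  "word_max u = (if u = [] then 0 else Max (set u))"

text \<open>If \<open>b\<^sub>1 < \<dots> < b\<^sub>r\<close> are the letters of \<open>w\<close>, then \<open>b\<^sub>k\<close> is the letter with exactly \<open>k\<close> letters
  of \<open>w\<close> weakly below it.\<close>

definition pack :: "'a::linorder list \<Rightarrow> nat list" where
  "pack w = map (\<lambda>a. card {b \<in> set w. b \<le> a}) w"

definition ev :: "nat list \<Rightarrow> nat list" where
  "ev u = map (count_list u) [1..<Suc (word_max u)]"

text \<open>The number received by position \<open>i\<close> is the number of positions that are numbered no later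
  than \<open>i\<close>: those carrying a smaller letter, and those carrying the same letter weakly to the left.\<close>

definition Std :: "'a::linorder list \<Rightarrow> nat list" where
  "Std w = map (\<lambda>i. card {j. j < length w \<and> (w ! j < w ! i \<or> w ! j = w ! i \<and> j \<le> i)})
             [0..<length w]"

text \<open>\<open>finer_comp d c\<close>: the composition \<open>d\<close> is finer than or equal to \<open>c\<close>, that is, the parts
  of \<open>c\<close> are the sums of consecutive nonempty runs of parts of \<open>d\<close>.\<close>

definition finer_comp :: "nat list \<Rightarrow> nat list \<Rightarrow> bool" where
  "finer_comp d c \<longleftrightarrow> (\<exists>dss. [] \<notin> set dss \<and> concat dss = d \<and> map sum_list dss = c)"

definition finer_word :: "nat list \<Rightarrow> nat list \<Rightarrow> bool" where
  "finer_word v u \<longleftrightarrow> packed u \<and> packed v \<and> Std v = Std u \<and> finer_comp (ev v) (ev u)"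

text \<open>Positions, and hence coordinates of \<open>\<real>\<^sup>n\<close>, are numbered from \<open>0\<close> to \<open>n - 1\<close>.\<close>

definition block :: "nat list \<Rightarrow> nat \<Rightarrow> nat set" where
  "block u k = {i. i < length u \<and> u ! i = k}"

text \<open>The segmented permutation of \<open>u\<close> is the list of its segments; erasing the bars is \<open>concat\<close>.\<close>

definition seg_perm :: "nat list \<Rightarrow> nat list list" where
  "seg_perm u = map (\<lambda>k. sorted_list_of_set (block u k)) [1..<Suc (word_max u)]"

definition block_end :: "nat list \<Rightarrow> nat \<Rightarrow> bool" where
  "block_end u p \<longleftrightarrow> p \<in> last ` set (seg_perm u)"


section \<open>The cones\<close>

text \<open>\<open>\<real>\<^sup>n\<close> with Lebesgue measure, for \<open>n\<close> a term: its points are the extensional functions on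
  \<open>{..<n}\<close>. For \<open>n = 0\<close> it is a point of mass one.\<close>

definition leb :: "nat \<Rightarrow> (nat \<Rightarrow> real) measure" where
  "leb n = PiM {..<n} (\<lambda>_. lborel)"

definition K_cone :: "nat list \<Rightarrow> (nat \<Rightarrow> real) set" where
  "K_cone u = {x \<in> space (leb (length u)).
     \<forall>k\<in>{1..word_max u}. (\<Sum>j=1..k. \<Sum>i\<in>block u j. x i) \<ge> 0}"

definition C_cone :: "nat list \<Rightarrow> (nat \<Rightarrow> real) set" where
  "C_cone u = {x \<in> space (leb (length u)).
     \<forall>k<length u. let \<sigma> = concat (seg_perm u); s = (\<Sum>i\<le>k. x (\<sigma> ! i)) in
       if block_end u (\<sigma> ! k) then s \<ge> 0 else s < 0}"

lemma length_pack [simp]: "length (pack w) = length w"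
  by (simp add: pack_def)

lemma set_pack_le: "packed v \<Longrightarrow> set v \<subseteq> {..length v}"
proof -
  assume "packed v"
  then obtain r where r: "set v = {1..r}" by (auto simp: packed_def)
  then have "r \<le> length v" using card_length[of v] by simp
  with r show ?thesis by auto
qed

lemma finite_finer: "finite {v. finer_word v u}"
proof (rule finite_subset)
  show "{v. finer_word v u} \<subseteq> {v. set v \<subseteq> {..length u} \<and> length v = length u}"
  proof safe
    fix v x assume *: "finer_word v u"
    then have "length (Std v) = length (Std u)" by (simp add: finer_word_def)
    then show l: "length v = length u" by (simp add: Std_def)
    assume "x \<in> set v"
    with * l set_pack_le[of v] show "x \<le> length u" by (auto simp: finer_word_def)
  qed
  show "finite {v. set v \<subseteq> {..length u} \<and> length v = length u}"
    by (rule finite_lists_length_eq) simp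
qed

lemma set_concat_seg_perm: "set (concat (seg_perm u)) \<subseteq> {..<length u}"
  by (auto simp: seg_perm_def block_def)

lemma sum_card_blocks:
  assumes "packed u" shows "length (concat (seg_perm u)) = length u"
proof -
  have r: "set u = {1..word_max u}"
  proof -
    obtain r where r: "set u = {1..r}" using assms by (auto simp: packed_def)
    show ?thesis
    proof (cases "u = []")
      case False
      then have "r \<ge> 1" using r by (cases r) auto
      then have "Max {1..r} = r" by (intro Max_eqI) auto
      with r False show ?thesis by (simp add: word_max_def)
    qed (simp add: word_max_def)
  qed
  have "length (concat (seg_perm u)) = (\<Sum>k\<leftarrow>[1..<Suc (word_max u)]. card (block u k))"
    by (simp add: seg_perm_def length_concat comp_def del: upt_Suc)
  also have "\<dots> = (\<Sum>k\<in>{1..word_max u}. card (block u k))"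
    by (subst sum_list_distinct_conv_sum_set) (auto simp: atLeastLessThanSuc_atLeastAtMost simp del: upt_Suc)
  also have "\<dots> = card (\<Union>k\<in>{1..word_max u}. block u k)"
    by (rule card_UN_disjoint[symmetric]) (auto simp: block_def)
  also have "(\<Union>k\<in>{1..word_max u}. block u k) = {..<length u}"
    using r nth_mem[of _ u] by (auto simp: block_def)
  finally show ?thesis by simp
qed

lemma sets_K_cone: "K_cone u \<in> sets (leb (length u))"
proof -
  have 1: "(\<lambda>x. x i) \<in> borel_measurable (leb (length u))" if "i \<in> block u j" for i j
    using that unfolding leb_def block_def
    by (auto intro!: measurable_component_singleton[of i _ "\<lambda>_. lborel", simplified])
  show ?thesis
    unfolding K_cone_def
    by (intro sets.sets_Collect_finite_All' sets.sets_Collect_finite_All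
          borel_measurable_le borel_measurable_const borel_measurable_sum 1) auto
qed

lemma sets_C_cone:
  assumes "packed u" shows "C_cone u \<in> sets (leb (length u))"
proof -
  let ?s = "concat (seg_perm u)"
  have 1: "(\<lambda>x. x (?s ! i)) \<in> borel_measurable (leb (length u))" if "i \<le> k" "k < length u" for i k
  proof -
    have "?s ! i \<in> set ?s" using that sum_card_blocks[OF assms] by (intro nth_mem) auto
    then have "?s ! i < length u" using set_concat_seg_perm by blast
    then show ?thesis unfolding leb_def
      by (auto intro!: measurable_component_singleton[of _ _ "\<lambda>_. lborel", simplified])
  qed
  have 2: "(\<lambda>x. \<Sum>i\<le>k. x (?s ! i)) \<in> borel_measurable (leb (length u))" if "k < length u" for k
    using that by (intro borel_measurable_sum 1) auto
  have 3: "{x \<in> space (leb (length u)). if b then (\<Sum>i\<le>k. x (?s ! i)) \<ge> 0 else (\<Sum>i\<le>k. x (?s ! i)) < 0}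
      \<in> sets (leb (length u))" if "k < length u" for k b
    using 2[OF that] by (cases b) auto
  have "{x \<in> space (leb (length u)). \<forall>k\<in>{..<length u}.
      if block_end u (?s ! k) then (\<Sum>i\<le>k. x (?s ! i)) \<ge> 0 else (\<Sum>i\<le>k. x (?s ! i)) < 0}
      \<in> sets (leb (length u))"
    by (intro sets.sets_Collect_finite_All 3) auto
  then show ?thesis unfolding C_cone_def Let_def Ball_def lessThan_iff .
qed


section \<open>The algebra of measurable functions modulo equality almost everywhere\<close>

text \<open>\<open>slice i n x\<close> is \<open>(x\<^sub>i\<^sub>+\<^sub>1, \<dots>, x\<^sub>i\<^sub>+\<^sub>n)\<close> in one-based numbering.\<close>

definition slice :: "nat \<Rightarrow> nat \<Rightarrow> (nat \<Rightarrow> real) \<Rightarrow> (nat \<Rightarrow> real)" where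
  "slice i n x = (\<lambda>j\<in>{..<n}. x (i + j))"

definition star :: "nat \<Rightarrow> nat \<Rightarrow> ((nat \<Rightarrow> real) \<Rightarrow> real) \<Rightarrow> ((nat \<Rightarrow> real) \<Rightarrow> real)
    \<Rightarrow> ((nat \<Rightarrow> real) \<Rightarrow> real)" where
  "star m n f g x = f (slice 0 m x) * g (slice m n x)"

text \<open>Representatives of elements of the direct sum: \<open>f n\<close> is the component of degree \<open>n\<close>.
  Borel measurable representatives suffice, since every Lebesgue measurable function is almost
  everywhere equal to a Borel measurable one.\<close>

definition meas_family :: "(nat \<Rightarrow> (nat \<Rightarrow> real) \<Rightarrow> real) \<Rightarrow> bool" where
  "meas_family f \<longleftrightarrow> (\<forall>n. f n \<in> borel_measurable (leb n)) \<and> (\<exists>N. \<forall>n>N. f n = (\<lambda>_. 0))"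

definition ae_rel :: "(nat \<Rightarrow> (nat \<Rightarrow> real) \<Rightarrow> real) \<Rightarrow> (nat \<Rightarrow> (nat \<Rightarrow> real) \<Rightarrow> real) \<Rightarrow> bool" where
  "ae_rel f g \<longleftrightarrow> meas_family f \<and> meas_family g \<and> (\<forall>n. AE x in leb n. f n x = g n x)"

lemma part_equivp_ae_rel: "part_equivp ae_rel"
proof (rule part_equivpI)
  show "\<exists>x. ae_rel x x"
    by (rule exI[of _ "\<lambda>_ _. 0"]) (auto simp: ae_rel_def meas_family_def)
  show "symp ae_rel"
    by (auto simp: symp_def ae_rel_def eq_commute)
  show "transp ae_rel"
  proof (rule transpI)
    fix f g h assume fg: "ae_rel f g" and gh: "ae_rel g h"
    have "AE x in leb n. f n x = h n x" for n
    proof -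
      have "AE x in leb n. f n x = g n x" "AE x in leb n. g n x = h n x"
        using fg gh by (auto simp: ae_rel_def)
      then show ?thesis by eventually_elim simp
    qed
    with fg gh show "ae_rel f h" by (auto simp: ae_rel_def)
  qed
qed

quotient_type funalg = "nat \<Rightarrow> (nat \<Rightarrow> real) \<Rightarrow> real" / partial: ae_rel
  by (rule part_equivp_ae_rel)

lemma space_leb: "space (leb n) = (\<Pi>\<^sub>E i\<in>{..<n}. UNIV)"
  by (simp add: leb_def space_PiM)

lemma measurable_slice:
  assumes "i + n \<le> m" shows "slice i n \<in> measurable (leb m) (leb n)"
  unfolding leb_def slice_def[abs_def]
  using assms by (intro measurable_restrict measurable_component_singleton) auto

lemma slice_slice: "a + b \<le> d \<Longrightarrow> slice a b (slice c d x) = slice (c + a) b x"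
  by (auto simp: slice_def restrict_def fun_eq_iff add.assoc)

lemma slice_full: "x \<in> space (leb n) \<Longrightarrow> slice 0 n x = x"
  by (auto simp: slice_def space_leb restrict_def PiE_def extensional_def fun_eq_iff)

definition join :: "nat \<Rightarrow> nat \<Rightarrow> (nat \<Rightarrow> real) \<times> (nat \<Rightarrow> real) \<Rightarrow> (nat \<Rightarrow> real)" where
  "join m n = (\<lambda>(x, y). \<lambda>i\<in>{..<m+n}. if i < m then x i else y (i - m))"

lemma sigma_finite_leb: "sigma_finite_measure (leb n)"
proof -
  interpret product_sigma_finite "\<lambda>_::nat. lborel :: real measure" by standard
  show ?thesis unfolding leb_def by (rule sigma_finite) simp
qed

lemma measurable_join: "join m n \<in> measurable (leb m \<Otimes>\<^sub>M leb n) (leb (m + n))"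
proof -
  have "(\<lambda>p. if i < m then fst p i else snd p (i - m)) \<in> measurable (leb m \<Otimes>\<^sub>M leb n) lborel"
    if "i < m + n" for i
  proof (cases "i < m")
    case True
    then show ?thesis unfolding leb_def
      by (simp add: measurable_compose[OF measurable_fst] measurable_component_singleton)
  next
    case False
    with that have "i - m < n" by auto
    with False show ?thesis unfolding leb_def
      by (simp add: measurable_compose[OF measurable_snd] measurable_component_singleton)
  qed
  then show ?thesis
    unfolding join_def leb_def[of "m + n"] case_prod_beta' by (intro measurable_restrict) auto
qed

lemma distr_join: "distr (leb m \<Otimes>\<^sub>M leb n) (leb (m + n)) (join m n) = leb (m + n)"
proof -
  interpret product_sigma_finite "\<lambda>_::nat. lborel :: real measure" by standard
  interpret n: sigma_finite_measure "leb n" by (rule sigma_finite_leb)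
  show ?thesis
    unfolding leb_def[of "m + n"]
  proof (rule PiM_eqI)
    fix A :: "nat \<Rightarrow> real set" assume A: "\<And>i. i \<in> {..<m+n} \<Longrightarrow> A i \<in> sets lborel"
    let ?B = "Pi\<^sub>E {..<m} A" and ?C = "Pi\<^sub>E {..<n} (\<lambda>i. A (m + i))"
    have eq: "join m n -` Pi\<^sub>E {..<m+n} A \<inter> space (leb m \<Otimes>\<^sub>M leb n) = ?B \<times> ?C"
    proof (intro set_eqI iffI)
      fix p assume p: "p \<in> join m n -` Pi\<^sub>E {..<m+n} A \<inter> space (leb m \<Otimes>\<^sub>M leb n)"
      obtain x y where xy: "p = (x, y)" by (cases p)
      have j: "join m n (x, y) i \<in> A i" if "i < m + n" for i
        using p xy that by (auto simp: PiE_iff)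
      have "x i \<in> A i" if "i < m" for i
        using j[of i] that by (simp add: join_def)
      moreover have "y i \<in> A (m + i)" if "i < n" for i
        using j[of "m + i"] that by (simp add: join_def)
      ultimately show "p \<in> ?B \<times> ?C"
        using p xy by (auto simp: space_pair_measure space_leb PiE_iff)
    next
      fix p assume p: "p \<in> ?B \<times> ?C"
      obtain x y where xy: "p = (x, y)" by (cases p)
      have y: "y (i - m) \<in> A i" if "\<not> i < m" "i < m + n" for i
      proof -
        have "y j \<in> A (m + j)" if "j < n" for j using p xy that by (simp add: PiE_iff)
        from this[of "i - m"] have "y (i - m) \<in> A (m + (i - m))" using that by arith
        moreover have "m + (i - m) = i" using that by simp
        ultimately show ?thesis by (simp only:)
      qed
      show "p \<in> join m n -` Pi\<^sub>E {..<m+n} A \<inter> space (leb m \<Otimes>\<^sub>M leb n)"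
        using p xy by (auto simp: space_pair_measure space_leb PiE_iff join_def intro: y)
    qed
    have B: "?B \<in> sets (leb m)" and C: "?C \<in> sets (leb n)"
      unfolding leb_def using A by (auto intro!: sets_PiM_I_finite)
    have "Pi\<^sub>E {..<m+n} A \<in> sets (leb (m + n))"
      unfolding leb_def using A by (auto intro!: sets_PiM_I_finite)
    then have "emeasure (distr (leb m \<Otimes>\<^sub>M leb n) (leb (m + n)) (join m n)) (Pi\<^sub>E {..<m+n} A)
        = emeasure (leb m \<Otimes>\<^sub>M leb n) (?B \<times> ?C)"
      by (simp add: emeasure_distr measurable_join eq)
    also have "\<dots> = emeasure (leb m) ?B * emeasure (leb n) ?C"
      by (rule n.emeasure_pair_measure_Times[OF B C])
    also have "\<dots> = (\<Prod>i\<in>{..<m}. emeasure lborel (A i)) * (\<Prod>i\<in>{..<n}. emeasure lborel (A (m + i)))"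
      unfolding leb_def using A by (subst (1 2) emeasure_PiM) auto
    also have "\<dots> = (\<Prod>i\<in>{..<m+n}. emeasure lborel (A i))"
      by (induction n) (simp_all add: mult.assoc[symmetric])
    finally show "emeasure (distr (leb m \<Otimes>\<^sub>M leb n) (Pi\<^sub>M {..<m+n} (\<lambda>_. lborel)) (join m n))
        (Pi\<^sub>E {..<m+n} A) = (\<Prod>i\<in>{..<m+n}. emeasure lborel (A i))"
      by (simp add: leb_def)
  qed (auto simp: leb_def)
qed

lemma slice_join:
  assumes "p \<in> space (leb m \<Otimes>\<^sub>M leb n)"
  shows "slice 0 m (join m n p) = fst p" "slice m n (join m n p) = snd p"
  using assms
  by (auto simp: slice_def join_def space_pair_measure space_leb restrict_def PiE_def
      extensional_def fun_eq_iff split: prod.splits)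

lemma AE_slice:
  assumes P: "AE x in leb k. P x" and k: "k = m \<and> i = 0 \<or> k = n \<and> i = m"
  shows "AE x in leb (m + n). P (slice i k x)"
proof -
  interpret n: sigma_finite_measure "leb n" by (rule sigma_finite_leb)
  obtain N where N: "N \<in> null_sets (leb k)" "{x \<in> space (leb k). \<not> P x} \<subseteq> N"
    using P by (auto simp: eventually_ae_filter)
  have ms: "slice i k \<in> measurable (leb (m + n)) (leb k)"
    using k by (intro measurable_slice) auto
  let ?S = "slice i k -` N \<inter> space (leb (m + n))"
  have S: "?S \<in> sets (leb (m + n))"
    using N by (intro measurable_sets[OF ms]) auto
  let ?T = "if k = m \<and> i = 0 then N \<times> space (leb n) else space (leb m) \<times> N"
  have "join m n -` ?S \<inter> space (leb m \<Otimes>\<^sub>M leb n) = ?T"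
  proof (cases "k = m \<and> i = 0")
    case True
    then have "N \<subseteq> space (leb m)" using N(1) sets.sets_into_space by blast
    with True show ?thesis
      using slice_join(1)[of _ m n] measurable_space[OF measurable_join[of m n]]
      by (auto simp: space_pair_measure)
  next
    case False
    with k have k': "k = n" "i = m" by auto
    then have "N \<subseteq> space (leb n)" using N(1) sets.sets_into_space by blast
    with False k' show ?thesis
      using slice_join(2)[of _ m n] measurable_space[OF measurable_join[of m n]]
      by (auto simp: space_pair_measure)
  qed
  then have "emeasure (leb (m + n)) ?S = emeasure (leb m \<Otimes>\<^sub>M leb n) ?T"
    by (subst distr_join[symmetric]) (simp add: emeasure_distr[OF measurable_join S])
  also have "\<dots> = 0"
  proof (cases "k = m \<and> i = 0")
    case True
    with N(1) have "N \<in> sets (leb m)" "emeasure (leb m) N = 0" by (auto simp: null_sets_def)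
    then have "emeasure (leb m \<Otimes>\<^sub>M leb n) (N \<times> space (leb n)) = 0"
      by (subst n.emeasure_pair_measure_Times) auto
    then show ?thesis unfolding if_P[OF True] .
  next
    case False
    with N(1) k have "N \<in> sets (leb n)" "emeasure (leb n) N = 0" by (auto simp: null_sets_def)
    then have "emeasure (leb m \<Otimes>\<^sub>M leb n) (space (leb m) \<times> N) = 0"
      by (subst n.emeasure_pair_measure_Times) auto
    then show ?thesis unfolding if_not_P[OF False] .
  qed
  finally have "?S \<in> null_sets (leb (m + n))" using S by (simp add: null_sets_def)
  moreover have "{x \<in> space (leb (m + n)). \<not> P (slice i k x)} \<subseteq> ?S"
    using N(2) measurable_space[OF ms] by auto
  ultimately show ?thesis by (rule AE_I')
qed

text \<open>The bilinear extension of \<open>star\<close> to the direct sum.\<close>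

definition fam_mult where
  "fam_mult f g n x = (\<Sum>i\<le>n. star i (n - i) (f i) (g (n - i)) x)"

lemma meas_family_mult:
  assumes f: "meas_family f" and g: "meas_family g" shows "meas_family (fam_mult f g)"
proof -
  have "fam_mult f g n \<in> borel_measurable (leb n)" for n
    unfolding fam_mult_def[abs_def] star_def
  proof (intro borel_measurable_sum borel_measurable_times)
    fix i assume "i \<in> {..n}"
    then show "(\<lambda>x. f i (slice 0 i x)) \<in> borel_measurable (leb n)"
      "(\<lambda>x. g (n - i) (slice i (n - i) x)) \<in> borel_measurable (leb n)"
      using f g by (auto simp: meas_family_def intro!: measurable_compose[OF measurable_slice])
  qed
  moreover obtain N where N: "\<And>n. n > N \<Longrightarrow> f n = (\<lambda>_. 0)"
    using f by (auto simp: meas_family_def)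
  moreover obtain M where M: "\<And>n. n > M \<Longrightarrow> g n = (\<lambda>_. 0)"
    using g by (auto simp: meas_family_def)
  have "fam_mult f g n = (\<lambda>_. 0)" if "n > N + M" for n
  proof
    fix x
    show "fam_mult f g n x = 0"
      unfolding fam_mult_def star_def
    proof (rule sum.neutral, intro ballI)
      fix i assume "i \<in> {..n}"
      have "i > N \<or> n - i > M" using that by linarith
      then show "f i (slice 0 i x) * g (n - i) (slice i (n - i) x) = 0"
        using N M by auto
    qed
  qed
  ultimately show ?thesis by (auto simp: meas_family_def)
qed

lemma ae_rel_mult:
  assumes "ae_rel f f'" "ae_rel g g'" shows "ae_rel (fam_mult f g) (fam_mult f' g')"
proof -
  have "AE x in leb n. fam_mult f g n x = fam_mult f' g' n x" for n
  proof -
    have "AE x in leb n. star i (n - i) (f i) (g (n - i)) x = star i (n - i) (f' i) (g' (n - i)) x"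
      if "i \<le> n" for i
    proof -
      have "AE x in leb (i + (n - i)). f i (slice 0 i x) = f' i (slice 0 i x)"
        using assms by (intro AE_slice) (auto simp: ae_rel_def)
      moreover have "AE x in leb (i + (n - i)). g (n - i) (slice i (n - i) x) = g' (n - i) (slice i (n - i) x)"
        using assms by (intro AE_slice) (auto simp: ae_rel_def)
      ultimately have "AE x in leb (i + (n - i)).
          star i (n - i) (f i) (g (n - i)) x = star i (n - i) (f' i) (g' (n - i)) x"
        by eventually_elim (simp add: star_def)
      moreover have "i + (n - i) = n" using that by simp
      ultimately show ?thesis by (simp only:)
    qed
    then have "AE x in leb n. \<forall>i\<in>{..n}.
        star i (n - i) (f i) (g (n - i)) x = star i (n - i) (f' i) (g' (n - i)) x"
      by (intro AE_finite_allI) auto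
    then show ?thesis by eventually_elim (auto simp: fam_mult_def intro!: sum.cong)
  qed
  with assms show ?thesis by (auto simp: ae_rel_def meas_family_mult)
qed

lemma fam_mult_assoc: "fam_mult (fam_mult f g) h n x = fam_mult f (fam_mult g h) n x"
proof -
  let ?F = "\<lambda>i j k. f i (slice 0 i x) * g j (slice i j x) * h k (slice (i + j) k x)"
  have "fam_mult (fam_mult f g) h n x = (\<Sum>j=0..n. \<Sum>i=0..j. ?F i (j - i) (n - j))"
    unfolding fam_mult_def star_def sum_distrib_right atMost_atLeast0
    by (intro sum.cong refl) (auto simp: slice_slice)
  also have "\<dots> = (\<Sum>j=0..n. \<Sum>i=0..n - j. ?F j i (n - j - i))"
    by (rule fps_mult_assoc_lemma)
  also have "\<dots> = fam_mult f (fam_mult g h) n x"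
    unfolding fam_mult_def star_def sum_distrib_left atMost_atLeast0
    by (intro sum.cong refl) (auto simp: slice_slice mult.assoc)
  finally show ?thesis .
qed

lemma meas_family_linear:
  assumes "meas_family f" "meas_family g"
  shows "meas_family (\<lambda>n x. a * f n x + b * g n x)"
proof -
  obtain N where N: "\<And>n. n > N \<Longrightarrow> f n = (\<lambda>_. 0)"
    using assms by (auto simp: meas_family_def)
  obtain M where M: "\<And>n. n > M \<Longrightarrow> g n = (\<lambda>_. 0)"
    using assms by (auto simp: meas_family_def)
  have "\<forall>n>max N M. (\<lambda>x. a * f n x + b * g n x) = (\<lambda>_. 0)"
    using N M by auto
  moreover have "(\<lambda>x. a * f n x + b * g n x) \<in> borel_measurable (leb n)" for n
    using assms by (auto simp: meas_family_def
        intro!: borel_measurable_add borel_measurable_times)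
  ultimately show ?thesis unfolding meas_family_def by blast
qed

lemma ae_rel_linear:
  assumes "ae_rel f f'" "ae_rel g g'"
  shows "ae_rel (\<lambda>n x. a * f n x + b * g n x) (\<lambda>n x. a * f' n x + b * g' n x)"
proof -
  have "AE x in leb n. a * f n x + b * g n x = a * f' n x + b * g' n x" for n
  proof -
    have "AE x in leb n. f n x = f' n x" "AE x in leb n. g n x = g' n x"
      using assms by (auto simp: ae_rel_def)
    then show ?thesis by eventually_elim simp
  qed
  then show ?thesis using assms by (auto simp: ae_rel_def meas_family_linear)
qed

lemma ae_rel_zero: "ae_rel (\<lambda>_ _. 0) (\<lambda>_ _. 0)"
  by (auto simp: ae_rel_def meas_family_def)

lemma ae_relI:
  "meas_family f \<Longrightarrow> meas_family g \<Longrightarrow> (\<And>n x. x \<in> space (leb n) \<Longrightarrow> f n x = g n x) \<Longrightarrow> ae_rel f g"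
  by (auto simp: ae_rel_def)

lemma ae_rel_meas: "ae_rel f g \<Longrightarrow> meas_family f" "ae_rel f g \<Longrightarrow> meas_family g"
  by (auto simp: ae_rel_def)

lemma meas_family_zero: "meas_family (\<lambda>_ _. 0)"
  by (simp add: meas_family_def)

lemma meas_family_one: "meas_family (\<lambda>n _. if n = 0 then 1 else 0)"
  by (auto simp: meas_family_def)

lemma meas_family_add: "meas_family f \<Longrightarrow> meas_family g \<Longrightarrow> meas_family (\<lambda>n x. f n x + g n x)"
  using meas_family_linear[of f g 1 1] by simp

lemma meas_family_diff: "meas_family f \<Longrightarrow> meas_family g \<Longrightarrow> meas_family (\<lambda>n x. f n x - g n x)"
  using meas_family_linear[of f g 1 "-1"] by simp

lemma meas_family_minus: "meas_family f \<Longrightarrow> meas_family (\<lambda>n x. - f n x)"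
  using meas_family_linear[of f f "-1" 0] by simp

lemma meas_family_scale: "meas_family f \<Longrightarrow> meas_family (\<lambda>n x. c * f n x)"
  using meas_family_linear[of f f c 0] by simp

lemmas meas_family_intros = meas_family_zero meas_family_one meas_family_add meas_family_diff
  meas_family_minus meas_family_scale meas_family_mult

lemma fam_mult_one_left:
  assumes "x \<in> space (leb n)"
  shows "fam_mult (\<lambda>n _. if n = 0 then 1 else 0) f n x = f n x"
proof -
  have "fam_mult (\<lambda>n _. if n = 0 then 1 else 0) f n x = (\<Sum>i\<le>n. if i = 0 then f n x else 0)"
    unfolding fam_mult_def star_def using assms by (intro sum.cong) (auto simp: slice_full)
  then show ?thesis by simp
qed

lemma fam_mult_one_right:
  assumes "x \<in> space (leb n)"
  shows "fam_mult f (\<lambda>n _. if n = 0 then 1 else 0) n x = f n x"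
proof -
  have "fam_mult f (\<lambda>n _. if n = 0 then 1 else 0) n x = (\<Sum>i\<le>n. if i = n then f n x else 0)"
    unfolding fam_mult_def star_def using assms by (intro sum.cong) (auto simp: slice_full)
  then show ?thesis by simp
qed

lemma fam_mult_linear:
  "fam_mult (\<lambda>n x. f n x + f' n x) g n x = fam_mult f g n x + fam_mult f' g n x"
  "fam_mult g (\<lambda>n x. f n x + f' n x) n x = fam_mult g f n x + fam_mult g f' n x"
  "fam_mult (\<lambda>n x. c * f n x) g n x = c * fam_mult f g n x"
  "fam_mult g (\<lambda>n x. c * f n x) n x = c * fam_mult g f n x"
  unfolding fam_mult_def star_def sum.distrib[symmetric] sum_distrib_left
  by (intro sum.cong refl; simp add: distrib_left distrib_right)+

instantiation funalg :: real_algebra_1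
begin

lift_definition zero_funalg :: funalg is "\<lambda>_ _. 0"
  by (rule ae_rel_zero)

lift_definition one_funalg :: funalg is "\<lambda>n _. if n = 0 then 1 else 0"
  by (auto simp: ae_rel_def meas_family_def)

lift_definition plus_funalg :: "funalg \<Rightarrow> funalg \<Rightarrow> funalg" is "\<lambda>f g n x. f n x + g n x"
  using ae_rel_linear[of _ _ _ _ 1 1] by simp

lift_definition minus_funalg :: "funalg \<Rightarrow> funalg \<Rightarrow> funalg" is "\<lambda>f g n x. f n x - g n x"
  using ae_rel_linear[of _ _ _ _ 1 "-1"] by simp

lift_definition uminus_funalg :: "funalg \<Rightarrow> funalg" is "\<lambda>f n x. - f n x"
  using ae_rel_linear[OF _ ae_rel_zero, of _ _ "-1" 0] by simp

lift_definition scaleR_funalg :: "real \<Rightarrow> funalg \<Rightarrow> funalg" is "\<lambda>c f n x. c * f n x"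
  subgoal for c using ae_rel_linear[OF _ ae_rel_zero, of _ _ c 0] by simp
  done

lift_definition times_funalg :: "funalg \<Rightarrow> funalg \<Rightarrow> funalg" is fam_mult
  by (rule ae_rel_mult)

instance
proof
  fix a b c :: funalg and r s :: real
  show "a + b + c = a + (b + c)"
    by transfer (auto intro!: ae_relI meas_family_intros dest: ae_rel_meas)
  show "a + b = b + a"
    by transfer (auto intro!: ae_relI meas_family_intros dest: ae_rel_meas)
  show "0 + a = a"
    by transfer simp
  show "- a + a = 0"
    by transfer (auto intro!: ae_relI meas_family_intros dest: ae_rel_meas)
  show "a - b = a + - b"
    by transfer (auto intro!: ae_relI meas_family_intros dest: ae_rel_meas)
  show "r *\<^sub>R (a + b) = r *\<^sub>R a + r *\<^sub>R b"
    by transfer (auto intro!: ae_relI meas_family_intros dest: ae_rel_meas simp: algebra_simps)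
  show "(r + s) *\<^sub>R a = r *\<^sub>R a + s *\<^sub>R a"
    by transfer (auto intro!: ae_relI meas_family_intros dest: ae_rel_meas simp: algebra_simps)
  show "r *\<^sub>R s *\<^sub>R a = (r * s) *\<^sub>R a"
    by transfer (auto intro!: ae_relI meas_family_intros dest: ae_rel_meas simp: algebra_simps)
  show "1 *\<^sub>R a = a"
    by transfer simp
  show "a * b * c = a * (b * c)"
    by transfer (auto intro!: ae_relI meas_family_intros dest: ae_rel_meas simp: fam_mult_assoc)
  show "(a + b) * c = a * c + b * c"
    by transfer (auto intro!: ae_relI meas_family_intros dest: ae_rel_meas simp: fam_mult_linear)
  show "a * (b + c) = a * b + a * c"
    by transfer (auto intro!: ae_relI meas_family_intros dest: ae_rel_meas simp: fam_mult_linear)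
  show "r *\<^sub>R a * b = r *\<^sub>R (a * b)"
    by transfer (auto intro!: ae_relI meas_family_intros dest: ae_rel_meas simp: fam_mult_linear)
  show "a * r *\<^sub>R b = r *\<^sub>R (a * b)"
    by transfer (auto intro!: ae_relI meas_family_intros dest: ae_rel_meas simp: fam_mult_linear)
  show "1 * a = a"
    by transfer (auto intro!: ae_relI meas_family_intros dest: ae_rel_meas simp: fam_mult_one_left)
  show "a * 1 = a"
    by transfer (auto intro!: ae_relI meas_family_intros dest: ae_rel_meas simp: fam_mult_one_right)
  show "(0::funalg) \<noteq> 1"
  proof transfer
    have "emeasure (leb 0) (space (leb 0)) \<noteq> 0"
      by (simp add: leb_def space_PiM)
    then have "\<not> (AE x in leb 0. False)"
      by (auto simp: AE_iff_measurable[OF sets.top])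
    then show "\<not> ae_rel (\<lambda>_ _. 0) (\<lambda>n _. if n = 0 then 1 else 0)"
      unfolding ae_rel_def by (auto dest!: spec[of _ 0])
  qed
qed

end

text \<open>The class of the characteristic function of a measurable subset \<open>A\<close> of \<open>\<real>\<^sup>d\<close>, in degree
  \<open>d\<close>. The guard is only there to make the function total; \<open>sets_K_cone\<close> and \<open>sets_C_cone\<close>
  show that it holds for the cones of packed words.\<close>

lift_definition char_fun :: "nat \<Rightarrow> (nat \<Rightarrow> real) set \<Rightarrow> funalg" is
  "\<lambda>d A n. if n = d \<and> A \<in> sets (leb d) then indicator A else (\<lambda>_. 0)"
  by (auto simp: ae_rel_def meas_family_def)

definition K_fun :: "nat list \<Rightarrow> funalg" where
  "K_fun u = char_fun (length u) (K_cone u)"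

definition C_fun :: "nat list \<Rightarrow> funalg" where
  "C_fun u = char_fun (length u) (C_cone u)"


section \<open>Noncommutative series of finite degree\<close>

text \<open>A series is given by its coefficients on words over the alphabet \<open>'a\<close>.\<close>

typedef 'a ncseries = "{f :: 'a list \<Rightarrow> real. \<exists>d. \<forall>w. length w > d \<longrightarrow> f w = 0}"
  morphisms nc_coeff Abs_ncseries
  by (rule exI[of _ "\<lambda>_. 0"]) auto

setup_lifting type_definition_ncseries

instantiation ncseries :: (type) real_algebra_1
begin

lift_definition zero_ncseries :: "'a ncseries" is "\<lambda>_. 0" by simp

lift_definition one_ncseries :: "'a ncseries" is "\<lambda>w. if w = [] then 1 else 0" by auto

lift_definition plus_ncseries :: "'a ncseries \<Rightarrow> 'a ncseries \<Rightarrow> 'a ncseries" is "\<lambda>f g w. f w + g w"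
proof -
  fix f g :: "'a list \<Rightarrow> real"
  assume "\<exists>d. \<forall>w. d < length w \<longrightarrow> f w = 0" "\<exists>d. \<forall>w. d < length w \<longrightarrow> g w = 0"
  then obtain d e where "\<forall>w. d < length w \<longrightarrow> f w = 0" "\<forall>w. e < length w \<longrightarrow> g w = 0" by auto
  then show "\<exists>d. \<forall>w. d < length w \<longrightarrow> f w + g w = 0" by (intro exI[of _ "d + e"]) auto
qed

lift_definition minus_ncseries :: "'a ncseries \<Rightarrow> 'a ncseries \<Rightarrow> 'a ncseries" is "\<lambda>f g w. f w - g w"
proof -
  fix f g :: "'a list \<Rightarrow> real"
  assume "\<exists>d. \<forall>w. d < length w \<longrightarrow> f w = 0" "\<exists>d. \<forall>w. d < length w \<longrightarrow> g w = 0"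
  then obtain d e where "\<forall>w. d < length w \<longrightarrow> f w = 0" "\<forall>w. e < length w \<longrightarrow> g w = 0" by auto
  then show "\<exists>d. \<forall>w. d < length w \<longrightarrow> f w - g w = 0" by (intro exI[of _ "d + e"]) auto
qed

lift_definition uminus_ncseries :: "'a ncseries \<Rightarrow> 'a ncseries" is "\<lambda>f w. - f w" by simp

lift_definition scaleR_ncseries :: "real \<Rightarrow> 'a ncseries \<Rightarrow> 'a ncseries" is "\<lambda>c f w. c * f w" by auto

lift_definition times_ncseries :: "'a ncseries \<Rightarrow> 'a ncseries \<Rightarrow> 'a ncseries" is
  "\<lambda>f g w. \<Sum>i\<le>length w. f (take i w) * g (drop i w)"
proof -
  fix f g :: "'a list \<Rightarrow> real"
  assume "\<exists>d. \<forall>w. d < length w \<longrightarrow> f w = 0" "\<exists>d. \<forall>w. d < length w \<longrightarrow> g w = 0"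
  then obtain d e where de: "\<forall>w. d < length w \<longrightarrow> f w = 0" "\<forall>w. e < length w \<longrightarrow> g w = 0" by auto
  have "f (take i w) * g (drop i w) = 0" if "d + e < length w" "i \<le> length w" for i w
  proof (cases "d < i")
    case True
    with de(1) that show ?thesis by simp
  next
    case False
    with de(2) that show ?thesis by simp
  qed
  then show "\<exists>d. \<forall>w. d < length w \<longrightarrow> (\<Sum>i\<le>length w. f (take i w) * g (drop i w)) = 0"
    by (intro exI[of _ "d + e"]) (auto intro!: sum.neutral)
qed

instance
proof
  fix a b c :: "'a ncseries" and r s :: real
  show "a + b + c = a + (b + c)" by transfer auto
  show "a + b = b + a" by transfer auto
  show "0 + a = a" by transfer auto
  show "- a + a = 0" by transfer auto
  show "a - b = a + - b" by transfer auto
  show "r *\<^sub>R (a + b) = r *\<^sub>R a + r *\<^sub>R b" by transfer (auto simp: algebra_simps)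
  show "(r + s) *\<^sub>R a = r *\<^sub>R a + s *\<^sub>R a" by transfer (auto simp: algebra_simps)
  show "r *\<^sub>R s *\<^sub>R a = (r * s) *\<^sub>R a" by transfer (auto simp: algebra_simps)
  show "1 *\<^sub>R a = a" by transfer auto
  show "(a + b) * c = a * c + b * c"
    by transfer (auto simp: algebra_simps sum.distrib)
  show "a * (b + c) = a * b + a * c"
    by transfer (auto simp: algebra_simps sum.distrib)
  show "r *\<^sub>R a * b = r *\<^sub>R (a * b)"
    by transfer (auto simp: algebra_simps sum_distrib_left)
  show "a * r *\<^sub>R b = r *\<^sub>R (a * b)"
    by transfer (auto simp: algebra_simps sum_distrib_left)
  show "(0::'a ncseries) \<noteq> 1" by transfer (auto simp: fun_eq_iff)
  show "1 * a = a"
  proof transfer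
    fix f :: "'a list \<Rightarrow> real"
    have "(\<Sum>i\<le>length w. (if take i w = [] then 1 else 0) * f (drop i w)) = f w" for w
    proof -
      have "(\<Sum>i\<le>length w. (if take i w = [] then 1 else 0) * f (drop i w))
          = (\<Sum>i\<le>length w. if i = 0 then f w else 0)"
        by (intro sum.cong) auto
      then show ?thesis by simp
    qed
    then show "(\<lambda>w. \<Sum>i\<le>length w. (if take i w = [] then 1 else 0) * f (drop i w)) = f" by simp
  qed
  show "a * 1 = a"
  proof transfer
    fix f :: "'a list \<Rightarrow> real"
    have "(\<Sum>i\<le>length w. f (take i w) * (if drop i w = [] then 1 else 0)) = f w" for w
    proof -
      have "(\<Sum>i\<le>length w. f (take i w) * (if drop i w = [] then 1 else 0))
          = (\<Sum>i\<le>length w. if i = length w then f w else 0)"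
        by (intro sum.cong) auto
      then show ?thesis by simp
    qed
    then show "(\<lambda>w. \<Sum>i\<le>length w. f (take i w) * (if drop i w = [] then 1 else 0)) = f" by simp
  qed
  show "a * b * c = a * (b * c)"
  proof transfer
    fix f g h :: "'a list \<Rightarrow> real"
    show "(\<lambda>w. \<Sum>i\<le>length w. (\<Sum>j\<le>length (take i w). f (take j (take i w)) * g (drop j (take i w))) * h (drop i w))
      = (\<lambda>w. \<Sum>i\<le>length w. f (take i w) * (\<Sum>j\<le>length (drop i w). g (take j (drop i w)) * h (drop j (drop i w))))"
      (is "?L = ?R")
    proof
      fix w
      let ?F = "\<lambda>i j k. f (take i w) * g (take j (drop i w)) * h (drop (i + j) w)"
      have "?L w = (\<Sum>j=0..length w. \<Sum>i=0..j. ?F i (j - i) (length w - j))"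
        unfolding sum_distrib_right atMost_atLeast0
        by (intro sum.cong) (auto simp: drop_take min_def)
      also have "\<dots> = (\<Sum>j=0..length w. \<Sum>i=0..length w - j. ?F j i (length w - j - i))"
        by (rule fps_mult_assoc_lemma)
      also have "\<dots> = ?R w"
        unfolding sum_distrib_left atMost_atLeast0
        by (intro sum.cong) (auto simp: mult.assoc add.commute)
      finally show "?L w = ?R w" .
    qed
  qed
qed

end

lift_definition M_ser :: "nat list \<Rightarrow> 'a::linorder ncseries" is
  "\<lambda>u w. if pack w = u then 1 else 0"
  subgoal for u by (rule exI[of _ "length u"]) auto
  done

definition Phi :: "nat list \<Rightarrow> 'a::linorder ncseries" where
  "Phi u = (\<Sum>v | finer_word v u. M_ser v)"

definition WQSym :: "'a::linorder ncseries set" where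
  "WQSym = span {M_ser u |u. packed u}"


section \<open>Subalgebras and their isomorphisms\<close>

definition is_subalgebra :: "'a::real_algebra_1 set \<Rightarrow> bool" where
  "is_subalgebra A \<longleftrightarrow> subspace A \<and> 1 \<in> A \<and> (\<forall>x\<in>A. \<forall>y\<in>A. x * y \<in> A)"

definition linear_on_subspace :: "'a::real_vector set \<Rightarrow> ('a \<Rightarrow> 'b::real_vector) \<Rightarrow> bool" where
  "linear_on_subspace A f \<longleftrightarrow>
     (\<forall>x\<in>A. \<forall>y\<in>A. f (x + y) = f x + f y) \<and> (\<forall>c. \<forall>x\<in>A. f (c *\<^sub>R x) = c *\<^sub>R f x)"

definition is_algebra_iso ::
    "'a::real_algebra_1 set \<Rightarrow> 'b::real_algebra_1 set \<Rightarrow> ('a \<Rightarrow> 'b) \<Rightarrow> bool" where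
  "is_algebra_iso A B f \<longleftrightarrow> is_subalgebra A \<and> is_subalgebra B \<and> bij_betw f A B \<and>
     linear_on_subspace A f \<and> f 1 = 1 \<and> (\<forall>x\<in>A. \<forall>y\<in>A. f (x * y) = f x * f y)"

definition P_alg :: "funalg set" where
  "P_alg = is_subalgebra hull {K_fun u |u. packed u}"

end

theory Submission
  imports Defs
begin

text \<open>The computation is done with the cones \<open>K_cone u\<close>: everything follows from the fact that the
isomorphism sends the class of \<open>K_cone u\<close> to \<open>(-1) ^ word_max u\<close> times \<open>M_ser u\<close>.

Passing from \<open>K\<close> to \<open>C\<close>. Fix a standardization. A packed word with this standardization amounts
to a set of ranks, its cuts, and refining the word means adding cuts (\<open>finer_word_cuts\<close>,
\<open>cuts_bij_betw\<close>). Let \<open>h d\<close> be the indicator of the half-space on which the coordinates of rank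
at most \<open>d\<close> have a nonnegative sum. Then \<open>K_cone u\<close> is the product of the \<open>h d\<close> over the cuts
of \<open>u\<close>, and \<open>C_cone u\<close> is the same product times \<open>1 - h d\<close> over all the other ranks. Expanding
this product writes \<open>C_cone u\<close> as the alternating sum of the \<open>K_cone v\<close> with \<open>v\<close> finer than
\<open>u\<close> (\<open>C_cone_expansion\<close>); under the correspondence just described its image is
\<open>(-1) ^ word_max u\<close> times \<open>Phi u\<close>. The expansion is unitriangular, hence the \<open>C_cone u\<close> span the
same space as the \<open>K_cone u\<close>, which gives uniqueness.

Products. Both \<open>M_ser u * M_ser v\<close> and the product of two cones are sums over the words \<open>w\<close> whose
first letters pack to \<open>u\<close> and whose remaining letters pack to \<open>v\<close>, the cones with the sign
\<open>(-1) ^ (word_max u + word_max v + word_max w)\<close> (\<open>M_ser_mult\<close>, \<open>K_fun_mult\<close>). Such \<open>w\<close> are the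
quasi-shuffles of the blocks of \<open>u\<close> and \<open>v\<close>, and the identity for the cones is an induction on
the last block that rests on the following remark about two real numbers: the indicator of
\<open>a + b \<ge> 0\<close>, times the indicator of \<open>a \<ge> 0\<close> plus that of \<open>b \<ge> 0\<close> minus one, is the indicator
of \<open>a \<ge> 0 \<and> b \<ge> 0\<close> (\<open>quasi_shuffle_identity\<close>).

Independence. The cones \<open>K_cone u\<close> are independent modulo null sets (\<open>K_indicators_independent\<close>). At a
point whose coordinates are plus or minus distinct powers of two, the sign of a partial sum is the
sign of its largest term, and all indicators are constant near such a point. So the values at these
points only depend on which positions carry the largest term of some defining sum of the cone, and
Moebius inversion over the choice of signs isolates the words with a prescribed set of such
positions. If the order of magnitude of the coordinates is adapted to a word \<open>u\<close>, then every word
with the same set as \<open>u\<close> dominates \<open>u\<close> letter by letter. Hence the coefficient of a word with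
maximal letter sum vanishes.\<close>

section \<open>Packed words and their lower sets\<close>

text \<open>The union of the first \<open>k\<close> blocks. The conditions that define \<open>K_cone u\<close> are the signs of the
coordinate sums over these sets.\<close>

definition below :: "nat list \<Rightarrow> nat \<Rightarrow> nat set" where
  "below u k = {i. i < length u \<and> u ! i \<le> k}"

lemma finite_below [simp]: "finite (below u k)"
  by (simp add: below_def)

lemma below_mono: "j \<le> k \<Longrightarrow> below u j \<subseteq> below u k"
  by (auto simp: below_def)

lemma packed_set: "packed u \<Longrightarrow> set u = {1..word_max u}"
proof -
  assume "packed u"
  then obtain r where r: "set u = {1..r}" by (auto simp: packed_def)
  show ?thesis
  proof (cases "u = []")
    case False
    then have "r \<ge> 1" using r by (cases r) auto
    then have "Max {1..r} = r" by (intro Max_eqI) auto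
    with r False show ?thesis by (simp add: word_max_def)
  qed (simp add: word_max_def)
qed

lemma packed_letter:
  assumes "packed u" "i < length u" shows "1 \<le> u ! i" "u ! i \<le> word_max u"
  using packed_set[OF assms(1)] nth_mem[OF assms(2)] by auto

lemma packed_letter_occurs:
  assumes "packed u" "1 \<le> k" "k \<le> word_max u" obtains i where "i < length u" "u ! i = k"
proof -
  have "k \<in> set u" using packed_set[OF assms(1)] assms by auto
  then show ?thesis using that by (auto simp: in_set_conv_nth)
qed

lemma word_max_le_length: "packed u \<Longrightarrow> word_max u \<le> length u"
  using packed_set[of u] card_length[of u] by simp

lemma packed_Nil [simp]: "packed []"
  by (auto simp: packed_def intro: exI[of _ 0])

lemma word_max_Nil [simp]: "word_max [] = 0"
  by (simp add: word_max_def)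

text \<open>Each letter of a packed word occurs, so these sets form a strictly increasing chain.\<close>

lemma below_strict_mono:
  assumes "packed u" "j < k" "k \<le> word_max u" shows "below u j \<subset> below u k"
proof -
  obtain i where "i < length u" "u ! i = k"
    using packed_letter_occurs[OF assms(1), of k] assms by auto
  then have "i \<in> below u k - below u j" using assms by (auto simp: below_def)
  then show ?thesis using below_mono[of j k u] assms by auto
qed

lemma below_word_max: "packed u \<Longrightarrow> below u (word_max u) = {..<length u}"
  using packed_letter by (auto simp: below_def)

lemma sum_blocks_below:
  assumes "packed u"
  shows "(\<Sum>j=1..k. \<Sum>i\<in>block u j. x i) = sum x (below u k)"
proof -
  have "(\<Sum>j=1..k. \<Sum>i\<in>block u j. x i) = sum x (\<Union>j\<in>{1..k}. block u j)"
    by (subst sum.UNION_disjoint) (auto simp: block_def)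
  also have "(\<Union>j\<in>{1..k}. block u j) = below u k"
    using packed_letter[OF assms] by (fastforce simp: block_def below_def)
  finally show ?thesis .
qed

lemma K_cone_below:
  assumes "packed u"
  shows "K_cone u = {x \<in> space (leb (length u)). \<forall>k\<in>{1..word_max u}. 0 \<le> sum x (below u k)}"
  unfolding K_cone_def sum_blocks_below[OF assms] ..

section \<open>Packing\<close>

abbreviation rank_in :: "'a::linorder set \<Rightarrow> 'a \<Rightarrow> nat" where
  "rank_in S a \<equiv> card {b \<in> S. b \<le> a}"

lemma rank_in_less:
  assumes "finite S" "b \<in> S" "a < b" shows "rank_in S a < rank_in S b"
proof (rule psubset_card_mono)
  have "{c \<in> S. c \<le> a} \<subseteq> {c \<in> S. c \<le> b}" "b \<in> {c \<in> S. c \<le> b}" "b \<notin> {c \<in> S. c \<le> a}"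
    using assms by auto
  then show "{c \<in> S. c \<le> a} \<subset> {c \<in> S. c \<le> b}" by blast
qed (use assms in simp)

lemma rank_in_strict_mono: "finite S \<Longrightarrow> strict_mono_on S (rank_in S)"
  by (intro strict_mono_onI rank_in_less)

lemma rank_in_image:
  assumes "finite S" shows "rank_in S ` S = {1..card S}"
proof (rule card_subset_eq)
  show "rank_in S ` S \<subseteq> {1..card S}"
  proof clarify
    fix a assume a: "a \<in> S"
    have "card {a} \<le> rank_in S a" using assms a by (intro card_mono) auto
    moreover have "rank_in S a \<le> card S" using assms by (intro card_mono) auto
    ultimately show "rank_in S a \<in> {1..card S}" by simp
  qed
  show "card (rank_in S ` S) = card {1..card S}"
    using strict_mono_on_imp_inj_on[OF rank_in_strict_mono[OF assms]] by (simp add: card_image)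
qed simp

lemma pack_eq_map: "pack w = map (rank_in (set w)) w"
  by (simp add: pack_def)

lemma set_pack: "set (pack w) = {1..card (set w)}"
  unfolding pack_eq_map set_map by (rule rank_in_image) simp

lemma packed_pack [simp]: "packed (pack w)"
  using set_pack by (auto simp: packed_def)

lemma word_max_pack: "word_max (pack w) = card (set w)"
  using packed_set[OF packed_pack, of w] set_pack[of w]
  by (metis card_atLeastAtMost diff_Suc_1)

text \<open>Packing only depends on the relative order of the letters. This makes it insensitive to packing a
larger word first, and lets words be transported along increasing maps.\<close>

lemma pack_map:
  assumes "strict_mono_on (set w) f" shows "pack (map f w) = pack w"
proof -
  have inj: "inj_on f (set w)" by (rule strict_mono_on_imp_inj_on[OF assms])
  have "card {b \<in> f ` set w. b \<le> f a} = card {b \<in> set w. b \<le> a}" if "a \<in> set w" for a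
  proof -
    have "{b \<in> f ` set w. b \<le> f a} = f ` {b \<in> set w. f b \<le> f a}" by blast
    also have "{b \<in> set w. f b \<le> f a} = {b \<in> set w. b \<le> a}"
      using strict_mono_on_less_eq[OF assms] that by blast
    finally show ?thesis using inj by (simp add: card_image inj_on_subset)
  qed
  then show ?thesis by (simp add: pack_def)
qed

lemma pack_packed: "packed u \<Longrightarrow> pack u = u"
proof -
  assume u: "packed u"
  have "card {b \<in> set u. b \<le> a} = a" if "a \<in> set u" for a
  proof -
    have "{b \<in> set u. b \<le> a} = {1..a}" using packed_set[OF u] that by auto
    then show ?thesis by simp
  qed
  then show ?thesis by (simp add: pack_def map_idI)
qed

lemma pack_map_rank_in:
  assumes "set w' \<subseteq> set w" shows "pack (map (rank_in (set w)) w') = pack w'"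
  using rank_in_strict_mono[of "set w"] assms
  by (intro pack_map) (auto simp: strict_mono_on_def subset_iff)

lemma pack_take_pack: "pack (take i (pack w)) = pack (take i w)"
  unfolding pack_eq_map[of w] take_map by (rule pack_map_rank_in) (rule set_take_subset)

lemma pack_drop_pack: "pack (drop i (pack w)) = pack (drop i w)"
  unfolding pack_eq_map[of w] drop_map by (rule pack_map_rank_in) (rule set_drop_subset)

text \<open>The letters \<open>1, \<dots>, r\<close> are mapped increasingly onto \<open>r\<close> elements of the infinite alphabet. Because
of this \<open>M_ser u\<close> is nonzero for packed \<open>u\<close>.\<close>

lemma exists_word_with_pack:
  assumes "infinite (UNIV :: 'a::linorder set)" "packed u"
  shows "\<exists>w :: 'a list. pack w = u"
proof -
  obtain S :: "'a set" where S: "finite S" "card S = word_max u"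
    using infinite_arbitrarily_large[OF assms(1), of "word_max u"] by auto
  let ?s = "sorted_list_of_set S"
  have len: "length ?s = word_max u" using S by simp
  have "strict_mono_on (set u) (\<lambda>k. ?s ! (k - 1))"
  proof (rule strict_mono_onI)
    fix j k assume "j \<in> set u" "k \<in> set u" "j < k"
    then have "j - 1 < k - 1" "k - 1 < length ?s" using packed_set[OF assms(2)] len by auto
    moreover have "sorted_wrt (<) ?s" by simp
    ultimately show "?s ! (j - 1) < ?s ! (k - 1)" by (simp only: sorted_wrt_nth_less)
  qed
  then have "pack (map (\<lambda>k. ?s ! (k - 1)) u) = pack u" by (rule pack_map)
  then show ?thesis using pack_packed[OF assms(2)] by metis
qed

section \<open>Refinement of packed words in terms of cuts\<close>

text \<open>The entry of the standardization at a position. For a packed word it orders the positions as the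
segmented permutation lists them.\<close>

definition rank :: "nat list \<Rightarrow> nat \<Rightarrow> nat" where
  "rank u i = Std u ! i"

text \<open>The ranks of the block ends; equivalently the partial sums of \<open>ev u\<close>.\<close>

definition cuts :: "nat list \<Rightarrow> nat set" where
  "cuts u = (\<lambda>k. card (below u k)) ` {1..word_max u}"

lemma rank_eq_card:
  "i < length u \<Longrightarrow> rank u i = card {j. j < length u \<and> (u ! j < u ! i \<or> u ! j = u ! i \<and> j \<le> i)}"
  by (simp add: rank_def Std_def)

lemma rank_less:
  assumes "j < length u" "i < length u" "u ! i < u ! j \<or> u ! i = u ! j \<and> i < j"
  shows "rank u i < rank u j"
  unfolding rank_eq_card[OF assms(1)] rank_eq_card[OF assms(2)]
proof (rule psubset_card_mono)
  let ?S = "\<lambda>i. {h. h < length u \<and> (u ! h < u ! i \<or> u ! h = u ! i \<and> h \<le> i)}"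
  have "?S i \<subseteq> ?S j" "j \<in> ?S j" "j \<notin> ?S i" using assms by auto
  then show "?S i \<subset> ?S j" by blast
qed simp

lemma rank_less_iff:
  assumes "j < length u" "i < length u"
  shows "rank u i < rank u j \<longleftrightarrow> u ! i < u ! j \<or> u ! i = u ! j \<and> i < j"
  using rank_less[OF assms] rank_less[OF assms(2,1)]
  by (cases i j rule: linorder_cases; cases "u ! i" "u ! j" rule: linorder_cases) auto

lemma rank_bij: "bij_betw (rank u) {..<length u} {1..length u}"
proof -
  have inj: "inj_on (rank u) {..<length u}"
  proof (rule inj_onI)
    fix i j assume "i \<in> {..<length u}" "j \<in> {..<length u}" "rank u i = rank u j"
    then show "i = j" using rank_less_iff[of i u j] rank_less_iff[of j u i]
      by (cases i j rule: linorder_cases; cases "u ! i" "u ! j" rule: linorder_cases) auto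
  qed
  have "rank u ` {..<length u} \<subseteq> {1..length u}"
  proof clarify
    fix i assume i: "i < length u"
    let ?S = "{h. h < length u \<and> (u ! h < u ! i \<or> u ! h = u ! i \<and> h \<le> i)}"
    have "card ?S \<le> card {..<length u}" by (intro card_mono) auto
    moreover have "card {i} \<le> card ?S" using i by (intro card_mono) auto
    ultimately show "rank u i \<in> {1..length u}" unfolding rank_eq_card[OF i] by simp
  qed
  moreover have "card (rank u ` {..<length u}) = card {1..length u}"
    using inj by (simp add: card_image)
  ultimately have "rank u ` {..<length u} = {1..length u}"
    by (intro card_subset_eq) auto
  with inj show ?thesis by (simp add: bij_betw_def)
qed

text \<open>The first \<open>k\<close> blocks are an initial segment for the order by rank.\<close>

lemma below_rank:
  assumes "i < length u"
  shows "u ! i \<le> k \<longleftrightarrow> rank u i \<le> card (below u k)"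
proof
  assume "u ! i \<le> k"
  then show "rank u i \<le> card (below u k)"
    unfolding rank_eq_card[OF assms] by (intro card_mono) (auto simp: below_def)
next
  assume le: "rank u i \<le> card (below u k)"
  show "u ! i \<le> k"
  proof (rule ccontr)
    assume "\<not> u ! i \<le> k"
    then have "card (insert i (below u k)) \<le> rank u i"
      unfolding rank_eq_card[OF assms] using assms by (intro card_mono) (auto simp: below_def)
    moreover have "card (insert i (below u k)) = Suc (card (below u k))"
      using \<open>\<not> u ! i \<le> k\<close> by (subst card_insert_disjoint) (auto simp: below_def)
    ultimately show False using le by simp
  qed
qed

lemma below_eq_rank: "below u k = {i. i < length u \<and> rank u i \<le> card (below u k)}"
  using below_rank[of _ u k] by (auto simp: below_def)

lemma card_below_less:
  assumes "packed u" "j < k" "k \<le> word_max u" shows "card (below u j) < card (below u k)"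
  by (rule psubset_card_mono[OF _ below_strict_mono[OF assms]]) simp

lemma card_cuts: "packed u \<Longrightarrow> card (cuts u) = word_max u"
proof -
  assume u: "packed u"
  have "inj_on (\<lambda>k. card (below u k)) {1..word_max u}"
    using card_below_less[OF u] by (intro strict_mono_on_imp_inj_on strict_mono_onI) auto
  then show ?thesis unfolding cuts_def by (simp add: card_image)
qed

lemma cuts_subset: "packed u \<Longrightarrow> cuts u \<subseteq> {1..length u}"
proof
  fix d assume u: "packed u" and "d \<in> cuts u"
  then obtain k where k: "1 \<le> k" "k \<le> word_max u" "d = card (below u k)" by (auto simp: cuts_def)
  have "card (below u 0) < d" using card_below_less[OF u, of 0 k] k by auto
  moreover have "d \<le> card {..<length u}" unfolding k by (intro card_mono) (auto simp: below_def)
  ultimately show "d \<in> {1..length u}" by auto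
qed

lemma length_in_cuts: "packed u \<Longrightarrow> u \<noteq> [] \<Longrightarrow> length u \<in> cuts u"
proof -
  assume u: "packed u" "u \<noteq> []"
  then have "1 \<le> word_max u" using packed_letter[OF u(1), of 0] by auto
  then show ?thesis unfolding cuts_def using below_word_max[OF u(1)]
    by (intro image_eqI[of _ _ "word_max u"]) auto
qed

text \<open>A letter exceeds by one the number of cuts before the rank of its position. So a packed word is
determined by its standardization and its cuts, and the formula also shows how to define a
word from given cuts.\<close>

lemma letter_eq_cuts:
  assumes u: "packed u" and i: "i < length u"
  shows "u ! i = Suc (card {d \<in> cuts u. d < rank u i})"
proof -
  have ui: "1 \<le> u ! i" "u ! i \<le> word_max u" using packed_letter[OF u i] by auto
  have less: "card (below u k) < rank u i \<longleftrightarrow> k < u ! i" for k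
    using below_rank[OF i, of k] by (metis not_le)
  have "{d \<in> cuts u. d < rank u i}
      = (\<lambda>k. card (below u k)) ` {k \<in> {1..word_max u}. card (below u k) < rank u i}"
    unfolding cuts_def by blast
  also have "{k \<in> {1..word_max u}. card (below u k) < rank u i} = {1..<u ! i}"
    unfolding less using ui by auto
  finally have "{d \<in> cuts u. d < rank u i} = (\<lambda>k. card (below u k)) ` {1..<u ! i}" .
  moreover have "inj_on (\<lambda>k. card (below u k)) {1..<u ! i}"
    using card_below_less[OF u] ui by (intro strict_mono_on_imp_inj_on strict_mono_onI) auto
  ultimately show ?thesis using ui by (simp add: card_image)
qed

lemma Std_length [simp]: "length (Std u) = length u"
  by (simp add: Std_def)

lemma eq_of_Std_cuts:
  assumes "packed u" "packed v" "Std u = Std v" "cuts u = cuts v" shows "u = v"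
proof (rule nth_equalityI)
  show len: "length u = length v" using assms(3) by (metis Std_length)
  fix i assume "i < length u"
  then show "u ! i = v ! i"
    using letter_eq_cuts[of u i] letter_eq_cuts[of v i] assms len by (simp add: rank_def)
qed

subsection \<open>Compositions\<close>

text \<open>The partial sums over nonempty initial segments. Refinement of compositions is inclusion of
these sets.\<close>

fun part_sums :: "nat list \<Rightarrow> nat set" where
  "part_sums [] = {}"
| "part_sums (a # as) = insert a ((+) a ` part_sums as)"

lemma part_sums_append: "part_sums (xs @ ys) = part_sums xs \<union> (+) (sum_list xs) ` part_sums ys"
  by (induction xs) (auto simp: image_Un image_image add.assoc)

lemma part_sums_le: "y \<in> part_sums xs \<Longrightarrow> y \<le> sum_list xs"
  by (induction xs arbitrary: y) auto

lemma part_sums_pos: "\<forall>x\<in>set xs. 0 < x \<Longrightarrow> y \<in> part_sums xs \<Longrightarrow> 0 < y"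
  by (induction xs arbitrary: y) auto

lemma sum_list_in_part_sums: "xs \<noteq> [] \<Longrightarrow> sum_list xs \<in> part_sums xs"
proof (induction xs)
  case (Cons a xs)
  then show ?case by (cases "xs = []") auto
qed simp

lemma part_sums_split:
  "a \<in> part_sums d \<Longrightarrow> \<exists>ds ds'. d = ds @ ds' \<and> ds \<noteq> [] \<and> sum_list ds = a"
proof (induction d arbitrary: a)
  case (Cons b d)
  consider "a = b" | a' where "a' \<in> part_sums d" "a = b + a'" using Cons.prems by auto
  then show ?case
  proof cases
    case 1
    then show ?thesis by (intro exI[of _ "[b]"] exI[of _ d]) auto
  next
    case 2
    then obtain ds ds' where "d = ds @ ds'" "sum_list ds = a'" using Cons.IH by blast
    then show ?thesis using 2 by (intro exI[of _ "b # ds"] exI[of _ ds']) auto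
  qed
qed simp

lemma finer_comp_imp_part_sums:
  "[] \<notin> set dss \<Longrightarrow> part_sums (map sum_list dss) \<subseteq> part_sums (concat dss)"
proof (induction dss)
  case (Cons ds dss)
  then have "sum_list ds \<in> part_sums ds" by (intro sum_list_in_part_sums) auto
  with Cons show ?case by (auto simp: part_sums_append)
qed simp

text \<open>The first part of the coarser composition is a partial sum of the finer one and thus splits off a
run of its parts. Since the parts are positive, the remaining partial sums lie strictly beyond this
run, so the hypothesis is inherited by the tails.\<close>

lemma part_sums_imp_finer_comp:
  "\<forall>x\<in>set d. 0 < x \<Longrightarrow> \<forall>x\<in>set c. 0 < x \<Longrightarrow> sum_list d = sum_list c \<Longrightarrow> part_sums c \<subseteq> part_sums d
    \<Longrightarrow> finer_comp d c"
proof (induction c arbitrary: d)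
  case Nil
  then have "d = []" by (cases d) auto
  then show ?case by (auto simp: finer_comp_def)
next
  case (Cons a c)
  then have "a \<in> part_sums d" by auto
  then obtain ds ds' where ds: "d = ds @ ds'" "ds \<noteq> []" "sum_list ds = a"
    using part_sums_split by blast
  have "part_sums c \<subseteq> part_sums ds'"
  proof
    fix y assume y: "y \<in> part_sums c"
    then have "0 < y" using part_sums_pos Cons.prems by auto
    have "a + y \<in> part_sums d" using y Cons.prems by auto
    moreover have "a + y \<notin> part_sums ds" using part_sums_le[of "a + y" ds] ds \<open>0 < y\<close> by auto
    ultimately show "y \<in> part_sums ds'" using ds by (auto simp: part_sums_append)
  qed
  then have "finer_comp ds' c" using Cons.prems ds by (intro Cons.IH) auto
  then obtain dss where "[] \<notin> set dss" "concat dss = ds'" "map sum_list dss = c"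
    by (auto simp: finer_comp_def)
  then show ?case unfolding finer_comp_def using ds by (intro exI[of _ "ds # dss"]) auto
qed

lemma count_list_block: "count_list u k = card (block u k)"
  by (simp add: count_list_eq_length_filter length_filter_conv_card block_def eq_commute)

lemma card_below_Suc: "card (below u (Suc k)) = card (below u k) + card (block u (Suc k))"
proof -
  have "below u (Suc k) = below u k \<union> block u (Suc k)" by (auto simp: below_def block_def)
  moreover have "card (below u k \<union> block u (Suc k)) = card (below u k) + card (block u (Suc k))"
    by (rule card_Un_disjoint) (auto simp: below_def block_def)
  ultimately show ?thesis by simp
qed

lemma part_sums_counts:
  assumes "packed u"
  shows "part_sums (map (count_list u) [1..<Suc r]) = (\<lambda>k. card (below u k)) ` {1..r}
    \<and> sum_list (map (count_list u) [1..<Suc r]) = card (below u r)"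
proof (induction r)
  case 0
  then show ?case using packed_letter[OF assms] by (fastforce simp: below_def)
next
  case (Suc r)
  have eq: "map (count_list u) [1..<Suc (Suc r)] = map (count_list u) [1..<Suc r] @ [card (block u (Suc r))]"
    by (simp add: count_list_block)
  have "{1..Suc r} = insert (Suc r) {1..r}" by auto
  then show ?case unfolding eq part_sums_append using Suc
    by (auto simp: card_below_Suc simp del: upt_Suc)
qed

lemma part_sums_ev: "packed u \<Longrightarrow> part_sums (ev u) = cuts u"
  using part_sums_counts[of u "word_max u"] by (simp add: ev_def cuts_def del: upt_Suc)

lemma sum_list_ev: "packed u \<Longrightarrow> sum_list (ev u) = length u"
  using part_sums_counts[of u "word_max u"] below_word_max[of u] by (simp add: ev_def del: upt_Suc)

lemma ev_pos: "packed u \<Longrightarrow> \<forall>x\<in>set (ev u). 0 < x"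
  using packed_set[of u] by (auto simp: ev_def count_list_0_iff neq0_conv[symmetric] simp del: upt_Suc neq0_conv)

lemma finer_word_cuts:
  "finer_word v u \<longleftrightarrow> packed u \<and> packed v \<and> Std v = Std u \<and> cuts u \<subseteq> cuts v"
proof -
  have "finer_comp (ev v) (ev u) \<longleftrightarrow> cuts u \<subseteq> cuts v"
    if "packed u" "packed v" "Std v = Std u"
  proof
    assume "finer_comp (ev v) (ev u)"
    then obtain dss where "[] \<notin> set dss" "concat dss = ev v" "map sum_list dss = ev u"
      by (auto simp: finer_comp_def)
    then have "part_sums (ev u) \<subseteq> part_sums (ev v)" using finer_comp_imp_part_sums[of dss] by simp
    then show "cuts u \<subseteq> cuts v" using that by (simp add: part_sums_ev)
next
    assume "cuts u \<subseteq> cuts v"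
    moreover have "length v = length u" using that(3) by (metis Std_length)
    ultimately show "finer_comp (ev v) (ev u)"
      using that by (intro part_sums_imp_finer_comp ev_pos) (auto simp: part_sums_ev sum_list_ev)
  qed
  then show ?thesis by (auto simp: finer_word_def)
qed

lemma card_rank_le:
  assumes "d \<le> length u"
  shows "card {j. j < length u \<and> rank u j \<le> d} = d"
proof -
  have "inj_on (rank u) {j. j < length u \<and> rank u j \<le> d}"
    using rank_bij[of u] by (auto simp: bij_betw_def inj_on_def)
  then have "card {j. j < length u \<and> rank u j \<le> d} = card (rank u ` {j. j < length u \<and> rank u j \<le> d})"
    by (simp add: card_image)
  also have "rank u ` {j. j < length u \<and> rank u j \<le> d} = rank u ` {..<length u} \<inter> {..d}" by auto
  also have "\<dots> = {1..d}" using rank_bij[of u] assms by (auto simp: bij_betw_def)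
  finally show ?thesis by simp
qed

text \<open>The word is forced: its letter at a position counts the cuts that precede the rank. That it has the
standardization of \<open>u\<close> needs the inclusion of the cuts: two positions that receive the same letter
already have the same letter in \<open>u\<close>, hence their ranks increase from left to right.\<close>

lemma exists_refinement:
  assumes u: "packed u" and D: "cuts u \<subseteq> D" "D \<subseteq> {1..length u}"
  shows "\<exists>v. finer_word v u \<and> cuts v = D"
proof (cases "u = []")
  case True
  then show ?thesis using D by (intro exI[of _ u]) (auto simp: finer_word_cuts)
next
  case False
  define n where "n = length u"
  have finD: "finite D" using D finite_subset by blast
  define v where "v = map (\<lambda>i. Suc (card {d \<in> D. d < rank u i})) [0..<n]"
  have len: "length v = n" by (simp add: v_def)
  have vi: "v ! i = Suc (card {d \<in> D. d < rank u i})" if "i < n" for i using that by (simp add: v_def)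
  have nD: "n \<in> D" using length_in_cuts[OF u False] D by (auto simp: n_def)
  have mono: "v ! i \<le> v ! j" if "i < n" "j < n" "rank u i \<le> rank u j" for i j
    using that finD by (auto simp: vi intro!: card_mono)
  have sep: "v ! i < v ! j \<longleftrightarrow> (\<exists>d\<in>D. rank u i \<le> d \<and> d < rank u j)" if "i < n" "j < n" for i j
  proof
    assume less: "v ! i < v ! j"
    show "\<exists>d\<in>D. rank u i \<le> d \<and> d < rank u j"
    proof (rule ccontr)
      assume "\<not> ?thesis"
      then have "{d \<in> D. d < rank u j} \<subseteq> {d \<in> D. d < rank u i}" by auto
      then have "v ! j \<le> v ! i" using that finD by (auto simp: vi intro!: card_mono)
      with less show False by simp
    qed
  next
    assume "\<exists>d\<in>D. rank u i \<le> d \<and> d < rank u j"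
    then obtain d where d: "d \<in> D" "rank u i \<le> d" "d < rank u j" by auto
    then have "{d \<in> D. d < rank u i} \<subseteq> {d \<in> D. d < rank u j}"
      "d \<in> {d \<in> D. d < rank u j}" "d \<notin> {d \<in> D. d < rank u i}" by auto
    then have "{d \<in> D. d < rank u i} \<subset> {d \<in> D. d < rank u j}" by blast
    then have "card {d \<in> D. d < rank u i} < card {d \<in> D. d < rank u j}"
      using finD by (intro psubset_card_mono) auto
    then show "v ! i < v ! j" using that by (simp add: vi)
  qed
  \<comment> \<open>Positions that \<open>v\<close> leaves in one block are in one block of \<open>u\<close>, where ranks increase.\<close>
  have same: "u ! i = u ! j" if ij: "i < n" "j < n" "v ! i = v ! j" for i j
  proof (rule ccontr)
    have *: False if h: "h < n" "l < n" "v ! h = v ! l" "u ! h < u ! l" for h l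
    proof -
      let ?d = "card (below u (u ! h))"
      have "?d \<in> cuts u" unfolding cuts_def using packed_letter[OF u] h by (auto simp: n_def)
      moreover have "rank u h \<le> ?d" "?d < rank u l"
        using below_rank[of h u "u ! h"] below_rank[of l u "u ! h"] h by (auto simp: n_def)
      ultimately have "v ! h < v ! l" using sep[of h l] h D by auto
      with h show False by simp
    qed
    assume "u ! i \<noteq> u ! j"
    then consider "u ! i < u ! j" | "u ! j < u ! i" by linarith
    then show False using *[of i j] *[of j i] ij by cases auto
  qed
  have lex: "v ! j < v ! i \<or> v ! j = v ! i \<and> j \<le> i \<longleftrightarrow> rank u j \<le> rank u i" if "i < n" "j < n" for i j
  proof -
    have 1: "rank u j \<le> rank u i \<longleftrightarrow> j \<le> i" if "v ! j = v ! i"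
    proof -
      have "u ! i = u ! j" using same[of i j] that \<open>i < n\<close> \<open>j < n\<close> by simp
      then have "rank u i < rank u j \<longleftrightarrow> i < j"
        using rank_less_iff[of j u i] \<open>i < n\<close> \<open>j < n\<close> by (simp add: n_def)
      then show ?thesis by (meson not_le)
    qed
    show ?thesis
    proof (cases "v ! j = v ! i")
      case True
      then show ?thesis using 1 by simp
    next
      case False
      then have "v ! j < v ! i \<longleftrightarrow> \<not> v ! i < v ! j" by auto
      moreover have "v ! j < v ! i \<longrightarrow> rank u j \<le> rank u i"
        using mono[of i j] that by (cases "rank u i \<le> rank u j") auto
      moreover have "rank u j \<le> rank u i \<longrightarrow> \<not> v ! i < v ! j" using mono[of j i] that by auto
      ultimately show ?thesis using False by auto
    qed
  qed
  have "Std v = Std u"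
  proof (rule nth_equalityI)
    fix i assume "i < length (Std v)"
    then have i: "i < n" by (simp add: len)
    then have ri: "rank u i \<in> {1..n}" using rank_bij[of u] by (auto simp: n_def bij_betw_def)
    have "Std v ! i = card {j. j < n \<and> (v ! j < v ! i \<or> v ! j = v ! i \<and> j \<le> i)}"
      using i len by (simp add: Std_def)
    also have "\<dots> = card {j. j < n \<and> rank u j \<le> rank u i}"
      by (intro arg_cong[of _ _ card] Collect_cong conj_cong refl lex[OF i])
    also have "\<dots> = rank u i" using ri by (simp add: n_def card_rank_le)
    finally show "Std v ! i = Std u ! i" by (simp add: rank_def)
  qed (simp add: len n_def)
  \<comment> \<open>The cuts of \<open>v\<close>: for \<open>d\<close> in \<open>D\<close> the position of rank \<open>d\<close> is the end of its block.\<close>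
  have dpos: "\<exists>i<n. rank u i = d" if "d \<in> D" for d
  proof -
    have "d \<in> rank u ` {..<n}" using that D rank_bij[of u] by (auto simp: n_def bij_betw_def)
    then show ?thesis by auto
  qed
  have below_v: "card (below v (v ! i)) = d" if d: "d \<in> D" "i < n" "rank u i = d" for d i
  proof -
    have eq: "below v (v ! i) = {j. j < n \<and> rank u j \<le> d}"
    proof -
      have "v ! j \<le> v ! i \<longleftrightarrow> rank u j \<le> d" if j: "j < n" for j
      proof (cases "rank u j \<le> d")
        case True
        then show ?thesis using mono[of j i] j d by simp
      next
        case False
        then have "\<exists>e\<in>D. rank u i \<le> e \<and> e < rank u j" using d by (intro bexI[of _ d]) auto
        then have "v ! i < v ! j" using sep[of i j] j d by blast
        with False show ?thesis by simp
      qed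
      then show ?thesis by (auto simp: below_def len)
    qed
    have "d \<le> length u" using D d by auto
    then show ?thesis unfolding eq n_def by (rule card_rank_le)
  qed
  define dd where "dd = (\<lambda>d. Suc (card {e \<in> D. e < d}))"
  have dd_inj: "inj_on dd D"
  proof (rule linorder_inj_onI)
    fix d e assume "d < e" "d \<in> D" "e \<in> D"
    then have "{x \<in> D. x < d} \<subseteq> {x \<in> D. x < e}" "d \<in> {x \<in> D. x < e}" "d \<notin> {x \<in> D. x < d}"
      by auto
    then have "{x \<in> D. x < d} \<subset> {x \<in> D. x < e}" by blast
    then have "card {x \<in> D. x < d} < card {x \<in> D. x < e}" using finD by (intro psubset_card_mono) auto
    then show "dd d \<noteq> dd e" by (simp add: dd_def)
  qed auto
  have dd_range: "dd ` D = {1..card D}"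
  proof (rule card_subset_eq)
    have "card {e \<in> D. e < d} < card D" if "d \<in> D" for d
    proof (rule psubset_card_mono[OF finD])
      have "d \<notin> {e \<in> D. e < d}" "{e \<in> D. e < d} \<subseteq> D" by auto
      with that show "{e \<in> D. e < d} \<subset> D" by blast
    qed
    then show "dd ` D \<subseteq> {1..card D}" by (auto simp: dd_def Suc_le_eq)
  qed (use dd_inj in \<open>auto simp: card_image\<close>)
  have setv: "set v = dd ` D"
  proof
    show "dd ` D \<subseteq> set v"
    proof
      fix k assume "k \<in> dd ` D"
      then obtain d where d: "d \<in> D" "k = dd d" by auto
      then obtain i where i: "i < n" "rank u i = d" using dpos by blast
      then have "k = v ! i" using d by (simp add: dd_def vi)
      then show "k \<in> set v" using i len by simp
    qed
    show "set v \<subseteq> dd ` D"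
    proof
      fix k assume "k \<in> set v"
      then obtain i where i: "i < n" "k = v ! i" by (auto simp: in_set_conv_nth len)
      have "rank u i \<in> {1..n}" using rank_bij[of u] i by (auto simp: n_def bij_betw_def)
      then have "n \<notin> {d \<in> D. d < rank u i}" "{d \<in> D. d < rank u i} \<subseteq> D" by auto
      then have "{d \<in> D. d < rank u i} \<subset> D" using nD by blast
      then have "card {d \<in> D. d < rank u i} < card D" using finD by (intro psubset_card_mono)
      then show "k \<in> dd ` D" unfolding dd_range i(2) vi[OF i(1)] by auto
    qed
  qed
  then have pv: "packed v" using dd_range by (auto simp: packed_def)
  then have "{1..word_max v} = dd ` D" using packed_set setv by simp
  then have "cuts v = (\<lambda>d. card (below v (dd d))) ` D" by (simp add: cuts_def image_image)
  also have "\<dots> = (\<lambda>d. d) ` D"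
  proof (rule image_cong[OF refl])
    fix d assume d: "d \<in> D"
    then obtain i where i: "i < n" "rank u i = d" using dpos by blast
    then have "dd d = v ! i" by (simp add: dd_def vi)
    then show "card (below v (dd d)) = d" using below_v[OF d i] by simp
  qed
  finally have "cuts v = D" by simp
  then show ?thesis using pv \<open>Std v = Std u\<close> u D by (auto simp: finer_word_cuts)
qed

text \<open>The refinements of \<open>u\<close> form a Boolean lattice.\<close>

lemma cuts_bij_betw:
  assumes u: "packed u"
  shows "bij_betw cuts {v. finer_word v u} {D. cuts u \<subseteq> D \<and> D \<subseteq> {1..length u}}"
proof (rule bij_betwI')
  fix v w assume "v \<in> {v. finer_word v u}" "w \<in> {v. finer_word v u}"
  then show "cuts v = cuts w \<longleftrightarrow> v = w" using eq_of_Std_cuts[of v w] by (auto simp: finer_word_cuts)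
next
  fix v assume v: "v \<in> {v. finer_word v u}"
  then have "Std v = Std u" by (simp add: finer_word_cuts)
  then have "length v = length u" by (metis Std_length)
  then show "cuts v \<in> {D. cuts u \<subseteq> D \<and> D \<subseteq> {1..length u}}"
    using v cuts_subset[of v] by (auto simp: finer_word_cuts)
next
  fix D assume "D \<in> {D. cuts u \<subseteq> D \<and> D \<subseteq> {1..length u}}"
  then show "\<exists>v\<in>{v. finer_word v u}. D = cuts v" using exists_refinement[OF u, of D] by auto
qed

section \<open>The cones in terms of cuts\<close>

text \<open>The argument \<open>p\<close> is a standardization. As all refinements of a word share it, their cones are
described by signs of the same sums.\<close>

definition rank_sum :: "nat list \<Rightarrow> nat \<Rightarrow> (nat \<Rightarrow> real) \<Rightarrow> real" where
  "rank_sum p d x = (\<Sum>i | i < length p \<and> p ! i \<le> d. x i)"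

lemma sum_below: "sum x (below u k) = rank_sum (Std u) (card (below u k)) x"
  unfolding rank_sum_def by (subst below_eq_rank) (simp add: rank_def)

lemma K_cone_cuts:
  assumes "packed u"
  shows "K_cone u = {x \<in> space (leb (length u)). \<forall>d\<in>cuts u. 0 \<le> rank_sum (Std u) d x}"
  unfolding K_cone_below[OF assms] cuts_def by (auto simp: sum_below)

text \<open>The segmented permutation is the inverse of the standardization.\<close>

lemma map_rank_seg_perm:
  assumes u: "packed u"
  shows "map (rank u) (concat (seg_perm u)) = [1..<Suc (length u)]"
proof -
  define L where "L r = concat (map (\<lambda>k. sorted_list_of_set (block u k)) [1..<Suc r])" for r
  have L_Suc: "L (Suc r) = L r @ sorted_list_of_set (block u (Suc r))" for r by (simp add: L_def)
  have fin: "finite (block u k)" for k by (simp add: block_def)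
  have *: "set (L r) = below u r \<and> sorted_wrt (\<lambda>i j. rank u i < rank u j) (L r)" for r
  proof (induction r)
    case 0
    have "below u 0 = {}" using packed_letter[OF u] by (fastforce simp: below_def)
    then show ?case by (simp add: L_def)
  next
    case (Suc r)
    have set: "set (sorted_list_of_set (block u (Suc r))) = block u (Suc r)" using fin by simp
    have "below u (Suc r) = below u r \<union> block u (Suc r)" by (auto simp: below_def block_def)
    then have "set (L (Suc r)) = below u (Suc r)" using Suc set by (simp add: L_Suc)
    moreover have "sorted_wrt (\<lambda>i j. rank u i < rank u j) (sorted_list_of_set (block u (Suc r)))"
    proof (rule sorted_wrt_mono_rel[of _ "(<)"])
      show "sorted_wrt (<) (sorted_list_of_set (block u (Suc r)))" by simp
      fix i j assume "i \<in> set (sorted_list_of_set (block u (Suc r)))"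
        "j \<in> set (sorted_list_of_set (block u (Suc r)))" "i < j"
      then show "rank u i < rank u j" unfolding set by (intro rank_less) (auto simp: block_def)
    qed
    moreover have "rank u i < rank u j" if "i \<in> below u r" "j \<in> block u (Suc r)" for i j
      using that by (intro rank_less) (auto simp: below_def block_def)
    ultimately show ?case using Suc set by (simp add: L_Suc sorted_wrt_append)
  qed
  have seg: "concat (seg_perm u) = L (word_max u)" by (simp only: seg_perm_def L_def)
  have "sorted_wrt (<) (map (rank u) (concat (seg_perm u)))"
    unfolding seg sorted_wrt_map by (rule conjunct2[OF *])
  then have 1: "sorted (map (rank u) (concat (seg_perm u)))"
    and 2: "distinct (map (rank u) (concat (seg_perm u)))"
    unfolding strict_sorted_iff by (rule conjunct1, rule conjunct2)
  have "set (concat (seg_perm u)) = {..<length u}"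
    unfolding seg below_word_max[OF u, symmetric] by (rule conjunct1[OF *])
  then have 3: "set (map (rank u) (concat (seg_perm u))) = set [1..<Suc (length u)]"
    using bij_betw_imp_surj_on[OF rank_bij[of u]]
    by (simp only: set_map set_upt atLeastLessThanSuc_atLeastAtMost)
  show ?thesis
    by (rule sorted_distinct_set_unique[OF 1 2 _ _ 3]) (simp_all del: upt_Suc)
qed

lemma sorted_le_last: "sorted xs \<Longrightarrow> x \<in> set xs \<Longrightarrow> x \<le> last xs"
  by (induction xs) auto

lemma C_cone_cuts:
  assumes u: "packed u"
  shows "C_cone u = {x \<in> space (leb (length u)).
    \<forall>d\<in>{1..length u}. if d \<in> cuts u then 0 \<le> rank_sum (Std u) d x else rank_sum (Std u) d x < 0}"
proof -
  define n where "n = length u"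
  define \<sigma> where "\<sigma> = concat (seg_perm u)"
  have len: "length \<sigma> = n" using sum_card_blocks[OF u] by (simp add: \<sigma>_def n_def)
  have rank_nth: "rank u (\<sigma> ! k) = Suc k" if "k < n" for k
  proof -
    have "rank u (\<sigma> ! k) = map (rank u) \<sigma> ! k" using that len by simp
    also have "\<dots> = Suc k" using that by (simp add: \<sigma>_def map_rank_seg_perm[OF u] n_def del: upt_Suc)
    finally show ?thesis .
  qed
  have bound: "\<sigma> ! k < n" if "k < n" for k
  proof -
    have "\<sigma> ! k \<in> set \<sigma>" using that len by simp
    then show ?thesis using set_concat_seg_perm[of u] by (auto simp: \<sigma>_def n_def)
  qed
  have inj: "inj_on (rank u) {..<n}" using rank_bij[of u] by (simp add: bij_betw_def n_def)
  have sums: "(\<Sum>i\<le>k. x (\<sigma> ! i)) = rank_sum (Std u) (Suc k) x" if k: "k < n" for k x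
  proof -
    have bij: "bij_betw ((!) \<sigma>) {..k} {i. i < n \<and> rank u i \<le> Suc k}"
    proof (rule bij_betwI')
      fix i j assume "i \<in> {..k}" "j \<in> {..k}"
      then have r: "rank u (\<sigma> ! i) = Suc i" "rank u (\<sigma> ! j) = Suc j" using rank_nth k by simp_all
      show "\<sigma> ! i = \<sigma> ! j \<longleftrightarrow> i = j"
      proof
        assume "\<sigma> ! i = \<sigma> ! j"
        then have "Suc i = Suc j" unfolding r[symmetric] by (rule arg_cong)
        then show "i = j" by simp
      qed simp
    next
      fix i assume "i \<in> {..k}"
      then show "\<sigma> ! i \<in> {i. i < n \<and> rank u i \<le> Suc k}" using rank_nth[of i] bound[of i] k by auto
    next
      fix i assume i: "i \<in> {i. i < n \<and> rank u i \<le> Suc k}"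
      then have "rank u i \<in> {1..n}"
        using bij_betwE[OF rank_bij[of u]] unfolding n_def by blast
      then obtain j where j: "rank u i = Suc j" "j < n"
        using Suc_le_D[of 0 "rank u i"] by (metis One_nat_def Suc_le_lessD atLeastAtMost_iff)
      then have "rank u (\<sigma> ! j) = rank u i" using rank_nth by simp
      moreover have "\<sigma> ! j \<in> {..<n}" "i \<in> {..<n}" using bound i j by simp_all
      ultimately have "\<sigma> ! j = i" by (rule inj_onD[OF inj])
      moreover have "j \<in> {..k}" using i j by simp
      ultimately show "\<exists>j\<in>{..k}. i = \<sigma> ! j" by blast
    qed
    have "(\<Sum>i\<le>k. x (\<sigma> ! i)) = (\<Sum>i | i < n \<and> rank u i \<le> Suc k. x i)"
      by (rule sum.reindex_bij_betw[OF bij])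
    then show ?thesis unfolding rank_sum_def rank_def n_def Std_length .
  qed
  have rank_last: "rank u (last (sorted_list_of_set (block u k))) = card (below u k) \<and>
      last (sorted_list_of_set (block u k)) < n" if k: "k \<in> {1..word_max u}" for k
  proof -
    let ?m = "last (sorted_list_of_set (block u k))"
    have fin: "finite (block u k)" by (simp add: block_def)
    obtain i where "i < length u" "u ! i = k" using packed_letter_occurs[OF u, of k] k by auto
    then have ne: "sorted_list_of_set (block u k) \<noteq> []" using fin by (auto simp: block_def)
    then have "?m \<in> set (sorted_list_of_set (block u k))" by (rule last_in_set)
    then have m: "?m < n" "u ! ?m = k" using fin by (auto simp: block_def n_def)
    have max: "j \<le> ?m" if "j \<in> block u k" for j
      using fin that by (intro sorted_le_last) auto
    have "rank u ?m = card (below u k)"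
      unfolding rank_eq_card[OF m(1)[unfolded n_def]] m(2)
      by (rule arg_cong[of _ _ card]) (use max in \<open>auto simp: below_def block_def\<close>)
    with m show ?thesis by simp
  qed
  have ends: "block_end u (\<sigma> ! k) \<longleftrightarrow> Suc k \<in> cuts u" if k: "k < n" for k
  proof
    assume "block_end u (\<sigma> ! k)"
    then obtain l where l: "l \<in> set [1..<Suc (word_max u)]" "\<sigma> ! k = last (sorted_list_of_set (block u l))"
      unfolding block_end_def seg_perm_def set_map by blast
    then have l': "l \<in> {1..word_max u}" by (simp only: set_upt atLeastLessThanSuc_atLeastAtMost)
    then have "Suc k = card (below u l)" using rank_last[OF l'] rank_nth[OF k] l(2) by simp
    then show "Suc k \<in> cuts u" unfolding cuts_def using l' by (rule image_eqI)
  next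
    assume "Suc k \<in> cuts u"
    then obtain l where l: "l \<in> {1..word_max u}" "Suc k = card (below u l)" by (auto simp: cuts_def)
    then have "rank u (last (sorted_list_of_set (block u l))) = rank u (\<sigma> ! k)"
      using rank_last[of l] rank_nth[OF k] by simp
    then have eq: "last (sorted_list_of_set (block u l)) = \<sigma> ! k"
      by (rule inj_onD[OF inj]) (use rank_last[OF l(1)] bound[OF k] in simp_all)
    have "sorted_list_of_set (block u l) \<in> set (seg_perm u)"
      unfolding seg_perm_def using l by (simp del: upt_Suc)
    then show "block_end u (\<sigma> ! k)" unfolding block_end_def eq[symmetric] by (rule imageI)
  qed
  have shift: "(\<forall>k<n. P (Suc k)) \<longleftrightarrow> (\<forall>d\<in>{1..n}. P d)" for P
    unfolding image_Suc_lessThan[symmetric] by blast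
  have "(\<forall>k<n. if block_end u (\<sigma> ! k) then 0 \<le> (\<Sum>i\<le>k. x (\<sigma> ! i)) else (\<Sum>i\<le>k. x (\<sigma> ! i)) < 0)
      \<longleftrightarrow> (\<forall>k<n. if Suc k \<in> cuts u then 0 \<le> rank_sum (Std u) (Suc k) x else rank_sum (Std u) (Suc k) x < 0)" for x
    by (intro all_cong) (simp only: ends sums)
  also have "\<dots> x \<longleftrightarrow> (\<forall>d\<in>{1..n}. if d \<in> cuts u then 0 \<le> rank_sum (Std u) d x else rank_sum (Std u) d x < 0)" for x
    by (rule shift)
  finally show ?thesis unfolding C_cone_def Let_def \<sigma>_def n_def by (intro Collect_cong conj_cong refl)
qed

text \<open>The complementary factors are multiplied out. A set \<open>D\<close> between \<open>A\<close> and \<open>N\<close> records where the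
summand \<open>- h d\<close> is chosen, and the parity of the added elements is that of \<open>card D + card A\<close>.\<close>

lemma prod_complement_expand:
  fixes h :: "'b \<Rightarrow> real"
  assumes "finite N" "A \<subseteq> N"
  shows "prod h A * (\<Prod>d\<in>N - A. 1 - h d) = (\<Sum>D | A \<subseteq> D \<and> D \<subseteq> N. (- 1) ^ (card D + card A) * prod h D)"
proof -
  have finA: "finite A" using assms finite_subset by blast
  have "(\<Prod>d\<in>N - A. 1 - h d) = (\<Prod>d\<in>N - A. - h d + 1)" by simp
  also have "\<dots> = (\<Sum>Z\<in>Pow (N - A). (\<Prod>d\<in>Z. - h d))"
    using assms by (subst prod_add) auto
  also have "\<dots> = (\<Sum>Z\<in>Pow (N - A). (- 1) ^ card Z * prod h Z)"
    by (simp add: prod_uminus)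
  finally have "prod h A * (\<Prod>d\<in>N - A. 1 - h d)
      = (\<Sum>Z\<in>Pow (N - A). prod h A * ((- 1) ^ card Z * prod h Z))"
    by (simp add: sum_distrib_left)
  also have "\<dots> = (\<Sum>D | A \<subseteq> D \<and> D \<subseteq> N. (- 1) ^ (card D + card A) * prod h D)"
  proof (rule sum.reindex_bij_witness[of _ "\<lambda>D. D - A" "\<lambda>Z. A \<union> Z"])
    fix Z assume Z: "Z \<in> Pow (N - A)"
    then have fZ: "finite Z" "A \<inter> Z = {}" using assms finite_subset[of Z N] by auto
    then have "card (A \<union> Z) = card A + card Z" "prod h (A \<union> Z) = prod h A * prod h Z"
      using finA by (simp_all add: card_Un_disjoint prod.union_disjoint)
    then show "(- 1) ^ (card (A \<union> Z) + card A) * prod h (A \<union> Z) = prod h A * ((- 1) ^ card Z * prod h Z)"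
      by (simp add: power_add power_mult_distrib[symmetric])
  qed (use assms in auto)
  finally show ?thesis .
qed

text \<open>For fixed \<open>x\<close> the right-hand side is the expansion of a product of factors \<open>h d\<close> for the cuts \<open>d\<close>
of \<open>u\<close> and \<open>1 - h d\<close> for the other ranks, as a refinement of \<open>u\<close> amounts to a choice of additional cuts.\<close>

lemma C_cone_expansion:
  assumes u: "packed u" and x: "x \<in> space (leb (length u))"
  shows "indicator (C_cone u) x
    = (\<Sum>v | finer_word v u. (- 1) ^ (word_max v + word_max u) * (indicator (K_cone v) x :: real))"
proof -
  define h :: "nat \<Rightarrow> real" where "h d = (if 0 \<le> rank_sum (Std u) d x then 1 else 0)" for d
  let ?N = "{1..length u}"
  have prod_h: "prod h D = (if \<forall>d\<in>D. 0 \<le> rank_sum (Std u) d x then 1 else 0)" if "finite D" for D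
    using that by (induction D) (auto simp: h_def)
  have prod_h': "(\<Prod>d\<in>D. 1 - h d) = (if \<forall>d\<in>D. rank_sum (Std u) d x < 0 then 1 else 0)" if "finite D" for D
    using that by (induction D) (auto simp: h_def)
  have cu: "cuts u \<subseteq> ?N" using cuts_subset[OF u] .
  then have fc: "finite (cuts u)" using finite_subset by blast
  have "indicator (C_cone u) x = prod h (cuts u) * (\<Prod>d\<in>?N - cuts u. 1 - h d)"
    using cu x unfolding C_cone_cuts[OF u] prod_h[OF fc]
    by (subst prod_h') (auto simp: indicator_def split: if_splits)
  also have "\<dots> = (\<Sum>D | cuts u \<subseteq> D \<and> D \<subseteq> ?N. (- 1) ^ (card D + card (cuts u)) * prod h D)"
    using cu by (intro prod_complement_expand) auto
  also have "\<dots> = (\<Sum>v | finer_word v u. (- 1) ^ (card (cuts v) + card (cuts u)) * prod h (cuts v))"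
    by (rule sum.reindex_bij_betw[OF cuts_bij_betw[OF u], symmetric])
  also have "\<dots> = (\<Sum>v | finer_word v u. (- 1) ^ (word_max v + word_max u) * indicator (K_cone v) x)"
  proof (rule sum.cong[OF refl])
    fix v assume "v \<in> {v. finer_word v u}"
    then have v: "packed v" "Std v = Std u" by (auto simp: finer_word_cuts)
    then have len: "length v = length u" by (metis Std_length)
    have "finite (cuts v)" by (simp add: cuts_def)
    then have "prod h (cuts v) = indicator (K_cone v) x"
      using x v len by (simp add: prod_h K_cone_cuts indicator_def)
    then show "(- 1) ^ (card (cuts v) + card (cuts u)) * prod h (cuts v)
        = (- 1) ^ (word_max v + word_max u) * indicator (K_cone v) x"
      using card_cuts v u by simp
  qed
  finally show ?thesis .
qed

text \<open>A proper refinement has more blocks: this makes the expansion of \<open>C_cone\<close> unitriangular.\<close>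

lemma finer_word_max:
  assumes "finer_word v u" "v \<noteq> u" shows "word_max u < word_max v"
proof -
  have *: "packed u" "packed v" "Std v = Std u" "cuts u \<subseteq> cuts v"
    using assms by (auto simp: finer_word_cuts)
  then have "cuts u \<noteq> cuts v" using eq_of_Std_cuts[of v u] assms by auto
  then have "card (cuts u) < card (cuts v)" using * by (intro psubset_card_mono) (auto simp: cuts_def)
  then show ?thesis using * by (simp add: card_cuts)
qed

lemma finer_word_refl: "packed u \<Longrightarrow> finer_word u u"
  by (simp add: finer_word_cuts)

lemma finer_word_length: "finer_word v u \<Longrightarrow> length v = length u"
  unfolding finer_word_cuts by (metis Std_length)

section \<open>Linear independence of the cones\<close>

text \<open>Moebius inversion on the lattice of finite sets, in the only case of interest: if all sums over
principal order ideals vanish, so do the sums over the fibres.\<close>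

lemma Moebius_vanish:
  fixes c :: "'v \<Rightarrow> real" and D :: "'v \<Rightarrow> 'b set"
  assumes V: "finite V" and fin: "\<And>v. v \<in> V \<Longrightarrow> finite (D v)"
    and zero: "\<And>Y. finite Y \<Longrightarrow> (\<Sum>v | v \<in> V \<and> D v \<subseteq> Y. c v) = 0"
  shows "finite A \<Longrightarrow> (\<Sum>v | v \<in> V \<and> D v = A. c v) = 0"
proof (induction A rule: finite_psubset_induct)
  case (psubset A)
  have eq: "{v. v \<in> V \<and> D v \<subseteq> A} = (\<Union>B\<in>Pow A. {v. v \<in> V \<and> D v = B})" by auto
  have "0 = (\<Sum>v | v \<in> V \<and> D v \<subseteq> A. c v)"
    using zero[OF psubset.hyps] by simp
  also have "\<dots> = (\<Sum>B\<in>Pow A. \<Sum>v | v \<in> V \<and> D v = B. c v)"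
    unfolding eq using V psubset.hyps by (subst sum.UNION_disjoint) auto
  also have "\<dots> = (\<Sum>v | v \<in> V \<and> D v = A. c v) + (\<Sum>B\<in>Pow A - {A}. \<Sum>v | v \<in> V \<and> D v = B. c v)"
    using psubset.hyps by (subst sum.remove[of _ A]) auto
  also have "(\<Sum>B\<in>Pow A - {A}. \<Sum>v | v \<in> V \<and> D v = B. c v) = 0"
    by (rule sum.neutral) (auto intro: psubset.IH)
  finally show ?case by simp
qed

text \<open>A point whose coordinates have pairwise different orders of magnitude. Here \<open>\<pi>\<close> gives the order of
magnitude of a coordinate, and \<open>Y\<close> the magnitudes of the positive coordinates.\<close>

definition lacunary :: "(nat \<Rightarrow> nat) \<Rightarrow> nat \<Rightarrow> nat set \<Rightarrow> nat \<Rightarrow> real" where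
  "lacunary \<pi> n Y = (\<lambda>i\<in>{..<n}. (if \<pi> i \<in> Y then 1 else - 1) * 2 ^ \<pi> i)"

text \<open>The largest power of two exceeds the sum of all smaller ones, and by at least one. This margin is
what makes the signs stable in a neighbourhood of the point.\<close>

lemma lacunary_sum:
  assumes inj: "inj_on \<pi> {..<n}" and S: "S \<subseteq> {..<n}" "S \<noteq> {}"
  shows "if Max (\<pi> ` S) \<in> Y then sum (lacunary \<pi> n Y) S \<ge> 1 else sum (lacunary \<pi> n Y) S \<le> - 1"
proof -
  have finS: "finite S" using S finite_subset by blast
  then have "Max (\<pi> ` S) \<in> \<pi> ` S" using S by (intro Max_in) auto
  then obtain m where m: "m \<in> S" "\<pi> m = Max (\<pi> ` S)" by auto
  let ?x = "lacunary \<pi> n Y"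
  have less: "\<pi> i < \<pi> m" if "i \<in> S - {m}" for i
  proof -
    have "\<pi> i \<le> \<pi> m" unfolding m(2) using finS that by (intro Max_ge) auto
    moreover have "\<pi> i \<noteq> \<pi> m" using inj S(1) m(1) that by (metis DiffD1 DiffD2 inj_on_eq_iff insertI1 subsetD)
    ultimately show ?thesis by simp
  qed
  have "\<bar>sum ?x (S - {m})\<bar> \<le> (\<Sum>i\<in>S - {m}. \<bar>?x i\<bar>)" by (rule sum_abs)
  also have "\<dots> = (\<Sum>i\<in>S - {m}. 2 ^ \<pi> i)"
    using S by (intro sum.cong) (auto simp: lacunary_def abs_mult)
  also have "\<dots> = (\<Sum>k\<in>\<pi> ` (S - {m}). 2 ^ k)"
    using inj S by (subst sum.reindex) (auto intro: inj_on_subset)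
  also have "\<dots> \<le> (\<Sum>k<\<pi> m. (2::real) ^ k)"
    using less by (intro sum_mono2) auto
  also have "\<dots> = 2 ^ \<pi> m - 1"
    by (simp add: sum_gp_strict)
  finally have "\<bar>sum ?x (S - {m})\<bar> \<le> 2 ^ \<pi> m - 1" .
  moreover have "sum ?x S = ?x m + sum ?x (S - {m})" using finS m by (simp add: sum.remove)
  moreover have "?x m = (if \<pi> m \<in> Y then 1 else - 1) * 2 ^ \<pi> m"
    using S m by (auto simp: lacunary_def)
  ultimately show ?thesis using m(2) by (auto simp: abs_le_iff)
qed

text \<open>A property that holds almost everywhere holds somewhere in every box, as the box has positive measure.\<close>

lemma AE_box:
  assumes ae: "AE x in leb n. P x" and p: "e > 0"
  shows "\<exists>x\<in>space (leb n). (\<forall>i<n. \<bar>x i - p i\<bar> \<le> e) \<and> P x"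
proof (rule ccontr)
  interpret product_sigma_finite "\<lambda>_::nat. lborel :: real measure" by standard
  assume no: "\<not> ?thesis"
  let ?B = "Pi\<^sub>E {..<n} (\<lambda>i. {p i - e..p i + e})"
  have B: "?B \<in> sets (leb n)" unfolding leb_def by (auto intro!: sets_PiM_I_finite)
  have "?B \<subseteq> {x \<in> space (leb n). \<not> P x}"
  proof
    fix x assume x: "x \<in> ?B"
    then have "x \<in> space (leb n)" by (auto simp: space_leb PiE_iff)
    moreover have "\<forall>i<n. \<bar>x i - p i\<bar> \<le> e" using x by (auto simp: PiE_iff abs_le_iff algebra_simps)
    ultimately show "x \<in> {x \<in> space (leb n). \<not> P x}" using no by auto
  qed
  moreover obtain N where "N \<in> null_sets (leb n)" "{x \<in> space (leb n). \<not> P x} \<subseteq> N"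
    using ae by (auto simp: eventually_ae_filter)
  ultimately have "?B \<in> null_sets (leb n)" using B null_sets_subset by blast
  then have "emeasure (leb n) ?B = 0" by auto
  moreover have "emeasure (leb n) ?B = (\<Prod>i<n. emeasure lborel {p i - e..p i + e})"
    unfolding leb_def by (rule emeasure_PiM) auto
  moreover have "\<dots> \<noteq> 0" using p by (simp add: prod_zero_iff)
  ultimately show False by simp
qed

text \<open>The magnitudes of the coordinates that decide the signs of the defining sums of \<open>K_cone v\<close>.\<close>

definition tops :: "(nat \<Rightarrow> nat) \<Rightarrow> nat list \<Rightarrow> nat set" where
  "tops \<pi> v = (\<lambda>k. Max (\<pi> ` below v k)) ` {1..word_max v}"

lemma below_nonempty:
  assumes "packed v" "1 \<le> k" "k \<le> word_max v" shows "below v k \<noteq> {}"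
  using below_strict_mono[OF assms(1), of 0 k] assms by auto

text \<open>The radius is chosen so that a sum of at most \<open>n\<close> coordinates changes by less than one.\<close>

lemma K_cone_near_lacunary:
  assumes v: "packed v" and n: "length v = n" and inj: "inj_on \<pi> {..<n}"
    and x: "x \<in> space (leb n)" "\<forall>i<n. \<bar>x i - lacunary \<pi> n Y i\<bar> \<le> 1 / (1 + real n)"
  shows "x \<in> K_cone v \<longleftrightarrow> tops \<pi> v \<subseteq> Y"
proof -
  have "0 \<le> sum x (below v k) \<longleftrightarrow> Max (\<pi> ` below v k) \<in> Y" if "k \<in> {1..word_max v}" for k
  proof -
    let ?S = "below v k" and ?p = "lacunary \<pi> n Y"
    have S: "?S \<subseteq> {..<n}" "?S \<noteq> {}"
      using below_nonempty[OF v, of k] that n by (auto simp: below_def)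
    have "\<bar>sum x ?S - sum ?p ?S\<bar> = \<bar>\<Sum>i\<in>?S. x i - ?p i\<bar>" by (simp add: sum_subtractf)
    also have "\<dots> \<le> (\<Sum>i\<in>?S. \<bar>x i - ?p i\<bar>)" by (rule sum_abs)
    also have "\<dots> \<le> (\<Sum>i\<in>?S. 1 / (1 + real n))" using S x(2) by (intro sum_mono) auto
    also have "\<dots> = real (card ?S) / (1 + real n)" by simp
    also have "\<dots> < 1" using card_mono[OF _ S(1)] by simp
    finally have "\<bar>sum x ?S - sum ?p ?S\<bar> < 1" .
    then show ?thesis using lacunary_sum[OF inj S, of Y] by (auto split: if_splits)
  qed
  then show ?thesis using x(1) n unfolding K_cone_below[OF v] tops_def by auto
qed

text \<open>The triangularity behind linear independence. Here \<open>\<pi>\<close> orders the positions by letter of \<open>u\<close> and then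
from left to right, so that the maximum over the first \<open>k\<close> blocks of \<open>u\<close> is reached at the end of the
\<open>k\<close>-th block.\<close>

lemma tops_eq_imp_le:
  assumes u: "packed u" and v: "packed v" and n: "length u = n" "length v = n"
    and pi: "\<pi> = (\<lambda>i. u ! i * n + i)" and eq: "tops \<pi> v = tops \<pi> u" and i: "i < n"
  shows "u ! i \<le> v ! i"
proof (cases "v ! i \<le> word_max u")
  case False
  then show ?thesis using packed_letter(2)[OF u, of i] i n by linarith
next
  case True
  let ?a = "\<lambda>k. Max (\<pi> ` below v k)" and ?b = "\<lambda>k. Max (\<pi> ` below u k)"
  have pi_less: "\<pi> i < \<pi> j" if "u ! i < u ! j" "i < n" for i j
  proof -
    have "\<pi> i < Suc (u ! i) * n" using that by (simp add: pi)
    also have "\<dots> \<le> u ! j * n" using that by (intro mult_right_mono) auto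
    finally show ?thesis by (simp add: pi)
  qed
  define k where "k = v ! i"
  have k: "1 \<le> k" "k \<le> word_max u" "k \<le> word_max v"
    using True packed_letter[OF v] i n by (auto simp: k_def)
  have b_in: "\<exists>l. l < n \<and> u ! l \<le> j \<and> \<pi> l = ?b j" if "1 \<le> j" "j \<le> word_max u" for j
  proof -
    have "?b j \<in> \<pi> ` below u j" using below_nonempty[OF u that] by (intro Max_in) auto
    then show ?thesis using n by (auto simp: below_def)
  qed
  have a_mono: "?a j \<le> ?a j'" if "1 \<le> j" "j \<le> j'" "j' \<le> word_max v" for j j'
    using below_nonempty[OF v, of j] below_mono[of j j' v] that by (intro Max_mono) auto
  have b_mono: "?b j < ?b j'" if jj: "1 \<le> j" "j < j'" "j' \<le> word_max u" for j j'
  proof -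
    obtain l where l: "l < n" "u ! l \<le> j" "\<pi> l = ?b j" using b_in[of j] jj by auto
    obtain l' where l': "l' < length u" "u ! l' = j'"
      using packed_letter_occurs[OF u, of j'] jj by auto
    have "\<pi> l < \<pi> l'" using l l' jj by (intro pi_less) auto
    also have "\<dots> \<le> ?b j'" using l' by (intro Max_ge) (auto simp: below_def)
    finally show ?thesis using l by simp
  qed
  \<comment> \<open>The value \<open>?b k\<close> is the \<open>k\<close>-th smallest of the common set, and a weakly increasing enumeration
      reaches its \<open>k\<close>-th smallest value at index \<open>k\<close> or later.\<close>
  have "?b k \<in> tops \<pi> v" unfolding eq unfolding tops_def using k by auto
  then obtain j where j: "1 \<le> j" "j \<le> word_max v" "?a j = ?b k" by (auto simp: tops_def)
  have "k \<le> j"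
  proof -
    have "?b ` {1..k} \<subseteq> ?a ` {1..j}"
    proof
      fix y assume "y \<in> ?b ` {1..k}"
      then obtain h where h: "1 \<le> h" "h \<le> k" "y = ?b h" by auto
      then have "y \<in> tops \<pi> v" unfolding eq unfolding tops_def using k by auto
      then obtain g where g: "1 \<le> g" "g \<le> word_max v" "y = ?a g" by (auto simp: tops_def)
      show "y \<in> ?a ` {1..j}"
      proof (cases "h = k")
        case True
        then show ?thesis using j h by (intro image_eqI[of _ _ j]) auto
      next
        case False
        then have "?a g < ?a j" using b_mono[of h k] h k g j by auto
        moreover have "?a j \<le> ?a g" if "j \<le> g" using a_mono[of j g] j g that by simp
        ultimately have "g \<le> j" by linarith
        then show ?thesis using g by auto
      qed
    qed
    then have "card (?b ` {1..k}) \<le> card (?a ` {1..j})" by (intro card_mono) auto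
    also have "\<dots> \<le> j" using card_image_le[of "{1..j}" ?a] by simp
    finally have "card (?b ` {1..k}) \<le> j" .
    moreover have "inj_on ?b {1..k}"
      using b_mono k by (intro strict_mono_on_imp_inj_on strict_mono_onI) auto
    ultimately show ?thesis by (simp add: card_image)
  qed
  have "\<pi> i \<le> ?a k" using i n by (intro Max_ge) (auto simp: below_def k_def)
  also have "\<dots> \<le> ?a j" using k j \<open>k \<le> j\<close> by (intro a_mono) auto
  also have "\<dots> = ?b k" by (rule j)
  finally have "\<pi> i \<le> ?b k" .
  moreover obtain l where l: "l < n" "u ! l \<le> k" "\<pi> l = ?b k" using b_in[of k] k by blast
  moreover have "\<pi> l < \<pi> i" if "k < u ! i" using pi_less[of l i] l that by simp
  ultimately have "u ! i \<le> k" by linarith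
  then show ?thesis by (simp add: k_def)
qed

lemma inj_on_lex: "inj_on (\<lambda>i. w ! i * n + i) {..<n::nat}"
proof (rule inj_onI)
  fix i j assume "i \<in> {..<n}" "j \<in> {..<n}" and eq: "w ! i * n + i = w ! j * n + j"
  moreover have "(a * n + i) mod n = i" if "i < n" for a i using that by simp
  ultimately show "i = j" by (metis lessThan_iff)
qed

text \<open>Among the words with nonzero coefficient one with maximal letter sum is the only one with its set of
\<open>tops\<close>, for the order adapted to it; hence its coefficient is zero after all.\<close>

lemma K_indicators_independent:
  assumes V: "finite V" "\<And>v. v \<in> V \<Longrightarrow> packed v \<and> length v = n"
    and zero: "AE x in leb n. (\<Sum>v\<in>V. c v * indicator (K_cone v) x) = (0::real)"
  shows "\<forall>v\<in>V. c v = 0"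
proof (rule ccontr)
  assume "\<not> ?thesis"
  then have ne: "{v \<in> V. c v \<noteq> 0} \<noteq> {}" by auto
  have fin: "finite {v \<in> V. c v \<noteq> 0}" using V by simp
  obtain u where u: "u \<in> V" "c u \<noteq> 0" and umax: "\<And>v. v \<in> V \<Longrightarrow> c v \<noteq> 0 \<Longrightarrow> sum_list v \<le> sum_list u"
  proof -
    have "Max (sum_list ` {v \<in> V. c v \<noteq> 0}) \<in> sum_list ` {v \<in> V. c v \<noteq> 0}"
      using ne fin by (intro Max_in) auto
    then obtain u where "u \<in> {v \<in> V. c v \<noteq> 0}" "sum_list u = Max (sum_list ` {v \<in> V. c v \<noteq> 0})"
      by auto
    then show ?thesis using fin by (intro that[of u]) auto
  qed
  \<comment> \<open>The lexicographic order on pairs of a letter and a position.\<close>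
  define \<pi> where "\<pi> = (\<lambda>i. u ! i * n + i)"
  have inj: "inj_on \<pi> {..<n}" unfolding \<pi>_def by (rule inj_on_lex)
  have sum0: "(\<Sum>v | v \<in> V \<and> tops \<pi> v \<subseteq> Y. c v) = 0" for Y
  proof -
    obtain x where x: "x \<in> space (leb n)" "\<forall>i<n. \<bar>x i - lacunary \<pi> n Y i\<bar> \<le> 1 / (1 + real n)"
      and z: "(\<Sum>v\<in>V. c v * indicator (K_cone v) x) = 0"
      using AE_box[OF zero, of "1 / (1 + real n)" "lacunary \<pi> n Y"] by auto
    have "(\<Sum>v | v \<in> V \<and> tops \<pi> v \<subseteq> Y. c v) = (\<Sum>v\<in>V. if tops \<pi> v \<subseteq> Y then c v else 0)"
      using V by (simp add: sum.If_cases Int_def)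
    also have "\<dots> = (\<Sum>v\<in>V. c v * indicator (K_cone v) x)"
      using V(2) K_cone_near_lacunary[OF _ _ inj x] by (intro sum.cong) (auto simp: indicator_def)
    finally show ?thesis using z by simp
  qed
  have "(\<Sum>v | v \<in> V \<and> tops \<pi> v = tops \<pi> u. c v) = 0"
    by (rule Moebius_vanish[OF V(1)]) (auto simp: sum0, auto simp: tops_def)
  moreover have "(\<Sum>v | v \<in> V \<and> tops \<pi> v = tops \<pi> u. c v) = (\<Sum>v\<in>{u}. c v)"
  proof (rule sum.mono_neutral_right)
    show "\<forall>v\<in>{v. v \<in> V \<and> tops \<pi> v = tops \<pi> u} - {u}. c v = 0"
    proof (intro ballI, rule ccontr)
      fix v assume v: "v \<in> {v. v \<in> V \<and> tops \<pi> v = tops \<pi> u} - {u}" and cv: "c v \<noteq> 0"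
      have le: "u ! i \<le> v ! i" if "i < n" for i
        using tops_eq_imp_le[of u v n \<pi>] V u v that by (auto simp: \<pi>_def)
      have len: "length u = n" "length v = n" using V u v by auto
      have "u = v"
      proof (rule nth_equalityI)
        fix i assume i: "i < length u"
        show "u ! i = v ! i"
        proof (rule ccontr)
          assume "u ! i \<noteq> v ! i"
          with le i len have "u ! i < v ! i" by (simp add: le_neq_implies_less)
          then have "(\<Sum>i<n. u ! i) < (\<Sum>i<n. v ! i)"
            using le i len by (intro sum_strict_mono_ex1) auto
          then have "sum_list u < sum_list v"
            using len by (simp add: sum_list_sum_nth atLeast0LessThan)
          then show False using umax[of v] v cv by auto
        qed
      qed (use len in simp)
      with v show False by auto
    qed
  qed (use V u in auto)
  ultimately show False using u by simp
qed

section \<open>Characteristic functions in the algebra of function classes\<close>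

text \<open>The representative that underlies \<open>char_fun\<close>.\<close>

definition ind_fam :: "nat \<Rightarrow> (nat \<Rightarrow> real) set \<Rightarrow> nat \<Rightarrow> (nat \<Rightarrow> real) \<Rightarrow> real" where
  "ind_fam d A n = (if n = d \<and> A \<in> sets (leb d) then indicator A else (\<lambda>_. 0))"

lemma char_fun_abs: "char_fun d A = abs_funalg (ind_fam d A)"
  by (simp add: char_fun.abs_eq ind_fam_def[abs_def])

lemma meas_ind_fam: "meas_family (ind_fam d A)"
  by (auto simp: meas_family_def ind_fam_def)

lemma ae_rel_self: "meas_family f \<Longrightarrow> ae_rel f f"
  by (simp add: ae_rel_def)

lemma abs_funalg_eq_iff:
  "meas_family f \<Longrightarrow> meas_family g \<Longrightarrow> abs_funalg f = abs_funalg g \<longleftrightarrow> (\<forall>n. AE x in leb n. f n x = g n x)"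
  using Quotient_rel[OF Quotient_funalg, of f g] ae_rel_self[of f] ae_rel_self[of g]
  by (simp add: ae_rel_def)

lemma meas_family_sum:
  "finite V \<Longrightarrow> (\<And>v. v \<in> V \<Longrightarrow> meas_family (f v)) \<Longrightarrow> meas_family (\<lambda>n x. \<Sum>v\<in>V. c v * f v n x)"
  by (induction V rule: finite_induct) (auto intro!: meas_family_intros)

lemma abs_funalg_sum:
  assumes "finite V" "\<And>v. v \<in> V \<Longrightarrow> meas_family (f v)"
  shows "(\<Sum>v\<in>V. c v *\<^sub>R abs_funalg (f v)) = abs_funalg (\<lambda>n x. \<Sum>v\<in>V. c v * f v n x)"
  using assms
proof (induction V rule: finite_induct)
  case empty
  then show ?case by (simp add: zero_funalg.abs_eq)
next
  case (insert v V)
  have m: "meas_family (f v)" "meas_family (\<lambda>n x. \<Sum>v\<in>V. c v * f v n x)"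
    using insert by (auto intro: meas_family_sum)
  have "(\<Sum>v\<in>insert v V. c v *\<^sub>R abs_funalg (f v))
      = c v *\<^sub>R abs_funalg (f v) + abs_funalg (\<lambda>n x. \<Sum>v\<in>V. c v * f v n x)"
    using insert by simp
  also have "\<dots> = abs_funalg (\<lambda>n x. c v * f v n x + (\<Sum>v\<in>V. c v * f v n x))"
    using m by (simp add: scaleR_funalg.abs_eq plus_funalg.abs_eq ae_rel_self meas_family_scale)
  also have "\<dots> = abs_funalg (\<lambda>n x. \<Sum>v\<in>insert v V. c v * f v n x)"
    using insert.hyps by simp
  finally show ?case .
qed

lemma char_fun_sumI:
  assumes "finite V" "\<And>v. v \<in> V \<Longrightarrow> A v \<in> sets (leb d)" "B \<in> sets (leb d)"
    and "\<And>x. x \<in> space (leb d) \<Longrightarrow> indicator B x = (\<Sum>v\<in>V. c v * indicator (A v) x)"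
  shows "char_fun d B = (\<Sum>v\<in>V. c v *\<^sub>R char_fun d (A v))"
proof -
  have "AE x in leb n. ind_fam d B n x = (\<Sum>v\<in>V. c v * ind_fam d (A v) n x)" for n
    using assms by (intro AE_I2) (auto simp: ind_fam_def)
  then show ?thesis unfolding char_fun_abs
    using assms by (subst abs_funalg_sum) (auto simp: meas_ind_fam abs_funalg_eq_iff meas_family_sum)
qed

lemma char_fun_sum_zero:
  assumes "finite V" "\<And>v. v \<in> V \<Longrightarrow> A v \<in> sets (leb (d v))"
    and "(\<Sum>v\<in>V. c v *\<^sub>R char_fun (d v) (A v)) = 0"
  shows "AE x in leb n. (\<Sum>v | v \<in> V \<and> d v = n. c v * indicator (A v) x) = 0"
proof -
  have "abs_funalg (\<lambda>n x. \<Sum>v\<in>V. c v * ind_fam (d v) (A v) n x) = abs_funalg (\<lambda>_ _. 0)"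
    using assms(1,3) abs_funalg_sum[of V "\<lambda>v. ind_fam (d v) (A v)" c]
    by (simp add: char_fun_abs meas_ind_fam zero_funalg.abs_eq)
  then have "AE x in leb n. (\<Sum>v\<in>V. c v * ind_fam (d v) (A v) n x) = 0"
    using assms(1) by (subst (asm) abs_funalg_eq_iff) (auto simp: meas_ind_fam meas_family_sum meas_family_zero)
  moreover have "(\<Sum>v\<in>V. c v * ind_fam (d v) (A v) n x) = (\<Sum>v | v \<in> V \<and> d v = n. c v * indicator (A v) x)" for x
    using assms(1,2) by (intro sum.mono_neutral_cong_right) (auto simp: ind_fam_def)
  ultimately show ?thesis by simp
qed

lemma char_fun_mult:
  assumes "A \<in> sets (leb m)" "B \<in> sets (leb n)"
  shows "char_fun m A * char_fun n B
    = char_fun (m + n) {x \<in> space (leb (m + n)). slice 0 m x \<in> A \<and> slice m n x \<in> B}"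
proof -
  let ?C = "{x \<in> space (leb (m + n)). slice 0 m x \<in> A \<and> slice m n x \<in> B}"
  have "?C = (slice 0 m -` A \<inter> space (leb (m + n))) \<inter> (slice m n -` B \<inter> space (leb (m + n)))" by auto
  also have "\<dots> \<in> sets (leb (m + n))"
    using assms by (intro sets.Int measurable_sets[OF measurable_slice]) auto
  finally have C: "?C \<in> sets (leb (m + n))" .
  have "fam_mult (ind_fam m A) (ind_fam n B) k x = ind_fam (m + n) ?C k x" if x: "x \<in> space (leb k)" for k x
  proof -
    have "fam_mult (ind_fam m A) (ind_fam n B) k x
        = (\<Sum>i\<le>k. if i = m then ind_fam m A m (slice 0 m x) * ind_fam n B (k - m) (slice m (k - m) x) else 0)"
      unfolding fam_mult_def star_def by (intro sum.cong) (auto simp: ind_fam_def)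
    also have "\<dots> = (if m \<le> k then ind_fam m A m (slice 0 m x) * ind_fam n B (k - m) (slice m (k - m) x) else 0)"
      by simp
    also have "\<dots> = ind_fam (m + n) ?C k x"
      using assms C x by (auto simp: ind_fam_def indicator_def)
    finally show ?thesis .
  qed
  then have "AE x in leb k. fam_mult (ind_fam m A) (ind_fam n B) k x = ind_fam (m + n) ?C k x" for k
    by (intro AE_I2)
  then show ?thesis unfolding char_fun_abs
    by (simp add: times_funalg.abs_eq ae_rel_self meas_ind_fam abs_funalg_eq_iff meas_family_mult)
qed

lemma one_eq_char_fun: "1 = char_fun 0 (space (leb 0))"
proof -
  have "AE x in leb n. (if n = 0 then 1 else 0) = ind_fam 0 (space (leb 0)) n x" for n
    by (intro AE_I2) (auto simp: ind_fam_def)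
  then show ?thesis unfolding char_fun_abs one_funalg.abs_eq
    by (simp add: abs_funalg_eq_iff meas_family_one meas_ind_fam)
qed

section \<open>Quasi-shuffles of set compositions\<close>

text \<open>The set composition encoded by a packed word.\<close>

definition blocks :: "nat list \<Rightarrow> nat set list" where
  "blocks u = map (block u) [1..<Suc (word_max u)]"

lemma length_blocks [simp]: "length (blocks u) = word_max u"
  by (simp add: blocks_def)

text \<open>Packing an arbitrary word discards the empty ones among its blocks.\<close>

lemma filter_block_pack:
  assumes "set w \<subseteq> {1..t}"
  shows "filter (\<lambda>X. X \<noteq> {}) (map (block w) [1..<Suc t]) = blocks (pack w)"
proof -
  let ?S = "set w" and ?s = "sorted_list_of_set (set w)"
  have "filter (\<lambda>X. X \<noteq> {}) (map (block w) [1..<Suc t])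
      = map (block w) (filter (\<lambda>k. block w k \<noteq> {}) [1..<Suc t])"
    by (simp add: filter_map comp_def del: upt_Suc)
  also have "(\<lambda>k. block w k \<noteq> {}) = (\<lambda>k. k \<in> ?S)"
    by (auto simp: block_def in_set_conv_nth fun_eq_iff)
  also have "filter (\<lambda>k. k \<in> ?S) [1..<Suc t] = ?s"
  proof (rule sorted_distinct_set_unique)
    have "set [1..<Suc t] = {1..t}" by (simp only: set_upt atLeastLessThanSuc_atLeastAtMost)
    then show "set (filter (\<lambda>k. k \<in> ?S) [1..<Suc t]) = set ?s"
      using assms by (simp only: set_filter) auto
    show "sorted (filter (\<lambda>k. k \<in> ?S) [1..<Suc t])"
      by (rule sorted_wrt_filter) (simp del: upt_Suc)
  qed (simp_all del: upt_Suc)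
  also have "map (block w) ?s = map (block (pack w)) (map (rank_in ?S) ?s)"
  proof -
    have "block w b = block (pack w) (rank_in ?S b)" if "b \<in> ?S" for b
    proof -
      have inj: "inj_on (rank_in ?S) ?S"
        by (rule strict_mono_on_imp_inj_on[OF rank_in_strict_mono]) simp
      have "w ! i = b \<longleftrightarrow> rank_in ?S (w ! i) = rank_in ?S b" if "i < length w" for i
        using inj_on_eq_iff[OF inj, of "w ! i" b] \<open>b \<in> ?S\<close> that by simp
      then show ?thesis by (auto simp: block_def pack_eq_map)
    qed
    then show ?thesis by simp
  qed
  also have "map (rank_in ?S) ?s = [1..<Suc (card ?S)]"
  proof (rule sorted_distinct_set_unique)
    have *: "sorted_wrt (<) (map (rank_in ?S) ?s)"
      unfolding sorted_wrt_map
      by (rule sorted_wrt_mono_rel[of _ "(<)"]) (auto intro: rank_in_less)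
    then show "sorted (map (rank_in ?S) ?s)" "distinct (map (rank_in ?S) ?s)"
      unfolding strict_sorted_iff by (rule conjunct1, rule conjunct2)
    show "set (map (rank_in ?S) ?s) = set [1..<Suc (card ?S)]"
      using rank_in_image[of ?S] by (simp only: set_map set_sorted_list_of_set finite_set
          set_upt atLeastLessThanSuc_atLeastAtMost)
  qed (simp_all del: upt_Suc)
  finally show ?thesis by (simp add: blocks_def word_max_pack)
qed

lemma blocks_inject:
  assumes "packed u" "packed v" "length u = length v" "blocks u = blocks v" shows "u = v"
proof (rule nth_equalityI)
  fix i assume i: "i < length u"
  have m: "word_max u = word_max v" using assms(4) length_blocks by metis
  have k: "1 \<le> u ! i" "u ! i \<le> word_max u" using packed_letter[OF assms(1) i] by auto
  have nth: "blocks w ! (u ! i - 1) = block w (u ! i)" if "word_max w = word_max u" for w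
    using k that by (simp add: blocks_def del: upt_Suc)
  have "i \<in> block u (u ! i)" using i by (simp add: block_def)
  then have "i \<in> block v (u ! i)" using nth[of u] nth[of v] assms(4) m by simp
  then show "u ! i = v ! i" by (simp add: block_def)
qed (rule assms(3))

text \<open>The letter at a position is the index of the entry that contains it, counted from one.\<close>

lemma exists_word_with_blocks:
  assumes ne: "{} \<notin> set L" and cover: "\<Union> (set L) = {..<n}"
    and disj: "\<And>i j. i < length L \<Longrightarrow> j < length L \<Longrightarrow> i \<noteq> j \<Longrightarrow> L ! i \<inter> L ! j = {}"
  shows "\<exists>w. packed w \<and> length w = n \<and> blocks w = L"
proof -
  have "\<exists>k. k < length L \<and> p \<in> L ! k" if "p < n" for p
  proof -
    have "p \<in> \<Union> (set L)" using that cover by simp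
    then show ?thesis by (auto simp: in_set_conv_nth)
  qed
  then obtain f where f: "\<And>p. p < n \<Longrightarrow> f p < length L \<and> p \<in> L ! f p" by metis
  define w where "w = map (\<lambda>p. Suc (f p)) [0..<n]"
  have len: "length w = n" by (simp add: w_def)
  have block: "block w (Suc k) = L ! k" if k: "k < length L" for k
  proof
    show "block w (Suc k) \<subseteq> L ! k" using f by (auto simp: block_def w_def)
    show "L ! k \<subseteq> block w (Suc k)"
    proof
      fix p assume p: "p \<in> L ! k"
      have "L ! k \<subseteq> {..<n}" using cover nth_mem[OF k] by blast
      with p have pn: "p < n" by auto
      then have "f p = k" using disj[of "f p" k] f[OF pn] k p by blast
      then show "p \<in> block w (Suc k)" using pn by (simp add: block_def w_def)
    qed
  qed
  have "set w = {1..length L}"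
  proof
    show "set w \<subseteq> {1..length L}" using f by (auto simp: w_def Suc_le_eq)
    show "{1..length L} \<subseteq> set w"
    proof
      fix k assume "k \<in> {1..length L}"
      then obtain j where j: "k = Suc j" "j < length L" by (cases k) auto
      then have "L ! j \<noteq> {}" using ne nth_mem[of j L] by metis
      then obtain p where "p \<in> block w k" using block j by auto
      then show "k \<in> set w" by (auto simp: block_def)
    qed
  qed
  then have pw: "packed w" by (auto simp: packed_def)
  have max: "word_max w = length L"
    using packed_set[OF pw] \<open>set w = {1..length L}\<close> by (metis card_atLeastAtMost diff_Suc_1)
  have "blocks w = L"
  proof (rule nth_equalityI)
    fix i assume "i < length (blocks w)"
    then have i: "i < length L" by (simp add: max)
    then show "blocks w ! i = L ! i" using block[OF i] by (simp add: blocks_def max del: upt_Suc)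
  qed (simp add: max)
  with pw len show ?thesis by blast
qed

text \<open>Lists in which the entries of both arguments appear in their order, where an entry of the one may be
merged with an entry of the other. The lists of blocks will be reversed, so that the recursion
removes the last block, which is the one whose partial sum runs over all positions.\<close>

fun quasi_shuffles :: "'b set list \<Rightarrow> 'b set list \<Rightarrow> 'b set list set" where
  "quasi_shuffles [] Cs = {Cs}"
| "quasi_shuffles (B # Bs) [] = {B # Bs}"
| "quasi_shuffles (B # Bs) (C # Cs) =
     (#) B ` quasi_shuffles Bs (C # Cs) \<union> (#) C ` quasi_shuffles (B # Bs) Cs \<union> (#) (B \<union> C) ` quasi_shuffles Bs Cs"

lemma quasi_shuffles_Nil2 [simp]: "quasi_shuffles Bs [] = {Bs}"
  by (cases Bs) auto

lemma finite_quasi_shuffles: "finite (quasi_shuffles Bs Cs)"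
  by (induction Bs Cs rule: quasi_shuffles.induct) auto

text \<open>The set composition that a set composition induces on a subset.\<close>

definition trace :: "'b set \<Rightarrow> 'b set list \<Rightarrow> 'b set list" where
  "trace I L = filter (\<lambda>X. X \<noteq> {}) (map (\<lambda>X. X \<inter> I) L)"

lemma trace_simps [simp]:
  "trace I [] = []"
  "trace I (X # L) = (if X \<inter> I = {} then trace I L else (X \<inter> I) # trace I L)"
  by (auto simp: trace_def)

definition parts_in :: "'b set \<Rightarrow> 'b set list \<Rightarrow> bool" where
  "parts_in I L \<longleftrightarrow> (\<forall>X\<in>set L. X \<noteq> {} \<and> X \<subseteq> I)"

lemma parts_in_simps [simp]:
  "parts_in I []" "parts_in I (X # L) \<longleftrightarrow> X \<noteq> {} \<and> X \<subseteq> I \<and> parts_in I L"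
  by (auto simp: parts_in_def)

lemma trace_id: "parts_in I L \<Longrightarrow> trace I L = L"
  by (induction L) (auto simp: Int_absorb2)

lemma trace_disjoint: "parts_in I L \<Longrightarrow> I \<inter> J = {} \<Longrightarrow> trace J L = []"
proof (induction L)
  case (Cons X L)
  then have "X \<inter> J = {}" by auto
  with Cons show ?case by simp
qed simp

text \<open>Together with \<open>quasi_shuffles_traces\<close>: the quasi-shuffles of two set compositions of disjoint sets are the
set compositions of the union that induce the given ones. An entry that meets only one of the two sets
comes from one argument, and an entry that meets both is a merged one.\<close>

lemma traces_in_quasi_shuffles: "parts_in (I \<union> J) L \<Longrightarrow> L \<in> quasi_shuffles (trace I L) (trace J L)"
proof (induction L)
  case (Cons X L)
  then have IH: "L \<in> quasi_shuffles (trace I L) (trace J L)" and X: "X \<noteq> {}" "X \<subseteq> I \<union> J" by auto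
  consider "X \<inter> I = {}" "X \<inter> J = X" "X \<inter> J \<noteq> {}" | "X \<inter> J = {}" "X \<inter> I = X" "X \<inter> I \<noteq> {}"
    | "X \<inter> I \<noteq> {}" "X \<inter> J \<noteq> {}" "X = X \<inter> I \<union> X \<inter> J" using X by blast
  then show ?case
  proof cases
    case 1
    then show ?thesis using IH by (cases "trace I L") auto
  next
    case 2
    then show ?thesis using IH by (cases "trace J L") auto
  next
    case 3
    have "X # L \<in> (#) (X \<inter> I \<union> X \<inter> J) ` quasi_shuffles (trace I L) (trace J L)"
      using 3(3) IH by auto
    then show ?thesis using 3(1,2) by simp
  qed
qed simp

lemma quasi_shuffles_traces:
  assumes "I \<inter> J = {}"
  shows "parts_in I Bs \<Longrightarrow> parts_in J Cs \<Longrightarrow> L \<in> quasi_shuffles Bs Cs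
    \<Longrightarrow> parts_in (I \<union> J) L \<and> trace I L = Bs \<and> trace J L = Cs"
proof (induction Bs Cs arbitrary: L rule: quasi_shuffles.induct)
  case (1 Cs)
  then have "L = Cs" by simp
  moreover have "trace I Cs = []" using 1 assms by (intro trace_disjoint) auto
  moreover have "parts_in (I \<union> J) Cs" using 1 by (auto simp: parts_in_def)
  ultimately show ?case using trace_id 1 by auto
next
  case (2 B Bs)
  then have "L = B # Bs" by simp
  moreover have "trace J (B # Bs) = []" using 2 assms by (intro trace_disjoint[of I]) auto
  moreover have "parts_in (I \<union> J) (B # Bs)" using 2 by (auto simp: parts_in_def)
  ultimately show ?case using trace_id 2 by metis
next
  case (3 B Bs C Cs)
  have B: "B \<noteq> {}" "B \<inter> I = B" "B \<inter> J = {}" "B \<subseteq> I \<union> J" and C: "C \<noteq> {}" "C \<inter> J = C" "C \<inter> I = {}" "C \<subseteq> I \<union> J"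
    using 3 assms by auto
  have BC: "(B \<union> C) \<inter> I = B" "(B \<union> C) \<inter> J = C" using B C by blast+
  consider L' where "L = B # L'" "L' \<in> quasi_shuffles Bs (C # Cs)" | L' where "L = C # L'" "L' \<in> quasi_shuffles (B # Bs) Cs"
    | L' where "L = (B \<union> C) # L'" "L' \<in> quasi_shuffles Bs Cs" using "3.prems" by auto
  then show ?case
  proof cases
    case (1 L')
    then have "parts_in (I \<union> J) L' \<and> trace I L' = Bs \<and> trace J L' = C # Cs"
      using 3 by simp
    with 1 B show ?thesis by simp
  next
    case (2 L')
    then have "parts_in (I \<union> J) L' \<and> trace I L' = B # Bs \<and> trace J L' = Cs"
      using 3 by simp
    with 2 C show ?thesis by simp
  next
    case (3 L')
    then have "parts_in (I \<union> J) L' \<and> trace I L' = Bs \<and> trace J L' = Cs"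
      using "3.IH"(3) "3.prems" by simp
    with 3 B C BC show ?thesis by simp
  qed
qed

lemma quasi_shuffles_Union: "L \<in> quasi_shuffles Bs Cs \<Longrightarrow> \<Union> (set L) = \<Union> (set Bs) \<union> \<Union> (set Cs)"
proof (induction Bs Cs arbitrary: L rule: quasi_shuffles.induct)
  case (3 B Bs C Cs)
  consider L' where "L = B # L'" "L' \<in> quasi_shuffles Bs (C # Cs)" | L' where "L = C # L'" "L' \<in> quasi_shuffles (B # Bs) Cs"
    | L' where "L = (B \<union> C) # L'" "L' \<in> quasi_shuffles Bs Cs" using "3.prems" by auto
  then show ?case
  proof cases
    case (1 L')
    show ?thesis using "3.IH"(1)[OF 1(2)] by (simp add: 1(1) Un_ac)
  next
    case (2 L')
    show ?thesis using "3.IH"(2)[OF 2(2)] by (simp add: 2(1) Un_ac)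
  next
    case (3 L')
    show ?thesis using "3.IH"(3)[OF 3(2)] by (simp add: 3(1) Un_ac)
  qed
qed simp_all

text \<open>Expressed through \<open>sorted_wrt\<close>, which is compatible with reversal and with \<open>map\<close>.\<close>

definition disjoint_list :: "'b set list \<Rightarrow> bool" where
  "disjoint_list = sorted_wrt (\<lambda>X Y. X \<inter> Y = {})"

lemma disjoint_list_simps [simp]:
  "disjoint_list []" "disjoint_list (X # L) \<longleftrightarrow> X \<inter> \<Union> (set L) = {} \<and> disjoint_list L"
  by (auto simp: disjoint_list_def)

lemma disjoint_list_quasi_shuffles:
  "L \<in> quasi_shuffles Bs Cs \<Longrightarrow> disjoint_list Bs \<Longrightarrow> disjoint_list Cs
    \<Longrightarrow> \<Union> (set Bs) \<inter> \<Union> (set Cs) = {} \<Longrightarrow> disjoint_list L"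
proof (induction Bs Cs arbitrary: L rule: quasi_shuffles.induct)
  case (3 B Bs C Cs)
  have sub: "\<Union> (set Bs) \<inter> \<Union> (set (C # Cs)) = {}" "\<Union> (set (B # Bs)) \<inter> \<Union> (set Cs) = {}"
      "\<Union> (set Bs) \<inter> \<Union> (set Cs) = {}" "disjoint_list Bs" "disjoint_list Cs"
    and head: "B \<inter> \<Union> (set Bs) = {}" "B \<inter> \<Union> (set (C # Cs)) = {}"
      "C \<inter> \<Union> (set Cs) = {}" "C \<inter> \<Union> (set (B # Bs)) = {}"
      "B \<inter> \<Union> (set Cs) = {}" "C \<inter> \<Union> (set Bs) = {}"
    using "3.prems"(2-4) by auto
  consider L' where "L = B # L'" "L' \<in> quasi_shuffles Bs (C # Cs)" | L' where "L = C # L'" "L' \<in> quasi_shuffles (B # Bs) Cs"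
    | L' where "L = (B \<union> C) # L'" "L' \<in> quasi_shuffles Bs Cs" using "3.prems"(1) by auto
  then show ?case
  proof cases
    case (1 L')
    have "disjoint_list L'" by (rule "3.IH"(1)[OF 1(2) sub(4) "3.prems"(3) sub(1)])
    then show ?thesis unfolding 1(1) disjoint_list_simps quasi_shuffles_Union[OF 1(2)] Int_Un_distrib head by simp
  next
    case (2 L')
    have "disjoint_list L'" by (rule "3.IH"(2)[OF 2(2) "3.prems"(2) sub(5) sub(2)])
    then show ?thesis unfolding 2(1) disjoint_list_simps quasi_shuffles_Union[OF 2(2)] Int_Un_distrib head by simp
  next
    case (3 L')
    have "disjoint_list L'" by (rule "3.IH"(3)[OF 3(2) sub(4) sub(5) sub(3)])
    then show ?thesis unfolding 3(1) disjoint_list_simps quasi_shuffles_Union[OF 3(2)] Int_Un_distrib Int_Un_distrib2 head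
      by simp
  qed
qed auto

section \<open>The quasi-shuffle identity for half-spaces\<close>

text \<open>The indicator of the set of \<open>x\<close> for which the sums over all final segments are nonnegative. On the
reversed list of blocks of \<open>u\<close> these are the conditions for \<open>K_cone u\<close>.\<close>

fun nested_ind :: "('b \<Rightarrow> real) \<Rightarrow> 'b set list \<Rightarrow> real" where
  "nested_ind x [] = 1"
| "nested_ind x (X # L) = (if 0 \<le> (\<Sum>Y\<leftarrow>X # L. sum x Y) then 1 else 0) * nested_ind x L"

text \<open>All quasi-shuffles have the same total, so that the condition on the whole list can be factored out.\<close>

lemma quasi_shuffles_total:
  assumes "I \<inter> J = {}" "finite I" "finite J"
  shows "parts_in I Bs \<Longrightarrow> parts_in J Cs \<Longrightarrow> L \<in> quasi_shuffles Bs Cs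
    \<Longrightarrow> (\<Sum>Y\<leftarrow>L. sum x Y) = (\<Sum>Y\<leftarrow>Bs. sum x Y) + (\<Sum>Y\<leftarrow>Cs. sum x (Y :: 'b set) :: real)"
proof (induction Bs Cs arbitrary: L rule: quasi_shuffles.induct)
  case (3 B Bs C Cs)
  have "B \<inter> C = {}" using "3.prems"(1,2) assms(1) by auto
  moreover have "finite B" "finite C"
    using "3.prems"(1,2) assms(2,3) by (auto intro: finite_subset)
  ultimately have BC: "sum x (B \<union> C) = sum x B + sum x C" by (simp add: sum.union_disjoint)
  have p: "parts_in I Bs" "parts_in J Cs" using "3.prems"(1,2) by auto
  consider L' where "L = B # L'" "L' \<in> quasi_shuffles Bs (C # Cs)" | L' where "L = C # L'" "L' \<in> quasi_shuffles (B # Bs) Cs"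
    | L' where "L = (B \<union> C) # L'" "L' \<in> quasi_shuffles Bs Cs" using "3.prems"(3) by auto
  then show ?case
  proof cases
    case (1 L')
    show ?thesis using "3.IH"(1)[OF p(1) "3.prems"(2) 1(2)] by (simp add: 1(1))
  next
    case (2 L')
    show ?thesis using "3.IH"(2)[OF "3.prems"(1) p(2) 2(2)] by (simp add: 2(1))
  next
    case (3 L')
    show ?thesis using "3.IH"(3)[OF p 3(2)] by (simp add: 3(1) BC)
  qed
qed auto

text \<open>All quasi-shuffles share the condition that the total \<open>a + b\<close> is nonnegative. After factoring it out,
the three kinds of first entries leave three smaller quasi-shuffle sums, and the induction hypothesis
reduces the claim to the identity for the two numbers \<open>a\<close> and \<open>b\<close> described at the beginning.\<close>

lemma quasi_shuffle_identity:
  assumes IJ: "I \<inter> J = {}" "finite I" "finite J"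
  shows "parts_in I Bs \<Longrightarrow> parts_in J Cs \<Longrightarrow>
    (\<Sum>L\<in>quasi_shuffles Bs Cs. (- 1) ^ length L * nested_ind x L)
      = (- 1) ^ (length Bs + length Cs) * nested_ind x Bs * nested_ind x (Cs :: 'b set list)"
proof (induction Bs Cs rule: quasi_shuffles.induct)
  case (3 B Bs C Cs)
  let ?F = "\<lambda>L. (- 1) ^ length L * nested_ind x L" and ?t = "\<lambda>L. \<Sum>Y\<leftarrow>L. sum x Y"
  let ?a = "?t (B # Bs)" and ?b = "?t (C # Cs)"
  let ?H = "\<lambda>s::real. if 0 \<le> s then 1 else (0::real)"
  have BC: "B \<inter> C = {}" "B \<noteq> {}" "C \<noteq> {}" using "3.prems" IJ by auto
  then have ne: "B \<noteq> C" "B \<noteq> B \<union> C" "C \<noteq> B \<union> C" by blast+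
  have "finite B" "finite C" using "3.prems"(1,2) IJ(2,3) by (auto intro: finite_subset)
  then have sumBC: "sum x (B \<union> C) = sum x B + sum x C" using BC(1) by (simp add: sum.union_disjoint)
  have step: "(\<Sum>L\<in>(#) X ` quasi_shuffles Bs' Cs'. ?F L) = - ?H (?a + ?b) * (\<Sum>L\<in>quasi_shuffles Bs' Cs'. ?F L)"
    if "\<And>L. L \<in> quasi_shuffles Bs' Cs' \<Longrightarrow> sum x X + ?t L = ?a + ?b" for X Bs' Cs'
  proof -
    have "(\<Sum>L\<in>(#) X ` quasi_shuffles Bs' Cs'. ?F L) = (\<Sum>L\<in>quasi_shuffles Bs' Cs'. ?F (X # L))"
      by (subst sum.reindex) (auto simp: comp_def)
    also have "\<dots> = (\<Sum>L\<in>quasi_shuffles Bs' Cs'. - ?H (?a + ?b) * ?F L)"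
    proof (rule sum.cong[OF refl])
      fix L assume L: "L \<in> quasi_shuffles Bs' Cs'"
      have "nested_ind x (X # L) = ?H (?a + ?b) * nested_ind x L"
        using that[OF L] by (simp only: nested_ind.simps list.map sum_list.Cons)
      then show "?F (X # L) = - ?H (?a + ?b) * ?F L" by simp
    qed
    finally show ?thesis by (simp only: sum_distrib_left)
  qed
  have p: "parts_in I Bs" "parts_in J Cs" "parts_in I (B # Bs)" "parts_in J (C # Cs)"
    using "3.prems" by auto
  have cons_disj: "(#) X ` S \<inter> (#) Y ` T = {}" if "X \<noteq> Y" for X Y :: "'b set" and S T using that by auto
  have "((#) B ` quasi_shuffles Bs (C # Cs) \<union> (#) C ` quasi_shuffles (B # Bs) Cs) \<inter> (#) (B \<union> C) ` quasi_shuffles Bs Cs = {}"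
    unfolding Int_Un_distrib2 cons_disj[OF ne(2)] cons_disj[OF ne(3)] by simp
  then have "(\<Sum>L\<in>quasi_shuffles (B # Bs) (C # Cs). ?F L)
      = (\<Sum>L\<in>(#) B ` quasi_shuffles Bs (C # Cs). ?F L) + (\<Sum>L\<in>(#) C ` quasi_shuffles (B # Bs) Cs. ?F L)
        + (\<Sum>L\<in>(#) (B \<union> C) ` quasi_shuffles Bs Cs. ?F L)"
    unfolding quasi_shuffles.simps
    by (simp only: sum.union_disjoint cons_disj[OF ne(1)] finite_Un finite_imageI finite_quasi_shuffles)
  also have "(\<Sum>L\<in>(#) B ` quasi_shuffles Bs (C # Cs). ?F L) = - ?H (?a + ?b) * (\<Sum>L\<in>quasi_shuffles Bs (C # Cs). ?F L)"
    by (rule step) (use quasi_shuffles_total[OF IJ p(1,4), of _ x] in simp)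
  also have "(\<Sum>L\<in>(#) C ` quasi_shuffles (B # Bs) Cs. ?F L) = - ?H (?a + ?b) * (\<Sum>L\<in>quasi_shuffles (B # Bs) Cs. ?F L)"
    by (rule step) (use quasi_shuffles_total[OF IJ p(3,2), of _ x] in simp)
  also have "(\<Sum>L\<in>(#) (B \<union> C) ` quasi_shuffles Bs Cs. ?F L) = - ?H (?a + ?b) * (\<Sum>L\<in>quasi_shuffles Bs Cs. ?F L)"
    by (rule step) (use quasi_shuffles_total[OF IJ p(1,2), of _ x] sumBC in simp)
  also note "3.IH"(1)[OF p(1,4)]
  also note "3.IH"(2)[OF p(3,2)]
  also note "3.IH"(3)[OF p(1,2)]
  finally have expand: "(\<Sum>L\<in>quasi_shuffles (B # Bs) (C # Cs). ?F L)
    = - ?H (?a + ?b) * ((- 1) ^ (length Bs + length (C # Cs)) * nested_ind x Bs * nested_ind x (C # Cs))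
      + - ?H (?a + ?b) * ((- 1) ^ (length (B # Bs) + length Cs) * nested_ind x (B # Bs) * nested_ind x Cs)
      + - ?H (?a + ?b) * ((- 1) ^ (length Bs + length Cs) * nested_ind x Bs * nested_ind x Cs)" .
  have heads: "nested_ind x (B # Bs) = ?H ?a * nested_ind x Bs" "nested_ind x (C # Cs) = ?H ?b * nested_ind x Cs"
    by (rule nested_ind.simps(2))+
  \<comment> \<open>An additional entry reverses the sign: relative to the sign \<open>e\<close> for \<open>Bs\<close> and \<open>Cs\<close> the first
      two summands carry a factor \<open>-1\<close>.\<close>
  have alg: "- h * (e * - 1 * P * (hb * Q)) + - h * (e * - 1 * (ha * P) * Q) + - h * (e * P * Q)
      = e * P * Q * (h * (ha + hb - 1))" for e h ha hb P Q :: real by (simp add: algebra_simps)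
  have "(\<Sum>L\<in>quasi_shuffles (B # Bs) (C # Cs). ?F L)
      = (- 1) ^ (length Bs + length Cs) * nested_ind x Bs * nested_ind x Cs * (?H (?a + ?b) * (?H ?a + ?H ?b - 1))"
    unfolding expand heads alg[symmetric] by (simp only: list.size add_Suc_right add_Suc power_Suc2 add_0_right)
  also have "?H (?a + ?b) * (?H ?a + ?H ?b - 1) = ?H ?a * ?H ?b" by simp
  finally show ?case unfolding heads by simp
qed auto

section \<open>Products of cones and of monomial series\<close>

text \<open>The words that occur in the product of \<open>M_ser u\<close> and \<open>M_ser v\<close>.\<close>

definition conv_words :: "nat list \<Rightarrow> nat list \<Rightarrow> nat list set" where
  "conv_words u v = {w. packed w \<and> length w = length u + length v \<and>
     pack (take (length u) w) = u \<and> pack (drop (length u) w) = v}"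

lemma finite_conv_words: "finite (conv_words u v)"
proof (rule finite_subset)
  let ?N = "length u + length v"
  show "conv_words u v \<subseteq> {w. set w \<subseteq> {..?N} \<and> length w = ?N}"
    using set_pack_le by (fastforce simp: conv_words_def)
  show "finite {w. set w \<subseteq> {..?N} \<and> length w = ?N}" by (rule finite_lists_length_eq) simp
qed

lemma sum_list_blocks:
  "(\<Sum>Y\<leftarrow>rev (map (block u) [1..<Suc t]). sum x Y) = (\<Sum>j=1..t. \<Sum>i\<in>block u j. x i :: real)"
  by (induction t) (simp_all add: rev_map[symmetric])

lemma nested_ind_blocks_aux:
  "nested_ind x (rev (map (block u) [1..<Suc t]))
    = (if \<forall>k\<in>{1..t}. 0 \<le> (\<Sum>j=1..k. \<Sum>i\<in>block u j. x i) then 1 else 0)"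
proof (induction t)
  case (Suc t)
  have eq: "rev (map (block u) [1..<Suc (Suc t)]) = block u (Suc t) # rev (map (block u) [1..<Suc t])" by simp
  have "nested_ind x (rev (map (block u) [1..<Suc (Suc t)]))
      = (if 0 \<le> (\<Sum>j=1..Suc t. \<Sum>i\<in>block u j. x i) then 1 else 0)
        * nested_ind x (rev (map (block u) [1..<Suc t]))"
    unfolding eq nested_ind.simps(2) unfolding eq[symmetric] sum_list_blocks ..
  also have "{1..Suc t} = insert (Suc t) {1..t}" by auto
  ultimately show ?case unfolding Suc by (auto simp del: sum.cl_ivl_Suc)
qed simp

lemma nested_ind_blocks:
  assumes "x \<in> space (leb (length u))"
  shows "indicator (K_cone u) x = nested_ind x (rev (blocks u))"
  using assms unfolding blocks_def nested_ind_blocks_aux by (simp add: K_cone_def indicator_def)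

lemma nested_ind_cong:
  "(\<And>X i. X \<in> set L \<Longrightarrow> i \<in> X \<Longrightarrow> x i = y i) \<Longrightarrow> nested_ind x L = nested_ind y L"
proof (induction L)
  case (Cons X L)
  have "map (sum x) (X # L) = map (sum y) (X # L)"
    by (rule map_cong[OF refl]) (use Cons.prems in \<open>auto intro!: sum.cong\<close>)
  moreover have "nested_ind x L = nested_ind y L" by (rule Cons.IH, rule Cons.prems) auto
  ultimately show ?case by (simp only: nested_ind.simps)
qed simp

lemma nested_ind_shift:
  "nested_ind x (map ((`) ((+) m)) L) = nested_ind (\<lambda>i. x (m + i)) (L :: nat set list)"
proof (induction L)
  case (Cons X L)
  have "sum x ((+) m ` Y) = (\<Sum>i\<in>Y. x (m + i))" for Y
    by (subst sum.reindex) (auto simp: comp_def)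
  then have "map (sum x) (map ((`) ((+) m)) (X # L)) = map (sum (\<lambda>i. x (m + i))) (X # L)" by simp
  then show ?case using Cons by (simp only: nested_ind.simps list.map)
qed simp

lemma trace_rev: "trace I (rev L) = rev (trace I L)"
  by (simp add: trace_def rev_map rev_filter)

lemma blocks_parts:
  assumes "packed w" "length w = n" shows "parts_in {..<n} (rev (blocks w))"
proof -
  have "block w k \<noteq> {}" if "1 \<le> k" "k \<le> word_max w" for k
    using packed_letter_occurs[OF assms(1) that] by (auto simp: block_def)
  then show ?thesis using assms(2)
    by (auto simp: parts_in_def blocks_def block_def less_Suc_eq_le simp del: upt_Suc)
qed

lemma Union_blocks: "packed w \<Longrightarrow> \<Union> (set (blocks w)) = {..<length w}"
  using packed_letter[of w] by (auto simp: blocks_def block_def less_Suc_eq_le simp del: upt_Suc)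

lemma disjoint_blocks: "disjoint_list (rev (blocks w))"
  unfolding disjoint_list_def blocks_def sorted_wrt_rev sorted_wrt_map
  by (rule sorted_wrt_mono_rel[of _ "(<)"]) (auto simp: block_def simp del: upt_Suc)

lemma trace_blocks_take:
  assumes "packed w"
  shows "trace {..<m} (blocks w) = blocks (pack (take m w))"
proof -
  have "map (\<lambda>X. X \<inter> {..<m}) (blocks w) = map (block (take m w)) [1..<Suc (word_max w)]"
    unfolding blocks_def map_map by (intro map_cong refl) (auto simp: block_def)
  moreover have "set (take m w) \<subseteq> {1..word_max w}"
    using packed_set[OF assms] set_take_subset[of m w] by blast
  ultimately show ?thesis unfolding trace_def by (simp only: filter_block_pack)
qed

lemma trace_blocks_drop:
  assumes "packed w" "m \<le> length w"
  shows "trace {m..<length w} (blocks w) = map ((`) ((+) m)) (blocks (pack (drop m w)))"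
proof -
  have "block w k \<inter> {m..<length w} = (+) m ` block (drop m w) k" for k
  proof
    show "block w k \<inter> {m..<length w} \<subseteq> (+) m ` block (drop m w) k"
    proof
      fix i assume "i \<in> block w k \<inter> {m..<length w}"
      then show "i \<in> (+) m ` block (drop m w) k"
        by (intro image_eqI[of _ _ "i - m"]) (auto simp: block_def)
    qed
    show "(+) m ` block (drop m w) k \<subseteq> block w k \<inter> {m..<length w}"
      using assms(2) by (auto simp: block_def)
  qed
  then have "map (\<lambda>X. X \<inter> {m..<length w}) (blocks w)
      = map ((`) ((+) m)) (map (block (drop m w)) [1..<Suc (word_max w)])"
    unfolding blocks_def map_map by (intro map_cong refl) simp
  then have "trace {m..<length w} (blocks w)
      = map ((`) ((+) m)) (filter (\<lambda>X. X \<noteq> {}) (map (block (drop m w)) [1..<Suc (word_max w)]))"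
    unfolding trace_def by (simp add: filter_map comp_def del: upt_Suc)
  moreover have "set (drop m w) \<subseteq> {1..word_max w}"
    using packed_set[OF assms(1)] set_drop_subset[of m w] by blast
  ultimately show ?thesis by (simp only: filter_block_pack)
qed

lemma parts_in_shift:
  "parts_in {..<n} L \<Longrightarrow> parts_in {m..<m+n} (map ((`) ((+) m)) L)" for m n :: nat
proof (induction L)
  case (Cons X L)
  then have "(+) m ` X \<subseteq> (+) m ` {..<n}" by (intro image_mono) simp
  also have "(+) m ` {..<n} = {m..<m+n}" by (simp add: lessThan_atLeast0 add.commute)
  finally show ?case using Cons by simp
qed simp

text \<open>A word in the product is determined by its blocks, and these form a set composition that induces the
blocks of \<open>u\<close> on the first positions and the shifted blocks of \<open>v\<close> on the others.\<close>

lemma conv_words_bij: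
  assumes u: "packed u" and v: "packed v"
  shows "bij_betw (\<lambda>w. rev (blocks w)) (conv_words u v)
    (quasi_shuffles (rev (blocks u)) (rev (map ((`) ((+) (length u))) (blocks v))))"
proof -
  define m n where "m = length u" and "n = length v"
  let ?I = "{..<m}" and ?J = "{m..<m+n}" and ?sh = "map ((`) ((+) m)) :: nat set list \<Rightarrow> nat set list"
  have IJ: "?I \<inter> ?J = {}" "?I \<union> ?J = {..<m+n}" by auto
  have sh_inj: "?sh L = ?sh L' \<longleftrightarrow> L = L'" for L L'
    by (rule inj_map_eq_map) (simp add: inj_def inj_image_eq_iff)
  have pu: "parts_in ?I (rev (blocks u))" using blocks_parts[OF u] by (simp add: m_def)
  have pv: "parts_in ?J (rev (?sh (blocks v)))"
    using parts_in_shift[OF blocks_parts[OF v, of n]] by (simp add: n_def rev_map)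
  have "bij_betw (\<lambda>w. rev (blocks w)) (conv_words u v) (quasi_shuffles (rev (blocks u)) (rev (?sh (blocks v))))"
  proof (rule bij_betwI')
    fix w w' assume "w \<in> conv_words u v" "w' \<in> conv_words u v"
    then show "rev (blocks w) = rev (blocks w') \<longleftrightarrow> w = w'"
      using blocks_inject[of w w'] by (auto simp: conv_words_def)
  next
    fix w assume w: "w \<in> conv_words u v"
    then have pw: "packed w" and len: "length w = m + n" and tw: "pack (take m w) = u" "pack (drop m w) = v"
      by (auto simp: conv_words_def m_def n_def)
    have "parts_in (?I \<union> ?J) (rev (blocks w))" unfolding IJ(2) by (rule blocks_parts[OF pw len])
    then have "rev (blocks w) \<in> quasi_shuffles (trace ?I (rev (blocks w))) (trace ?J (rev (blocks w)))"
      by (rule traces_in_quasi_shuffles)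
    moreover have "trace ?I (blocks w) = blocks u" using trace_blocks_take[OF pw, of m] tw by simp
    moreover have "trace ?J (blocks w) = ?sh (blocks v)"
      using trace_blocks_drop[OF pw, of m] tw len by simp
    ultimately show "rev (blocks w) \<in> quasi_shuffles (rev (blocks u)) (rev (?sh (blocks v)))"
      by (simp only: trace_rev)
  next
    fix L assume L: "L \<in> quasi_shuffles (rev (blocks u)) (rev (?sh (blocks v)))"
    have tr: "parts_in (?I \<union> ?J) L" "trace ?I L = rev (blocks u)" "trace ?J L = rev (?sh (blocks v))"
      using quasi_shuffles_traces[OF IJ(1) pu pv L] by auto
    have Uu: "\<Union> (set (rev (blocks u))) = ?I" using Union_blocks[OF u] by (simp add: m_def)
    have Uv: "\<Union> (set (rev (?sh (blocks v)))) = ?J"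
    proof -
      have "\<Union> (set (rev (?sh (blocks v)))) = (+) m ` \<Union> (set (blocks v))" by auto
      also have "\<dots> = ?J" using Union_blocks[OF v] by (simp add: n_def lessThan_atLeast0 add.commute)
      finally show ?thesis .
    qed
    have "disjoint_list (rev (?sh (blocks v)))"
    proof -
      have "sorted_wrt (\<lambda>X Y. (+) m ` X \<inter> (+) m ` Y = {}) (rev (blocks v))"
        by (rule sorted_wrt_mono_rel[OF _ disjoint_blocks[unfolded disjoint_list_def]]) auto
      then show ?thesis unfolding disjoint_list_def rev_map sorted_wrt_map .
    qed
    then have "disjoint_list L" using disjoint_list_quasi_shuffles[OF L disjoint_blocks] IJ(1) Uu Uv by simp
    then have "sorted_wrt (\<lambda>X Y. X \<inter> Y = {}) (rev L)"
      unfolding disjoint_list_def sorted_wrt_rev by (simp add: Int_commute)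
    then have less: "rev L ! i \<inter> rev L ! j = {}" if "i < j" "j < length (rev L)" for i j
      using that by (simp only: sorted_wrt_iff_nth_less)
    have "\<exists>w. packed w \<and> length w = m + n \<and> blocks w = rev L"
    proof (rule exists_word_with_blocks)
      show "{} \<notin> set (rev L)" using tr(1) by (auto simp: parts_in_def)
      show "\<Union> (set (rev L)) = {..<m+n}" using quasi_shuffles_Union[OF L] Uu Uv IJ(2) by simp
      fix i j assume "i < length (rev L)" "j < length (rev L)" "i \<noteq> j"
      then show "rev L ! i \<inter> rev L ! j = {}"
        using less[of i j] less[of j i] by (metis Int_commute linorder_neqE_nat)
    qed
    then obtain w where w: "packed w" "length w = m + n" "blocks w = rev L" by blast
    have "blocks (pack (take m w)) = blocks u"
      using trace_blocks_take[OF w(1), of m] tr(2) unfolding w(3) trace_rev by simp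
    then have "pack (take m w) = u" using w(2) u by (intro blocks_inject) (auto simp: m_def)
    moreover have "?sh (blocks (pack (drop m w))) = ?sh (blocks v)"
      using trace_blocks_drop[OF w(1), of m] tr(3) w(2) unfolding w(3) trace_rev by simp
    then have "pack (drop m w) = v" unfolding sh_inj using w(2) v
      by (intro blocks_inject) (auto simp: n_def)
    ultimately have "w \<in> conv_words u v" using w by (simp add: conv_words_def m_def n_def)
    moreover have "L = rev (blocks w)" using w(3) by simp
    ultimately show "\<exists>w\<in>conv_words u v. L = rev (blocks w)" by blast
  qed
  then show ?thesis by (simp add: m_def)
qed

lemma K_indicator_mult:
  assumes u: "packed u" and v: "packed v" and x: "x \<in> space (leb (length u + length v))"
  shows "indicator (K_cone u) (slice 0 (length u) x) * indicator (K_cone v) (slice (length u) (length v) x)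
    = (\<Sum>w\<in>conv_words u v. (- 1) ^ (word_max u + word_max v + word_max w) * (indicator (K_cone w) x :: real))"
proof -
  let ?m = "length u" and ?n = "length v"
  let ?Bs = "rev (blocks u)" and ?Cs = "rev (map ((`) ((+) ?m)) (blocks v))"
  have sl: "slice 0 ?m x \<in> space (leb ?m)" "slice ?m ?n x \<in> space (leb ?n)"
    by (auto simp: slice_def space_leb)
  have 1: "indicator (K_cone u) (slice 0 ?m x) = nested_ind x ?Bs"
    unfolding nested_ind_blocks[OF sl(1)]
    by (rule nested_ind_cong) (auto simp: blocks_def block_def slice_def simp del: upt_Suc)
  have 2: "indicator (K_cone v) (slice ?m ?n x) = nested_ind x ?Cs"
    unfolding nested_ind_blocks[OF sl(2)] rev_map nested_ind_shift
    by (rule nested_ind_cong) (auto simp: blocks_def block_def slice_def simp del: upt_Suc)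
  let ?e = "(- 1) ^ (word_max u + word_max v) :: real"
  have "(\<Sum>w\<in>conv_words u v. (- 1) ^ (word_max u + word_max v + word_max w) * (indicator (K_cone w) x :: real))
      = (\<Sum>w\<in>conv_words u v. ?e * ((- 1) ^ length (rev (blocks w)) * nested_ind x (rev (blocks w))))"
  proof (rule sum.cong[OF refl])
    fix w assume "w \<in> conv_words u v"
    then have "x \<in> space (leb (length w))" using x by (simp add: conv_words_def)
    then show "(- 1) ^ (word_max u + word_max v + word_max w) * (indicator (K_cone w) x :: real)
        = ?e * ((- 1) ^ length (rev (blocks w)) * nested_ind x (rev (blocks w)))"
      by (simp add: nested_ind_blocks power_add)
  qed
  also have "\<dots> = ?e * (\<Sum>L\<in>quasi_shuffles ?Bs ?Cs. (- 1) ^ length L * nested_ind x L)"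
    unfolding sum_distrib_left[symmetric]
    by (rule arg_cong[of _ _ "(*) ?e"], rule sum.reindex_bij_betw[OF conv_words_bij[OF u v]])
  also have "(\<Sum>L\<in>quasi_shuffles ?Bs ?Cs. (- 1) ^ length L * nested_ind x L)
      = (- 1) ^ (length ?Bs + length ?Cs) * nested_ind x ?Bs * nested_ind x ?Cs"
  proof (rule quasi_shuffle_identity)
    show "{..<?m} \<inter> {?m..<?m+?n} = {}" by auto
    show "parts_in {..<?m} ?Bs" by (rule blocks_parts[OF u refl])
    show "parts_in {?m..<?m+?n} ?Cs" unfolding rev_map by (rule parts_in_shift[OF blocks_parts[OF v refl]])
  qed simp_all
  also have "(- 1) ^ (length ?Bs + length ?Cs) = ?e" by simp
  also have "?e * (?e * nested_ind x ?Bs * nested_ind x ?Cs) = ?e * ?e * (nested_ind x ?Bs * nested_ind x ?Cs)"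
    by (simp only: mult.assoc)
  also have "?e * ?e = 1" by (simp add: power_mult_distrib[symmetric])
  finally show ?thesis unfolding 1 2 by simp
qed

lemma K_fun_mult:
  assumes u: "packed u" and v: "packed v"
  shows "K_fun u * K_fun v
    = (\<Sum>w\<in>conv_words u v. (- 1) ^ (word_max u + word_max v + word_max w) *\<^sub>R K_fun w)"
proof -
  let ?m = "length u" and ?n = "length v"
  let ?A = "{x \<in> space (leb (?m + ?n)). slice 0 ?m x \<in> K_cone u \<and> slice ?m ?n x \<in> K_cone v}"
  have "?A = (slice 0 ?m -` K_cone u \<inter> space (leb (?m + ?n))) \<inter> (slice ?m ?n -` K_cone v \<inter> space (leb (?m + ?n)))"
    by auto
  also have "\<dots> \<in> sets (leb (?m + ?n))"
    by (intro sets.Int measurable_sets[OF measurable_slice] sets_K_cone) auto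
  finally have A: "?A \<in> sets (leb (?m + ?n))" .
  have len: "length w = ?m + ?n" if "w \<in> conv_words u v" for w using that by (simp add: conv_words_def)
  have "K_fun u * K_fun v = char_fun (?m + ?n) ?A"
    unfolding K_fun_def by (rule char_fun_mult) (rule sets_K_cone)+
  also have "\<dots> = (\<Sum>w\<in>conv_words u v. (- 1) ^ (word_max u + word_max v + word_max w) *\<^sub>R char_fun (?m + ?n) (K_cone w))"
  proof (rule char_fun_sumI[OF finite_conv_words _ A])
    fix w assume "w \<in> conv_words u v"
    then show "K_cone w \<in> sets (leb (?m + ?n))" using sets_K_cone[of w] len by simp
  next
    fix x assume x: "x \<in> space (leb (?m + ?n))"
    then have "indicator ?A x = (indicator (K_cone u) (slice 0 ?m x) * indicator (K_cone v) (slice ?m ?n x) :: real)"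
      by (simp add: indicator_def)
    then show "indicator ?A x = (\<Sum>w\<in>conv_words u v.
        (- 1) ^ (word_max u + word_max v + word_max w) * (indicator (K_cone w) x :: real))"
      using K_indicator_mult[OF u v x] by simp
  qed
  also have "\<dots> = (\<Sum>w\<in>conv_words u v. (- 1) ^ (word_max u + word_max v + word_max w) *\<^sub>R K_fun w)"
    by (rule sum.cong) (simp_all add: K_fun_def len)
  finally show ?thesis .
qed

lemma nc_coeff_sum: "nc_coeff (\<Sum>v\<in>V. f v) w = (\<Sum>v\<in>V. nc_coeff (f v) w)"
  by (induction V rule: infinite_finite_induct)
     (simp_all add: zero_ncseries.rep_eq plus_ncseries.rep_eq)

lemma M_ser_mult:
  "M_ser u * M_ser v = (\<Sum>w\<in>conv_words u v. M_ser w :: 'a::linorder ncseries)"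
proof -
  let ?m = "length u" and ?n = "length v"
  have "nc_coeff (M_ser u * M_ser v :: 'a ncseries) W = nc_coeff (\<Sum>w\<in>conv_words u v. M_ser w) W" for W :: "'a list"
  proof -
    let ?P = "length W = ?m + ?n \<and> pack (take ?m W) = u \<and> pack (drop ?m W) = v"
    have "nc_coeff (M_ser u * M_ser v) W
        = (\<Sum>i\<le>length W. (if pack (take i W) = u then 1 else 0) * (if pack (drop i W) = v then 1 else 0))"
      by (simp add: times_ncseries.rep_eq M_ser.rep_eq)
    also have "\<dots> = (\<Sum>i\<le>length W. if i = ?m then (if ?P then 1 else 0) else 0)"
    proof (rule sum.cong[OF refl])
      fix i assume i: "i \<in> {..length W}"
      have "pack (take i W) = u \<and> pack (drop i W) = v \<longleftrightarrow> i = ?m \<and> ?P"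
      proof
        assume *: "pack (take i W) = u \<and> pack (drop i W) = v"
        have "length (take i W) = i" "length (drop i W) = length W - i" using i by simp_all
        moreover have "length (take i W) = ?m" "length (drop i W) = ?n"
          using * by (metis length_pack)+
        ultimately have "i = ?m" "length W = ?m + ?n" using i by simp_all
        then show "i = ?m \<and> ?P" using * by simp
      qed blast
      then have "(if pack (take i W) = u \<and> pack (drop i W) = v then 1 else 0 :: real)
          = (if i = ?m \<and> ?P then 1 else 0)" by (simp only:)
      also have "\<dots> = (if i = ?m then (if ?P then 1 else 0) else 0)" by (cases "i = ?m") simp_all
      also have "(if pack (take i W) = u \<and> pack (drop i W) = v then 1 else 0 :: real)
          = (if pack (take i W) = u then 1 else 0) * (if pack (drop i W) = v then 1 else 0)" by simp
      finally show "(if pack (take i W) = u then 1 else 0) * (if pack (drop i W) = v then 1 else 0)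
          = (if i = ?m then (if ?P then 1 else 0) else 0 :: real)" .
    qed
    also have "\<dots> = (if ?P then 1 else 0)" by simp
    also have "?P \<longleftrightarrow> pack W \<in> conv_words u v"
      by (simp add: conv_words_def pack_take_pack pack_drop_pack)
    also have "(if pack W \<in> conv_words u v then 1 else 0) = (\<Sum>w\<in>conv_words u v. if pack W = w then 1 else 0 :: real)"
      using finite_conv_words[of u v] by simp
    also have "\<dots> = nc_coeff (\<Sum>w\<in>conv_words u v. M_ser w) W"
      by (simp add: nc_coeff_sum M_ser.rep_eq)
    finally show ?thesis .
  qed
  then show ?thesis by (simp add: nc_coeff_inject[symmetric] fun_eq_iff)
qed

section \<open>The isomorphism\<close>

text \<open>An indexed version of linear independence: the vanishing of coefficients also excludes repetitions in
the family.\<close>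

lemma independent_familyI:
  assumes "\<And>V c. finite V \<Longrightarrow> V \<subseteq> I \<Longrightarrow> (\<Sum>v\<in>V. c v *\<^sub>R b v) = 0 \<Longrightarrow> \<forall>v\<in>V. c v = 0"
  shows "inj_on b I" "independent (b ` I)"
proof -
  show inj: "inj_on b I"
  proof (rule inj_onI, rule ccontr)
    fix u v assume uv: "u \<in> I" "v \<in> I" "b u = b v" "u \<noteq> v"
    then have "(\<Sum>w\<in>{u, v}. (if w = u then 1 else - 1) *\<^sub>R b w) = 0" by auto
    then show False using assms[of "{u, v}" "\<lambda>w. if w = u then 1 else - 1"] uv by auto
  qed
  show "independent (b ` I)"
    unfolding dependent_explicit
  proof clarify
    fix T c w assume T: "finite T" "T \<subseteq> b ` I" "(\<Sum>v\<in>T. c v *\<^sub>R v) = 0" "w \<in> T" "c w \<noteq> 0"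
    then obtain V where V: "V \<subseteq> I" "inj_on b V" "T = b ` V" by (auto simp: subset_image_inj)
    then have "finite V" using T(1) finite_imageD by blast
    moreover have "(\<Sum>v\<in>V. c (b v) *\<^sub>R b v) = 0" using T(3) V by (simp add: sum.reindex comp_def)
    ultimately have "\<forall>v\<in>V. c (b v) = 0" using V(1) by (intro assms)
    then show False using T V by auto
  qed
qed

lemma K_fun_sum_zero:
  assumes V: "finite V" "V \<subseteq> Collect packed" and zero: "(\<Sum>v\<in>V. c v *\<^sub>R K_fun v) = 0"
  shows "\<forall>v\<in>V. c v = 0"
proof
  fix u assume u: "u \<in> V"
  let ?V = "{v. v \<in> V \<and> length v = length u}"
  have "AE x in leb (length u). (\<Sum>v\<in>?V. c v * indicator (K_cone v) x) = 0"
    using V zero unfolding K_fun_def by (intro char_fun_sum_zero) (auto intro: sets_K_cone)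
  then have "\<forall>v\<in>?V. c v = 0"
    using V by (intro K_indicators_independent) auto
  with u show "c u = 0" by simp
qed

text \<open>The coefficients are read off at words that pack to the given packed word.\<close>

lemma M_ser_sum_zero:
  assumes inf: "infinite (UNIV :: 'a::linorder set)"
    and V: "finite V" "V \<subseteq> Collect packed" and zero: "(\<Sum>v\<in>V. c v *\<^sub>R (M_ser v :: 'a ncseries)) = 0"
  shows "\<forall>v\<in>V. c v = 0"
proof
  fix u assume u: "u \<in> V"
  then obtain w :: "'a list" where w: "pack w = u" using exists_word_with_pack[OF inf, of u] V by auto
  have "0 = nc_coeff (\<Sum>v\<in>V. c v *\<^sub>R (M_ser v :: 'a ncseries)) w"
    unfolding zero by (simp add: zero_ncseries.rep_eq)
  also have "\<dots> = (\<Sum>v\<in>V. if v = u then c v else 0)"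
    unfolding nc_coeff_sum by (intro sum.cong) (auto simp: scaleR_ncseries.rep_eq M_ser.rep_eq w)
  also have "\<dots> = c u" using V u by simp
  finally show "c u = 0" by simp
qed

lemma subalgebra_spanI:
  fixes S :: "'a::real_algebra_1 set"
  assumes one: "1 \<in> span S" and mult: "\<And>a b. a \<in> S \<Longrightarrow> b \<in> S \<Longrightarrow> a * b \<in> span S"
  shows "is_subalgebra (span S)"
proof -
  have "a * y \<in> span S" if "a \<in> S" "y \<in> span S" for a y
  proof -
    have "subspace {y. a * y \<in> span S}"
      by (auto simp: subspace_def distrib_left intro: span_add span_scale span_zero)
    then show ?thesis using span_induct[OF that(2), of "\<lambda>y. a * y \<in> span S"] mult that(1) by blast
  qed
  then have "x * y \<in> span S" if "x \<in> span S" "y \<in> span S" for x y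
  proof -
    have "subspace {x. x * y \<in> span S}"
      by (auto simp: subspace_def distrib_right intro: span_add span_scale span_zero)
    then show ?thesis using span_induct[OF that(1), of "\<lambda>x. x * y \<in> span S"] that(2)
        \<open>\<And>y a. a \<in> S \<Longrightarrow> y \<in> span S \<Longrightarrow> a * y \<in> span S\<close> by blast
  qed
  then show ?thesis using one by (simp add: is_subalgebra_def)
qed

text \<open>Multiplicativity of a linear map is inherited from a spanning set by bilinearity.\<close>

lemma linear_mult_on_span:
  fixes f :: "'a::real_algebra_1 \<Rightarrow> 'b::real_algebra_1"
  assumes f: "linear f" and gen: "\<And>a b. a \<in> S \<Longrightarrow> b \<in> S \<Longrightarrow> f (a * b) = f a * f b"
    and xy: "x \<in> span S" "y \<in> span S"
  shows "f (x * y) = f x * f y"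
proof -
  note lin = linear_add[OF f] linear_scale[OF f] linear_0[OF f]
  have "f (a * y) = f a * f y" if a: "a \<in> S" for a
  proof -
    have "subspace {y. f (a * y) = f a * f y}" by (auto simp: subspace_def distrib_left lin)
    then show ?thesis using span_induct[OF xy(2), of "\<lambda>y. f (a * y) = f a * f y"] gen a by blast
  qed
  moreover have "subspace {x. f (x * y) = f x * f y}" by (auto simp: subspace_def distrib_right lin)
  ultimately show ?thesis using span_induct[OF xy(1), of "\<lambda>x. f (x * y) = f x * f y"] by blast
qed

lemma span_subset_hull: "span S \<subseteq> is_subalgebra hull S"
  unfolding hull_def using span_minimal by (auto simp: is_subalgebra_def)

lemma K_fun_Nil: "K_fun [] = 1"
proof -
  have "K_cone [] = space (leb 0)" by (simp add: K_cone_def)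
  then show ?thesis by (simp add: K_fun_def one_eq_char_fun)
qed

lemma M_ser_Nil: "M_ser [] = 1"
proof -
  have "nc_coeff (M_ser [] :: 'a::linorder ncseries) w = nc_coeff 1 w" for w :: "'a list"
    by (simp add: M_ser.rep_eq one_ncseries.rep_eq pack_def)
  then show ?thesis by (simp add: nc_coeff_inject[symmetric] fun_eq_iff)
qed

lemma subalgebra_span_K: "is_subalgebra (span (K_fun ` Collect packed))"
proof (rule subalgebra_spanI)
  have "K_fun [] \<in> span (K_fun ` Collect packed)" by (intro span_base) auto
  then show "1 \<in> span (K_fun ` Collect packed)" by (simp add: K_fun_Nil)
next
  fix a b assume "a \<in> K_fun ` Collect packed" "b \<in> K_fun ` Collect packed"
  then obtain u v where uv: "a = K_fun u" "b = K_fun v" "packed u" "packed v" by auto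
  show "a * b \<in> span (K_fun ` Collect packed)"
    unfolding uv(1,2) K_fun_mult[OF uv(3,4)]
    by (intro span_sum span_scale span_base imageI) (simp add: conv_words_def)
qed

lemma P_alg_eq_span: "P_alg = span (K_fun ` Collect packed)"
proof
  have eq: "{K_fun u |u. packed u} = K_fun ` Collect packed" by auto
  show "P_alg \<subseteq> span (K_fun ` Collect packed)"
    unfolding P_alg_def eq by (intro hull_minimal span_superset subalgebra_span_K)
  show "span (K_fun ` Collect packed) \<subseteq> P_alg"
    unfolding P_alg_def eq by (rule span_subset_hull)
qed

lemma WQSym_eq_span: "WQSym = span (M_ser ` Collect packed)"
  by (simp add: WQSym_def setcompr_eq_image)

lemma subalgebra_WQSym: "is_subalgebra (WQSym :: 'a::linorder ncseries set)"
  unfolding WQSym_eq_span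
proof (rule subalgebra_spanI)
  have "M_ser [] \<in> span (M_ser ` Collect packed)" by (intro span_base) auto
  then show "1 \<in> span (M_ser ` Collect packed)" by (simp add: M_ser_Nil)
next
  fix a b :: "'a ncseries" assume "a \<in> M_ser ` Collect packed" "b \<in> M_ser ` Collect packed"
  then obtain u v where uv: "a = M_ser u" "b = M_ser v" "packed u" "packed v" by auto
  show "a * b \<in> span (M_ser ` Collect packed)"
    unfolding uv(1,2) M_ser_mult
    by (intro span_sum span_base imageI) (simp add: conv_words_def)
qed

lemma C_fun_expansion:
  assumes u: "packed u"
  shows "C_fun u = (\<Sum>v | finer_word v u. (- 1) ^ (word_max v + word_max u) *\<^sub>R K_fun v)"
proof -
  have "C_fun u = (\<Sum>v | finer_word v u. (- 1) ^ (word_max v + word_max u) *\<^sub>R char_fun (length u) (K_cone v))"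
    unfolding C_fun_def
  proof (rule char_fun_sumI[OF finite_finer _ sets_C_cone[OF u]])
    fix v assume "v \<in> {v. finer_word v u}"
    then show "K_cone v \<in> sets (leb (length u))" using sets_K_cone[of v] finer_word_length[of v u] by simp
  qed (rule C_cone_expansion[OF u])
  also have "\<dots> = (\<Sum>v | finer_word v u. (- 1) ^ (word_max v + word_max u) *\<^sub>R K_fun v)"
    by (rule sum.cong) (simp_all add: K_fun_def finer_word_length)
  finally show ?thesis .
qed

lemma C_fun_in_span_K: "packed u \<Longrightarrow> C_fun u \<in> span (K_fun ` Collect packed)"
  unfolding C_fun_expansion
  by (intro span_sum span_scale span_base imageI) (simp add: finer_word_cuts)

text \<open>Inverts the unitriangular expansion of \<open>C_fun\<close> by descending induction on the number of blocks, which
is at most the length.\<close>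

lemma K_fun_in_span_C: "packed u \<Longrightarrow> K_fun u \<in> span (C_fun ` Collect packed)"
proof (induction "length u - word_max u" arbitrary: u rule: less_induct)
  case less
  let ?S = "span (C_fun ` Collect packed)"
  let ?R = "\<Sum>v\<in>{v. finer_word v u} - {u}. (- 1) ^ (word_max v + word_max u) *\<^sub>R K_fun v"
  have "C_fun u = (- 1) ^ (word_max u + word_max u) *\<^sub>R K_fun u + ?R"
    unfolding C_fun_expansion[OF less.prems]
    by (rule sum.remove[OF finite_finer]) (simp add: finer_word_refl less.prems)
  then have "K_fun u = C_fun u - ?R" by (simp add: power_add power_mult_distrib[symmetric])
  moreover have "C_fun u \<in> ?S" using less.prems by (intro span_base) auto
  moreover have "K_fun v \<in> ?S" if v: "v \<in> {v. finer_word v u} - {u}" for v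
  proof (rule less.hyps)
    show pv: "packed v" using v by (simp add: finer_word_cuts)
    have "word_max u < word_max v" using v finer_word_max by auto
    moreover have "word_max v \<le> length v" by (rule word_max_le_length[OF pv])
    moreover have "length v = length u" using v finer_word_length by auto
    ultimately show "length v - word_max v < length u - word_max u" by linarith
  qed
  then have "?R \<in> ?S" by (intro span_sum span_scale) auto
  ultimately show ?case by (simp add: span_diff)
qed

theorem theorem5p5:
  assumes "infinite (UNIV :: 'a::linorder set)"
  shows "(\<forall>u. packed u \<longrightarrow> C_fun u \<in> P_alg) \<and>
    (\<exists>\<alpha> :: funalg \<Rightarrow> 'a ncseries.
       is_algebra_iso P_alg WQSym \<alpha> \<and>
       (\<forall>u. packed u \<longrightarrow> \<alpha> (C_fun u) = (-1) ^ word_max u *\<^sub>R Phi u) \<and>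
       (\<forall>\<beta> :: funalg \<Rightarrow> 'a ncseries.
          linear_on_subspace P_alg \<beta> \<and>
          (\<forall>u. packed u \<longrightarrow> \<beta> (C_fun u) = (-1) ^ word_max u *\<^sub>R Phi u) \<longrightarrow>
          (\<forall>f\<in>P_alg. \<beta> f = \<alpha> f)))"
proof -
  let ?I = "Collect packed" and ?e = "\<lambda>u. (- 1) ^ word_max u :: real"
  let ?M = "M_ser :: nat list \<Rightarrow> 'a ncseries"
  have K: "inj_on K_fun ?I" "independent (K_fun ` ?I)"
    by (rule independent_familyI; rule K_fun_sum_zero; assumption)+
  have M: "inj_on ?M ?I" "independent (?M ` ?I)"
    by (rule independent_familyI; rule M_ser_sum_zero[OF assms]; assumption)+
  obtain \<alpha> where \<alpha>: "linear \<alpha>" "\<forall>x\<in>K_fun ` ?I. \<alpha> x = ?e (inv_into ?I K_fun x) *\<^sub>R ?M (inv_into ?I K_fun x)"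
    using linear_independent_extend[OF K(2), of "\<lambda>x. ?e (inv_into ?I K_fun x) *\<^sub>R ?M (inv_into ?I K_fun x)"]
    by blast
  then have \<alpha>_K: "\<alpha> (K_fun u) = ?e u *\<^sub>R ?M u" if "packed u" for u
    using that inv_into_f_f[OF K(1), of u] by simp
  \<comment> \<open>The inverse is obtained in the same way, by extending from the basis of monomial series.\<close>
  obtain \<gamma> where \<gamma>: "linear \<gamma>" "\<forall>x\<in>?M ` ?I. \<gamma> x = ?e (inv_into ?I ?M x) *\<^sub>R K_fun (inv_into ?I ?M x)"
    using linear_independent_extend[OF M(2), of "\<lambda>x. ?e (inv_into ?I ?M x) *\<^sub>R K_fun (inv_into ?I ?M x)"]
    by blast
  then have \<gamma>_M: "\<gamma> (?M u) = ?e u *\<^sub>R K_fun u" if "packed u" for u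
    using that inv_into_f_f[OF M(1), of u] by simp
  have ee: "?e u * ?e u = 1" for u by (simp add: power_mult_distrib[symmetric])
  have \<gamma>\<alpha>: "(\<gamma> \<circ> \<alpha>) f = id f" if "f \<in> P_alg" for f
  proof (rule linear_eq_on_span[where f = "\<gamma> \<circ> \<alpha>" and g = id and B = "K_fun ` ?I"])
    show "linear (\<gamma> \<circ> \<alpha>)" by (rule linear_compose[OF \<alpha>(1) \<gamma>(1)])
    show "linear (id :: funalg \<Rightarrow> funalg)" by (rule linear_id)
    show "f \<in> span (K_fun ` ?I)" using that by (simp add: P_alg_eq_span)
    show "(\<gamma> \<circ> \<alpha>) x = id x" if "x \<in> K_fun ` ?I" for x
      using that ee by (auto simp: \<alpha>_K \<gamma>_M linear_scale[OF \<gamma>(1)])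
  qed
  have \<alpha>\<gamma>: "(\<alpha> \<circ> \<gamma>) f = id f" if "f \<in> WQSym" for f
  proof (rule linear_eq_on_span[where f = "\<alpha> \<circ> \<gamma>" and g = id and B = "?M ` ?I"])
    show "linear (\<alpha> \<circ> \<gamma>)" by (rule linear_compose[OF \<gamma>(1) \<alpha>(1)])
    show "linear (id :: 'a ncseries \<Rightarrow> 'a ncseries)" by (rule linear_id)
    show "f \<in> span (?M ` ?I)" using that by (simp add: WQSym_eq_span)
    show "(\<alpha> \<circ> \<gamma>) x = id x" if "x \<in> ?M ` ?I" for x
      using that ee by (auto simp: \<alpha>_K \<gamma>_M linear_scale[OF \<alpha>(1)])
  qed
  have "\<alpha> (K_fun u) \<in> span (?M ` ?I)" if "packed u" for u
    unfolding \<alpha>_K[OF that] by (intro span_scale span_base imageI) (simp add: that)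
  then have \<alpha>_img: "\<alpha> ` P_alg \<subseteq> WQSym"
    unfolding P_alg_eq_span WQSym_eq_span linear_span_image[OF \<alpha>(1), symmetric]
    by (intro span_minimal subspace_span) auto
  have "\<gamma> (?M u) \<in> span (K_fun ` ?I)" if "packed u" for u
    unfolding \<gamma>_M[OF that] by (intro span_scale span_base imageI) (simp add: that)
  then have \<gamma>_img: "\<gamma> ` WQSym \<subseteq> P_alg"
    unfolding P_alg_eq_span WQSym_eq_span linear_span_image[OF \<gamma>(1), symmetric]
    by (intro span_minimal subspace_span) auto
  have bij: "bij_betw \<alpha> P_alg WQSym"
    by (rule bij_betw_byWitness[of _ \<gamma>]) (use \<gamma>\<alpha> \<alpha>\<gamma> \<alpha>_img \<gamma>_img in auto)
  have mult: "\<alpha> (x * y) = \<alpha> x * \<alpha> y" if "x \<in> P_alg" "y \<in> P_alg" for x y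
  proof (rule linear_mult_on_span[OF \<alpha>(1)])
    show "x \<in> span (K_fun ` ?I)" "y \<in> span (K_fun ` ?I)" using that by (simp_all add: P_alg_eq_span)
    fix a b assume "a \<in> K_fun ` ?I" "b \<in> K_fun ` ?I"
    then obtain u v where uv: "a = K_fun u" "b = K_fun v" "packed u" "packed v" by auto
    have "\<alpha> (a * b) = (\<Sum>w\<in>conv_words u v. (- 1) ^ (word_max u + word_max v + word_max w) *\<^sub>R \<alpha> (K_fun w))"
      by (simp add: uv K_fun_mult linear_sum[OF \<alpha>(1)] linear_scale[OF \<alpha>(1)])
    also have "\<dots> = (\<Sum>w\<in>conv_words u v. (?e u * ?e v) *\<^sub>R ?M w)"
    proof (rule sum.cong[OF refl])
      fix w assume "w \<in> conv_words u v"
      then have "\<alpha> (K_fun w) = ?e w *\<^sub>R ?M w" by (intro \<alpha>_K) (simp add: conv_words_def)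
      moreover have "(- 1) ^ (word_max u + word_max v + word_max w) * ?e w = ?e u * ?e v"
        using ee[of w] by (simp add: power_add)
      ultimately show "(- 1) ^ (word_max u + word_max v + word_max w) *\<^sub>R \<alpha> (K_fun w) = (?e u * ?e v) *\<^sub>R ?M w"
        by simp
    qed
    also have "\<dots> = \<alpha> a * \<alpha> b"
      by (simp add: uv \<alpha>_K M_ser_mult scaleR_sum_right mult.commute)
    finally show "\<alpha> (a * b) = \<alpha> a * \<alpha> b" .
  qed
  have \<alpha>_C: "\<alpha> (C_fun u) = ?e u *\<^sub>R Phi u" if u: "packed u" for u
  proof -
    have "\<alpha> (C_fun u) = (\<Sum>v | finer_word v u. (- 1) ^ (word_max v + word_max u) *\<^sub>R \<alpha> (K_fun v))"
      by (simp add: C_fun_expansion[OF u] linear_sum[OF \<alpha>(1)] linear_scale[OF \<alpha>(1)])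
    also have "\<dots> = (\<Sum>v | finer_word v u. ?e u *\<^sub>R ?M v)"
    proof (rule sum.cong[OF refl])
      fix v assume "v \<in> {v. finer_word v u}"
      then have "\<alpha> (K_fun v) = ?e v *\<^sub>R ?M v" by (intro \<alpha>_K) (simp add: finer_word_def)
      then show "(- 1) ^ (word_max v + word_max u) *\<^sub>R \<alpha> (K_fun v) = ?e u *\<^sub>R ?M v"
        using ee[of v] by (simp add: power_add mult.commute mult.left_commute)
    qed
    finally show ?thesis by (simp add: Phi_def scaleR_sum_right)
  qed
  have iso: "is_algebra_iso P_alg WQSym \<alpha>"
    unfolding is_algebra_iso_def
  proof (intro conjI ballI)
    show "is_subalgebra P_alg" unfolding P_alg_eq_span by (rule subalgebra_span_K)
    show "is_subalgebra (WQSym :: 'a ncseries set)" by (rule subalgebra_WQSym)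
    show "bij_betw \<alpha> P_alg WQSym" by (rule bij)
    show "linear_on_subspace P_alg \<alpha>"
      by (simp add: linear_on_subspace_def linear_add[OF \<alpha>(1)] linear_scale[OF \<alpha>(1)])
    show "\<alpha> 1 = 1" using \<alpha>_K[of "[]"] by (simp add: K_fun_Nil M_ser_Nil)
  qed (rule mult)
  have C_in: "C_fun u \<in> P_alg" if "packed u" for u
    unfolding P_alg_eq_span by (rule C_fun_in_span_K[OF that])
  have P_sub: "subspace P_alg" unfolding P_alg_eq_span by (rule subspace_span)
  have unique: "\<beta> f = \<alpha> f"
    if \<beta>: "linear_on_subspace P_alg \<beta>" "\<forall>u. packed u \<longrightarrow> \<beta> (C_fun u) = ?e u *\<^sub>R Phi u" and f: "f \<in> P_alg"
    for \<beta> :: "funalg \<Rightarrow> 'a ncseries" and f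
  proof -
    have add: "\<beta> (x + y) = \<beta> x + \<beta> y" if "x \<in> P_alg" "y \<in> P_alg" for x y
      using \<beta>(1) that by (simp add: linear_on_subspace_def)
    have scale: "\<beta> (c *\<^sub>R x) = c *\<^sub>R \<beta> x" if "x \<in> P_alg" for c x
      using \<beta>(1) that by (simp add: linear_on_subspace_def)
    have zero: "\<beta> 0 = 0" using scale[OF subspace_0[OF P_sub], of 0] by simp
    have "f \<in> span (C_fun ` ?I)"
    proof -
      have "K_fun ` ?I \<subseteq> span (C_fun ` ?I)" using K_fun_in_span_C by auto
      then have "span (K_fun ` ?I) \<subseteq> span (C_fun ` ?I)" by (rule span_minimal) (rule subspace_span)
      then show ?thesis using f by (auto simp: P_alg_eq_span)
    qed
    then have "f \<in> P_alg \<and> \<beta> f = \<alpha> f"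
    proof (rule span_induct)
      show "subspace {f. f \<in> P_alg \<and> \<beta> f = \<alpha> f}"
        using P_sub by (auto simp: subspace_def add scale zero linear_add[OF \<alpha>(1)]
            linear_scale[OF \<alpha>(1)] linear_0[OF \<alpha>(1)])
      fix x assume "x \<in> C_fun ` ?I"
      then show "x \<in> P_alg \<and> \<beta> x = \<alpha> x" using C_in \<alpha>_C \<beta>(2) by auto
    qed
    then show ?thesis by simp
  qed
  show ?thesis using C_in iso \<alpha>_C unique by blast
qed

end
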